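(* (1) For every direct product of (finite) regular permutation groups $G = G_1 \times \cdots \times G_n \leq \mathrm{Sym}(G_1\cup\cdots\cup G_n)$ (acting naturally on the disjoint union of the $G_i$), the problem $\textsc{Decide}(\Sigma_G)$ can be solved in time $\mathcal O\big(\mathrm{ar}(\mathbf A)\, \| \mathbf A \|^{n (|G| + \sum_{i=1}^n |G_i|)}\big)$. (2) For every cyclic loop condition $\Sigma_{\langle \pi \rangle}$ (i.e. for every $m\in\mathbb N$ and every single permutation $\pi\in\mathrm{Sym}(m)$), the problem $\textsc{Decide}(\Sigma_{\langle \pi \rangle})$ is in $\mathsf{P}$.
   Context: A finite algebra $\mathbf A=(A,f_1,\dots,f_r)$ is a finite non-empty set $A$ with a finite list of finitary operations $f_i\colon A^{k_i}\to A$. $\mathrm{ar}(\mathbf A)$ is the maximal arity of a basic operation, and $\|\mathbf A\|=\sum_{i=1}^r|A|^{k_i}$ is the input size when the algebra is given by its operation tables. $\mathsf{Clo}(\mathbf A)$ is the set of term operations of $\mathbf A$, i.e. all operations obtained by composing basic operations and projections. All permutation groups act on finite sets. For $G \leq \mathrm{Sym}(X)$, $X$ finite, and $t\colon A^X\to A$, write $t^\pi((x_i)_{i\in X}) = t((x_{\pi(i)})_{i\in X})$. $\Sigma_G$ is the set of identities $t\approx t^\pi$, $\pi\in G$; $\mathbf A$ satisfies $\Sigma_G$ if there is an $X$-ary $t\in\mathsf{Clo}(\mathbf A)$ with $t(\overline x)=t^\pi(\overline x)$ for all $\pi\in G$ and $\overline x\in A^X$. $\textsc{Decide}(\Sigma)$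 is the decision problem: given a finite algebra $\mathbf A$ (by operation tables), decide whether $\mathbf A$ satisfies $\Sigma$. The group is fixed and not part of the input; implicit constants may depend on it. A regular permutation group $H\leq\mathrm{Sym}(H)$ is a group acting on itself by left translation. The natural action on the disjoint union is $(\pi_1,\ldots,\pi_n)(z)=\pi_i(z)$ for $z\in G_i$. $\langle\pi\rangle$ is the permutation group generated by $\pi$. *)

theory Defs
  imports
    "HOL-Algebra.Sym_Groups"
    "HOL-Algebra.Product_Groups"
    "HOL-Computational_Algebra.Polynomial"
    "HOL-Library.FuncSet"
    "HOL-Library.Log_Nat"
begin

section \<open>Finite algebras, term operations, loop conditions\<close>

text \<open>
  A basic operation is given by its arity and a function on argument lists; only the values on
  lists over the universe of the length given by the arity are relevant.
\<close>

record 'a algebra =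
  universe :: "'a set"
  operations :: "(nat \<times> ('a list \<Rightarrow> 'a)) list"

definition finite_algebra :: "'a algebra \<Rightarrow> bool" where
  "finite_algebra A \<longleftrightarrow> finite (universe A) \<and> universe A \<noteq> {} \<and>
     (\<forall>(k, f) \<in> set (operations A). \<forall>xs. length xs = k \<and> set xs \<subseteq> universe A \<longrightarrow> f xs \<in> universe A)"

definition max_arity :: "'a algebra \<Rightarrow> nat" where
  "max_arity A = Max (insert 0 (fst ` set (operations A)))"

definition table_size :: "'a algebra \<Rightarrow> nat" where
  "table_size A = (\<Sum>(k, f) \<leftarrow> operations A. card (universe A) ^ k)"

text \<open>
  The \<open>X\<close>-ary term operations. An argument tuple is a function \<open>x\<close> on the index set \<open>X\<close>; outside
  \<open>X \<rightarrow>\<^sub>E universe A\<close> the values of a term operation have no meaning.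
\<close>

inductive_set term_ops :: "'a algebra \<Rightarrow> 'x set \<Rightarrow> (('x \<Rightarrow> 'a) \<Rightarrow> 'a) set"
  for A :: "'a algebra" and X :: "'x set" where
  proj: "i \<in> X \<Longrightarrow> (\<lambda>x. x i) \<in> term_ops A X"
| comp: "(k, f) \<in> set (operations A) \<Longrightarrow> length ts = k \<Longrightarrow> (\<And>t. t \<in> set ts \<Longrightarrow> t \<in> term_ops A X)
    \<Longrightarrow> (\<lambda>x. f (map (\<lambda>t. t x) ts)) \<in> term_ops A X"

text \<open>
  \<open>G\<close> is a set of permutations of \<open>X\<close> that fix every point outside \<open>X\<close>, so \<open>x \<circ> \<pi>\<close> is again in
  \<open>X \<rightarrow>\<^sub>E universe A\<close>.
\<close>

definition satisfies_loop :: "'a algebra \<Rightarrow> 'x set \<Rightarrow> ('x \<Rightarrow> 'x) set \<Rightarrow> bool" where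
  "satisfies_loop A X G \<longleftrightarrow>
     (\<exists>t \<in> term_ops A X. \<forall>\<pi> \<in> G. \<forall>x \<in> X \<rightarrow>\<^sub>E universe A. t x = t (x \<circ> \<pi>))"


section \<open>Direct products of regular permutation groups\<close>

definition disjoint_carriers :: "nat \<Rightarrow> (nat \<Rightarrow> 'g monoid) \<Rightarrow> (nat \<times> 'g) set" where
  "disjoint_carriers n G = (SIGMA i:{..<n}. carrier (G i))"

definition translation :: "nat \<Rightarrow> (nat \<Rightarrow> 'g monoid) \<Rightarrow> (nat \<Rightarrow> 'g) \<Rightarrow> nat \<times> 'g \<Rightarrow> nat \<times> 'g" where
  "translation n G p z =
     (if z \<in> disjoint_carriers n G then (fst z, p (fst z) \<otimes>\<^bsub>G (fst z)\<^esub> snd z) else z)"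

definition regular_product :: "nat \<Rightarrow> (nat \<Rightarrow> 'g monoid) \<Rightarrow> (nat \<times> 'g \<Rightarrow> nat \<times> 'g) set" where
  "regular_product n G = translation n G ` carrier (product_group {..<n} G)"


section \<open>Random access machines\<close>

text \<open>
  The random access machine of Cook and Reckhow, with registers holding natural numbers and truncated
  subtraction. In particular there is no multiplication. The input is a finite sequence
  of numbers that is read from left to right; all registers initially hold 0.

  \<^item> \<open>Const i c\<close>: \<open>X\<^sub>i := c\<close>
  \<^item> \<open>Add i j k\<close>: \<open>X\<^sub>i := X\<^sub>j + X\<^sub>k\<close>
  \<^item> \<open>Sub i j k\<close>: \<open>X\<^sub>i := X\<^sub>j - X\<^sub>k\<close>
  \<^item> \<open>Load i j\<close>: \<open>X\<^sub>i := X\<^sub>r\<close> where \<open>r = X\<^sub>j\<close>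
  \<^item> \<open>Store i j\<close>: \<open>X\<^sub>r := X\<^sub>j\<close> where \<open>r = X\<^sub>i\<close>
  \<^item> \<open>Jump j l\<close>: continue at instruction \<open>l\<close> if \<open>X\<^sub>j > 0\<close>
  \<^item> \<open>Read i l\<close>: \<open>X\<^sub>i :=\<close> next input number; continue at instruction \<open>l\<close> if the input is exhausted
\<close>

datatype instr =
    Const nat nat
  | Add nat nat nat
  | Sub nat nat nat
  | Load nat nat
  | Store nat nat
  | Jump nat nat
  | Read nat nat

text \<open>Program counter, registers, unread input.\<close>

type_synonym config = "nat \<times> (nat \<Rightarrow> nat) \<times> nat list"

fun exec :: "instr \<Rightarrow> config \<Rightarrow> config" where
  "exec (Const i c) (pc, X, w) = (Suc pc, X(i := c), w)"
| "exec (Add i j k) (pc, X, w) = (Suc pc, X(i := X j + X k), w)"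
| "exec (Sub i j k) (pc, X, w) = (Suc pc, X(i := X j - X k), w)"
| "exec (Load i j) (pc, X, w) = (Suc pc, X(i := X (X j)), w)"
| "exec (Store i j) (pc, X, w) = (Suc pc, X(X i := X j), w)"
| "exec (Jump j l) (pc, X, w) = (if X j > 0 then l else Suc pc, X, w)"
| "exec (Read i l) (pc, X, w) =
     (case w of [] \<Rightarrow> (l, X, []) | a # w' \<Rightarrow> (Suc pc, X(i := a), w'))"

definition halted :: "instr list \<Rightarrow> config \<Rightarrow> bool" where
  "halted p c \<longleftrightarrow> fst c \<ge> length p"

definition step :: "instr list \<Rightarrow> config \<Rightarrow> config" where
  "step p c = (if halted p c then c else exec (p ! fst c) c)"

definition run :: "instr list \<Rightarrow> nat list \<Rightarrow> nat \<Rightarrow> config" where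
  "run p w t = (step p ^^ t) (0, (\<lambda>_. 0), w)"

definition accepting :: "config \<Rightarrow> bool" where
  "accepting c \<longleftrightarrow> fst (snd c) 0 > 0"

text \<open>Logarithmic cost: an instruction costs the bit lengths of the numbers it processes.\<close>

definition num_size :: "nat \<Rightarrow> nat" where
  "num_size x = Suc (floorlog 2 x)"

fun instr_cost :: "instr \<Rightarrow> config \<Rightarrow> nat" where
  "instr_cost (Const i c) (pc, X, w) = 1"
| "instr_cost (Add i j k) (pc, X, w) = num_size (X j) + num_size (X k)"
| "instr_cost (Sub i j k) (pc, X, w) = num_size (X j) + num_size (X k)"
| "instr_cost (Load i j) (pc, X, w) = num_size (X j) + num_size (X (X j))"
| "instr_cost (Store i j) (pc, X, w) = num_size (X i) + num_size (X j)"
| "instr_cost (Jump j l) (pc, X, w) = num_size (X j)"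
| "instr_cost (Read i l) (pc, X, w) = (case w of [] \<Rightarrow> 1 | a # w' \<Rightarrow> num_size a)"

definition step_cost :: "instr list \<Rightarrow> config \<Rightarrow> nat" where
  "step_cost p c = (if halted p c then 0 else instr_cost (p ! fst c) c)"

definition log_cost :: "instr list \<Rightarrow> nat list \<Rightarrow> nat \<Rightarrow> nat" where
  "log_cost p w t = (\<Sum>s<t. step_cost p (run p w s))"

definition input_size :: "nat list \<Rightarrow> nat" where
  "input_size w = (\<Sum>a \<leftarrow> w. num_size a)"

text \<open>
  Random access machines under the logarithmic cost measure and Turing machines simulate each other
  with polynomial overhead, so this is the usual class \<open>P\<close>, for languages of finite sequences of
  numbers whose length is measured in bits.
\<close>

definition class_P :: "nat list set set" where
  "class_P = {L. \<exists>p (q :: nat poly). \<forall>w. \<exists>t. halted p (run p w t) \<and>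
     log_cost p w t \<le> poly q (input_size w) \<and> (accepting (run p w t) \<longleftrightarrow> w \<in> L)}"


section \<open>The decision problem\<close>

text \<open>
  Every finite algebra is, up to renaming its elements, one with universe \<open>{..<N}\<close>. It is
  presented by \<open>N\<close>, the number of its operations and, for each operation, the arity followed by
  the table of values in lexicographic order of the arguments.
\<close>

definition tabular :: "nat algebra \<Rightarrow> bool" where
  "tabular A \<longleftrightarrow> finite_algebra A \<and> universe A = {..<card (universe A)}"

definition encode :: "nat algebra \<Rightarrow> nat list" where
  "encode A = card (universe A) # length (operations A) #
     concat (map (\<lambda>(k, f). k # map f (product_lists (replicate k [0..<card (universe A)])))
       (operations A))"

definition Decide :: "'x set \<Rightarrow> ('x \<Rightarrow> 'x) set \<Rightarrow> nat list set" where
  "Decide X G = {encode A | A. tabular A \<and> satisfies_loop A X G}"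

text \<open>
  The instances are algebras, time is the number of executed instructions (uniform cost), and
  the constant \<open>c\<close> is the one of the \<open>O\<close>-notation.
\<close>

definition solvable_in_time_O :: "nat list set \<Rightarrow> (nat algebra \<Rightarrow> nat) \<Rightarrow> bool" where
  "solvable_in_time_O L T \<longleftrightarrow> (\<exists>p c. \<forall>A. tabular A \<longrightarrow>
     (\<exists>t \<le> c * T A. halted p (run p (encode A) t) \<and>
       (accepting (run p (encode A) t) \<longleftrightarrow> encode A \<in> L)))"

end

theory Submission
  imports Defs "HOL-Library.Countable" "HOL-Library.Countable_Set"
begin

text \<open>
  Let \<open>G\<close> be a permutation group on a finite set \<open>X\<close> whose point stabilizers are normal, and let \<open>M\<close>
  be an upper bound on the number of different stabilizers. The algebra \<open>A\<close> satisfies the loop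
  condition of \<open>G\<close> as soon as for any \<open>M\<close> tuples in \<open>A\<^sup>X\<close> some term operation is invariant at each of
  them (\<open>local_to_global\<close>). The idea is to plug term operations into a term operation. If
  \<open>\<Phi> : A\<^sup>X \<rightarrow> A\<^sup>X\<close> has term operations as components and commutes with a subgroup \<open>H\<close>, and \<open>s\<close> is
  invariant at \<open>\<Phi> a\<close>, then \<open>s \<circ> \<Phi>\<close> is invariant under \<open>H\<close> at \<open>a\<close>. Such maps \<open>\<Phi>\<close> can be
  built from term operations that are invariant under the smaller groups \<open>H \<inter> N\<close>, with \<open>N\<close> a
  stabilizer not containing \<open>H\<close>. So one climbs from the trivial group to \<open>G\<close> through
  intersections of stabilizers. Every step uses up one of the \<open>M\<close> tuples, and there are at most
  \<open>M\<close> steps.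

  For fixed tuples \<open>a\<^sub>1, \<dots>, a\<^sub>M\<close> the lists of values of term operations at all \<open>a\<^sub>j \<circ> g\<close> are the
  elements of the subalgebra of \<open>A\<close> to the power \<open>M * |G|\<close> that is generated by \<open>|X|\<close> elements
  (\<open>subpower_term\<close>), and one looks for an element that is constant on each of the \<open>M\<close> blocks
  (\<open>scheme_exists\<close>). The subalgebra is generated by a queue: when an element becomes the head,
  the operations are applied to all arguments that contain it and otherwise earlier elements only
  (\<open>wp_close_code\<close>). Thus an operation of arity \<open>k\<close> is applied at most \<open>k\<close> times to the same
  arguments. With \<open>N\<close> elements, \<open>r\<close> operations and arities at most \<open>\<kappa>\<close>, all searches together
  cost about \<open>r * \<kappa>\<^sup>2\<close> times \<open>N\<close> to the power \<open>M * |X| + \<kappa> * M * |G|\<close>, and up to a constant factor this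
  is at most the size of the tables to the power \<open>M * |X| + M * |G|\<close> (\<open>search_time_core\<close>).

  In a direct product of \<open>n\<close> regular groups, the stabilizer of a point of the \<open>i\<close>-th component
  is the kernel of the \<open>i\<close>-th projection. Hence stabilizers are normal and \<open>M = n\<close> is possible.
  A cyclic group is abelian, so all its subgroups are normal, and any large enough \<open>M\<close> that depends
  only on the group gives a polynomial bound. The logarithmic cost is then polynomial, too, since without
  multiplication a number gains at most one bit per step (\<open>log_cost_le\<close>). For membership in \<open>P\<close>
  the program must also reject words that are no encodings, in time polynomial in their length
  (\<open>wp_validate_code\<close>).

  The programs are written in a small structured language. Its states contain a clock, so that the
  weakest precondition calculus treats correctness and running time together, and a compiler
  translates it to the machine with a constant factor (\<open>compiled_program_exists\<close>).
\<close>

section \<open>The local criterion\<close>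

lemma term_ops_closed:
  assumes "finite_algebra A" "t \<in> term_ops A X" "x \<in> X \<rightarrow>\<^sub>E universe A"
  shows "t x \<in> universe A"
  using assms(2)
proof induction
  case (proj i)
  then show ?case using assms(3) by auto
next
  case (comp k f ts)
  have "length (map (\<lambda>t. t x) ts) = k" "set (map (\<lambda>t. t x) ts) \<subseteq> universe A"
    using comp by auto
  then show ?case using assms(1) comp(1) unfolding finite_algebra_def by blast
qed

lemma term_ops_subst:
  assumes "t \<in> term_ops A X" "\<And>z. z \<in> X \<Longrightarrow> u z \<in> term_ops A Y"
  shows "(\<lambda>x. t (\<lambda>z. if z \<in> X then u z x else undefined)) \<in> term_ops A Y"
  using assms(1)
proof induction
  case (proj i)
  then show ?case using assms(2) by simp
next
  case (comp k f ts)
  have "(\<lambda>x. f (map (\<lambda>t. t x) (map (\<lambda>t x. t (\<lambda>z. if z \<in> X then u z x else undefined)) ts)))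
      \<in> term_ops A Y"
    using comp by (intro term_ops.comp) auto
  then show ?case by (simp add: comp_def)
qed

lemma term_ops_minor:
  assumes "t \<in> term_ops A X" "\<And>z. z \<in> X \<Longrightarrow> h z \<in> X"
  shows "(\<lambda>x. t (x \<circ> h)) \<in> term_ops A X"
  using assms(1)
proof induction
  case (proj i)
  then show ?case using assms(2) term_ops.proj[of "h i" X A] by simp
next
  case (comp k f ts)
  have "(\<lambda>x. f (map (\<lambda>t. t x) (map (\<lambda>t x. t (x \<circ> h)) ts))) \<in> term_ops A X"
    using comp by (intro term_ops.comp) auto
  then show ?case by (simp add: comp_def)
qed

definition invariant_at :: "('x \<Rightarrow> 'x) set \<Rightarrow> (('x \<Rightarrow> 'a) \<Rightarrow> 'a) \<Rightarrow> ('x \<Rightarrow> 'a) \<Rightarrow> bool" where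
  "invariant_at H t x \<longleftrightarrow> (\<forall>h\<in>H. t (x \<circ> h) = t x)"

text \<open>
  The last assumption says that point stabilizers depend only on the orbit of the point, that is,
  that they are normal subgroups.
\<close>

locale normal_stabilizers =
  fixes X :: "'x set" and G :: "('x \<Rightarrow> 'x) set"
  assumes finite_X: "finite X" and finite_G: "finite G"
    and id_in: "id \<in> G"
    and comp_in: "g \<in> G \<Longrightarrow> h \<in> G \<Longrightarrow> g \<circ> h \<in> G"
    and inverse_in: "g \<in> G \<Longrightarrow> \<exists>h\<in>G. h \<circ> g = id \<and> g \<circ> h = id"
    and maps: "g \<in> G \<Longrightarrow> z \<in> X \<Longrightarrow> g z \<in> X"
    and fixes_outside: "g \<in> G \<Longrightarrow> z \<notin> X \<Longrightarrow> g z = z"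
    and stabilizer_orbit: "g \<in> G \<Longrightarrow> h \<in> G \<Longrightarrow> z \<in> X \<Longrightarrow> h z = z \<Longrightarrow> h (g z) = g z"
begin

definition stab :: "'x \<Rightarrow> ('x \<Rightarrow> 'x) set" where
  "stab z = {g \<in> G. g z = z}"

definition stab_set :: "'x set \<Rightarrow> ('x \<Rightarrow> 'x) set" where
  "stab_set Z = {g \<in> G. \<forall>z\<in>Z. g z = z}"

text \<open>
  For normal stabilizers, \<open>stab z\<close> is a label of the orbit of \<open>z\<close>. The number of labels of orbits
  that are not fixed pointwise by \<open>stab_set Z\<close> is what the induction in \<open>local_to_global\<close> is about.
\<close>

definition moved_labels :: "'x set \<Rightarrow> ('x \<Rightarrow> 'x) set set" where
  "moved_labels Z = {stab z |z. z \<in> X \<and> \<not> stab_set Z \<subseteq> stab z}"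

lemma stab_orbit: "g \<in> G \<Longrightarrow> z \<in> X \<Longrightarrow> stab (g z) = stab z"
proof (intro equalityI subsetI)
  fix h assume g: "g \<in> G" "z \<in> X" and "h \<in> stab (g z)"
  then have h: "h \<in> G" "h (g z) = g z" by (auto simp: stab_def)
  obtain k where k: "k \<in> G" "k \<circ> g = id" using inverse_in[OF g(1)] by blast
  have "h (k (g z)) = k (g z)" using stabilizer_orbit[OF k(1) h(1) maps[OF g] h(2)] .
  moreover have "k (g z) = z" using k(2) by (metis comp_apply id_apply)
  ultimately show "h \<in> stab z" using h(1) by (simp add: stab_def)
qed (auto simp: stab_def stabilizer_orbit)

lemma stab_set_group:
  "id \<in> stab_set Z" "g \<in> stab_set Z \<Longrightarrow> h \<in> stab_set Z \<Longrightarrow> g \<circ> h \<in> stab_set Z"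
  "g \<in> stab_set Z \<Longrightarrow> \<exists>h\<in>stab_set Z. h \<circ> g = id \<and> g \<circ> h = id"
  "stab_set Z \<subseteq> G" "stab_set (insert z Z) = stab_set Z \<inter> stab z"
proof -
  assume g: "g \<in> stab_set Z"
  then obtain h where h: "h \<in> G" "h \<circ> g = id" "g \<circ> h = id" using inverse_in by (auto simp: stab_set_def)
  have "h z = z" if "z \<in> Z" for z
  proof -
    have "h (g z) = z" using h(2) by (metis comp_apply id_apply)
    then show ?thesis using g that by (simp add: stab_set_def)
  qed
  then show "\<exists>h\<in>stab_set Z. h \<circ> g = id \<and> g \<circ> h = id" using h by (auto simp: stab_set_def)
qed (auto simp: stab_set_def stab_def id_in comp_in)

lemma point_comp: "x \<in> X \<rightarrow>\<^sub>E U \<Longrightarrow> g \<in> G \<Longrightarrow> x \<circ> g \<in> X \<rightarrow>\<^sub>E U"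
  by (auto simp: PiE_iff extensional_def maps fixes_outside)

text \<open>
  Choose a representative of every orbit of \<open>H\<close> and, for every point \<open>z\<close>, an element of \<open>H\<close>
  that moves the representative to \<open>z\<close>.
\<close>

lemma transversal_exists:
  assumes "H = stab_set Z"
  shows "\<exists>\<sigma>. (\<forall>z. \<sigma> z \<in> H) \<and>
    (\<forall>h\<in>H. \<forall>z\<in>X. \<exists>k\<in>H \<inter> stab z. \<sigma> (h z) \<circ> k = h \<circ> \<sigma> z)"
proof -
  note grp = stab_set_group[where Z = Z, folded assms]
  define \<rho> where "\<rho> z = (SOME y. \<exists>h\<in>H. z = h y)" for z
  have \<rho>: "\<exists>h\<in>H. z = h (\<rho> z)" for z
    unfolding \<rho>_def by (rule someI[of "\<lambda>y. \<exists>h\<in>H. z = h y" z]) (rule bexI[OF _ grp(1)], simp)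
  define \<sigma> where "\<sigma> z = (SOME h. h \<in> H \<and> z = h (\<rho> z))" for z
  have \<sigma>: "\<sigma> z \<in> H" "\<sigma> z (\<rho> z) = z" for z
  proof -
    have "\<exists>h. h \<in> H \<and> z = h (\<rho> z)" using \<rho> by blast
    from someI_ex[OF this, folded \<sigma>_def] show "\<sigma> z \<in> H" "\<sigma> z (\<rho> z) = z" by simp_all
  qed
  have \<rho>_orbit: "\<rho> (h z) = \<rho> z" if h: "h \<in> H" for h z
  proof -
    obtain h' where h': "h' \<in> H" "h' \<circ> h = id" using grp(3)[OF h] by blast
    have "(\<exists>k\<in>H. h z = k y) \<longleftrightarrow> (\<exists>k\<in>H. z = k y)" for y
    proof
      assume "\<exists>k\<in>H. h z = k y"
      then obtain k where "k \<in> H" "h z = k y" by blast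
      then have "z = (h' \<circ> k) y" using h'(2) by (metis comp_apply id_apply)
      then show "\<exists>k\<in>H. z = k y" using grp(2)[OF h'(1) \<open>k \<in> H\<close>] by blast
    next
      assume "\<exists>k\<in>H. z = k y"
      then obtain k where "k \<in> H" "h z = (h \<circ> k) y" by auto
      then show "\<exists>k\<in>H. h z = k y" using grp(2)[OF h] by blast
    qed
    then show ?thesis unfolding \<rho>_def by simp
  qed
  show ?thesis
  proof (intro exI[of _ \<sigma>] conjI allI ballI)
    fix h z assume h: "h \<in> H" and z: "z \<in> X"
    obtain k where k: "k \<in> H" "k \<circ> \<sigma> (h z) = id" "\<sigma> (h z) \<circ> k = id" using grp(3)[OF \<sigma>(1)] by blast
    define l where "l = k \<circ> (h \<circ> \<sigma> z)"
    have l: "l \<in> H" unfolding l_def using grp(2) k(1) h \<sigma>(1) by blast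
    have lz: "\<sigma> (h z) \<circ> l = h \<circ> \<sigma> z" unfolding l_def using k(3) by (metis comp_assoc id_comp)
    have "l (\<rho> z) = k (\<sigma> (h z) (\<rho> (h z)))" unfolding l_def comp_apply \<sigma>(2) by (rule refl)
    also have "\<dots> = \<rho> (h z)" using k(2) by (metis comp_apply id_apply)
    finally have "l (\<rho> z) = \<rho> z" using \<rho>_orbit[OF h] by simp
    moreover have "\<rho> z \<in> X"
    proof (rule ccontr)
      assume "\<rho> z \<notin> X"
      then have "\<sigma> z (\<rho> z) = \<rho> z" using fixes_outside \<sigma>(1) grp(4) by blast
      then show False using \<sigma>(2)[of z] z \<open>\<rho> z \<notin> X\<close> by simp
    qed
    ultimately have "l (\<sigma> z (\<rho> z)) = \<sigma> z (\<rho> z)"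
      using stabilizer_orbit[of "\<sigma> z" l] \<sigma>(1) l grp(4) by blast
    then have "l \<in> H \<inter> stab z" using l grp(4) \<sigma>(2)[of z] by (auto simp: stab_def)
    then show "\<exists>k\<in>H \<inter> stab z. \<sigma> (h z) \<circ> k = h \<circ> \<sigma> z" using lz by blast
  qed (rule \<sigma>(1))
qed

text \<open>
  Let \<open>H = stab_set Z\<close>. If a point \<open>z\<close> is moved by \<open>H\<close>, the intersection of \<open>H\<close> with its
  stabilizer is smaller than \<open>H\<close>, and term operations that are invariant under it everywhere can be
  made invariant under \<open>H\<close> at more and more tuples. One such operation \<open>T N\<close> is kept for every label
  \<open>N\<close>, because all of them are needed for the next equivariant map. The price is one additional
  tuple in the hypothesis, namely the image of the tuple that is added.
\<close>

lemma improve: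
  fixes A :: "'a algebra"
  assumes A: "finite_algebra A"
    and z0: "z0 \<in> X" "\<not> stab_set Z \<subseteq> stab z0"
    and B: "finite B" "card B \<le> m" "B \<subseteq> X \<rightarrow>\<^sub>E universe A"
    and IH: "\<And>z B'. z \<in> X \<Longrightarrow> \<not> stab_set Z \<subseteq> stab z \<Longrightarrow> finite B' \<Longrightarrow> card B' \<le> Suc m \<Longrightarrow>
      B' \<subseteq> X \<rightarrow>\<^sub>E universe A \<Longrightarrow> \<exists>t\<in>term_ops A X.
        (\<forall>x \<in> X \<rightarrow>\<^sub>E universe A. invariant_at (stab_set (insert z Z)) t x) \<and> (\<forall>b\<in>B'. invariant_at G t b)"
  shows "\<exists>t\<in>term_ops A X.
    (\<forall>x \<in> X \<rightarrow>\<^sub>E universe A. invariant_at (stab_set Z) t x) \<and> (\<forall>b\<in>B. invariant_at G t b)"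
proof -
  let ?P = "X \<rightarrow>\<^sub>E universe A"
  define H where "H = stab_set Z"
  note grp = stab_set_group[where Z = Z, folded H_def]
  obtain \<sigma> where \<sigma>: "\<And>z. \<sigma> z \<in> H"
    "\<And>h z. h \<in> H \<Longrightarrow> z \<in> X \<Longrightarrow> \<exists>k\<in>H \<inter> stab z. \<sigma> (h z) \<circ> k = h \<circ> \<sigma> z"
    using transversal_exists[OF H_def] by blast
  define good where "good T S \<longleftrightarrow> (\<forall>N\<in>moved_labels Z. T N \<in> term_ops A X \<and>
      (\<forall>x\<in>?P. invariant_at (H \<inter> N) (T N) x) \<and> (\<forall>b\<in>B. invariant_at G (T N) b) \<and>
      (\<forall>x\<in>S. invariant_at H (T N) x))" for T S
  have labels: "stab z \<in> moved_labels Z" if "z \<in> X" "\<not> H \<subseteq> stab z" for z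
    using that unfolding moved_labels_def H_def by blast
  have P_G: "x \<circ> g \<in> ?P" if "x \<in> ?P" "g \<in> G" for x g using point_comp that by blast
  have P_H: "x \<circ> g \<in> ?P" if "x \<in> ?P" "g \<in> H" for x g using point_comp that grp(4) by blast
  have step: "\<exists>T'. good T' (insert a S)" if T: "good T S" and a: "a \<in> ?P" and S: "S \<subseteq> ?P" for T a S
  proof -
    have T1: "T (stab z) \<in> term_ops A X" and T2: "x \<in> ?P \<Longrightarrow> invariant_at (H \<inter> stab z) (T (stab z)) x"
      and T3: "b \<in> B \<Longrightarrow> invariant_at G (T (stab z)) b" and T4: "x \<in> S \<Longrightarrow> invariant_at H (T (stab z)) x"
      if "z \<in> X" "\<not> H \<subseteq> stab z" for z x b
      using T labels[OF that] unfolding good_def by blast+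
    \<comment> \<open>On an orbit moved by \<open>H\<close>, the coordinate at \<open>\<sigma> z\<close> applied to the representative is the value at the translate by \<open>\<sigma> z\<close>. The choice of \<open>\<sigma> z\<close> is irrelevant, as the operation is invariant under the stabilizer in \<open>H\<close>.\<close>
    define \<Phi> where "\<Phi> x = (\<lambda>z. if z \<in> X then if H \<subseteq> stab z then x z else T (stab z) (x \<circ> \<sigma> z)
        else undefined)" for x
    have \<Phi>_P: "\<Phi> x \<in> ?P" if x: "x \<in> ?P" for x
    proof (rule PiE_I)
      fix z assume "z \<in> X"
      then show "\<Phi> x z \<in> universe A"
        using x term_ops_closed[OF A T1 P_H[OF x \<sigma>(1)]] by (auto simp: \<Phi>_def)
    qed (simp add: \<Phi>_def)
    have moved_H: "H \<subseteq> stab (g z) \<longleftrightarrow> H \<subseteq> stab z" if "z \<in> X" "g \<in> G" for g z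
      using stab_orbit[OF that(2,1)] by simp
    have equivariant: "\<Phi> (x \<circ> h) = \<Phi> x \<circ> h" if x: "x \<in> ?P" and h: "h \<in> H" for x h
    proof
      fix z
      have hG: "h \<in> G" using h grp(4) by blast
      show "\<Phi> (x \<circ> h) z = (\<Phi> x \<circ> h) z"
      proof (cases "z \<in> X \<and> \<not> H \<subseteq> stab z")
        case True
        obtain k where k: "k \<in> H \<inter> stab z" "\<sigma> (h z) \<circ> k = h \<circ> \<sigma> z" using \<sigma>(2)[OF h] True by blast
        have "x \<circ> h \<circ> \<sigma> z = x \<circ> \<sigma> (h z) \<circ> k" using k(2) by (metis comp_assoc)
        moreover have "T (stab z) (x \<circ> \<sigma> (h z) \<circ> k) = T (stab z) (x \<circ> \<sigma> (h z))"
          using T2[of z "x \<circ> \<sigma> (h z)"] True k(1) P_H[OF x \<sigma>(1)] unfolding invariant_at_def by blast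
        ultimately show ?thesis using True moved_H[OF _ hG] maps[OF hG] stab_orbit[OF hG]
          by (simp add: \<Phi>_def)
      next
        case False
        then show ?thesis using moved_H[OF _ hG] maps[OF hG] fixes_outside[OF hG]
          by (cases "z \<in> X") (auto simp: \<Phi>_def)
      qed
    qed
    \<comment> \<open>At the tuples of \<open>B\<close>, the map commutes with all of \<open>G\<close>: it is constant on the orbits that \<open>H\<close> moves, and the identity on the others.\<close>
    have equivariant_B: "\<Phi> (b \<circ> g) = \<Phi> b \<circ> g" if b: "b \<in> B" and g: "g \<in> G" for b g
    proof
      fix z
      show "\<Phi> (b \<circ> g) z = (\<Phi> b \<circ> g) z"
      proof (cases "z \<in> X \<and> \<not> H \<subseteq> stab z")
        case True
        have "g \<circ> \<sigma> z \<in> G" "\<sigma> (g z) \<in> G" using \<sigma>(1) grp(4) comp_in g by blast+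
        then have "T (stab z) (b \<circ> (g \<circ> \<sigma> z)) = T (stab z) (b \<circ> \<sigma> (g z))"
          using T3[of z b] True b unfolding invariant_at_def by metis
        then show ?thesis using True moved_H[OF _ g] maps[OF g] stab_orbit[OF g]
          by (simp add: \<Phi>_def comp_assoc)
      next
        case False
        then show ?thesis using moved_H[OF _ g] maps[OF g] fixes_outside[OF g]
          by (cases "z \<in> X") (auto simp: \<Phi>_def)
      qed
    qed
    \<comment> \<open>At tuples treated before, the map already produces tuples fixed by \<open>H\<close>, so every operation may follow.\<close>
    have orbit_constant: "\<Phi> x \<circ> h = \<Phi> x" if x: "x \<in> S" and h: "h \<in> H" for x h
    proof
      fix z
      have hG: "h \<in> G" using h grp(4) by blast
      show "(\<Phi> x \<circ> h) z = \<Phi> x z"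
      proof (cases "z \<in> X \<and> \<not> H \<subseteq> stab z")
        case True
        have "T (stab z) (x \<circ> \<sigma> (h z)) = T (stab z) (x \<circ> \<sigma> z)"
          using T4[of z x] True x \<sigma>(1) unfolding invariant_at_def by metis
        then show ?thesis using True moved_H[OF _ hG] maps[OF hG] stab_orbit[OF hG]
          by (simp add: \<Phi>_def)
      next
        case False
        show ?thesis
        proof (cases "z \<in> X")
          case True
          then have "h z = z" using False h by (auto simp: stab_def)
          then show ?thesis by simp
        qed (simp add: fixes_outside[OF hG])
      qed
    qed
    let ?B = "insert (\<Phi> a) (\<Phi> ` B)"
    have B': "finite ?B" "card ?B \<le> Suc m"
      using B card_image_le[OF B(1), of \<Phi>] by (auto simp: card_insert_if)
    have B'': "?B \<subseteq> ?P" using B(3) \<Phi>_P a by blast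
    have "\<exists>s\<in>term_ops A X. (\<forall>x\<in>?P. invariant_at (H \<inter> N) s x) \<and> (\<forall>b\<in>?B. invariant_at G s b)"
      if N: "N \<in> moved_labels Z" for N
    proof -
      obtain z where "z \<in> X" "\<not> H \<subseteq> stab z" "N = stab z"
        using N unfolding moved_labels_def H_def by blast
      then show ?thesis using IH[OF _ _ B' B'', of z] stab_set_group(5)[of z Z] unfolding H_def by simp
    qed
    then obtain s where s: "s N \<in> term_ops A X" "x \<in> ?P \<Longrightarrow> invariant_at (H \<inter> N) (s N) x"
      "b \<in> ?B \<Longrightarrow> invariant_at G (s N) b" if "N \<in> moved_labels Z" for N x b
      by metis
    have "good (\<lambda>N x. s N (\<Phi> x)) (insert a S)"
      unfolding good_def
    proof (intro ballI conjI)
      fix N assume N: "N \<in> moved_labels Z"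
      show "(\<lambda>x. s N (\<Phi> x)) \<in> term_ops A X"
        unfolding \<Phi>_def
      proof (rule term_ops_subst[OF s(1)[OF N], where u = "\<lambda>z x. if H \<subseteq> stab z then x z
          else T (stab z) (x \<circ> \<sigma> z)"])
        fix z assume z: "z \<in> X"
        show "(\<lambda>x. if H \<subseteq> stab z then x z else T (stab z) (x \<circ> \<sigma> z)) \<in> term_ops A X"
        proof (cases "H \<subseteq> stab z")
          case False
          have "\<sigma> z \<in> G" using \<sigma>(1) grp(4) by blast
          then show ?thesis using term_ops_minor[OF T1[OF z False] maps] False by simp
        qed (use z term_ops.proj in simp)
      qed
      show "invariant_at (H \<inter> N) (\<lambda>x. s N (\<Phi> x)) x" if "x \<in> ?P" for x
        using s(2)[OF N \<Phi>_P[OF that]] equivariant[OF that] by (simp add: invariant_at_def)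
      show "invariant_at G (\<lambda>x. s N (\<Phi> x)) b" if "b \<in> B" for b
        using s(3)[OF N, of "\<Phi> b"] equivariant_B that by (simp add: invariant_at_def)
      show "invariant_at H (\<lambda>x. s N (\<Phi> x)) x" if x: "x \<in> insert a S" for x
      proof (cases "x = a")
        case True
        have "s N (\<Phi> a \<circ> h) = s N (\<Phi> a)" if "h \<in> H" for h
          using s(3)[OF N, of "\<Phi> a"] that grp(4) by (auto simp: invariant_at_def)
        then show ?thesis using equivariant[OF a] True by (simp add: invariant_at_def)
      next
        case False
        then show ?thesis using equivariant orbit_constant x S by (auto simp: invariant_at_def)
      qed
    qed
    then show ?thesis by blast
  qed
  have "\<exists>T. good T S" if "finite S" "S \<subseteq> ?P" for S
    using that
  proof (induction S)
    case empty
    have "\<exists>s\<in>term_ops A X. (\<forall>x\<in>?P. invariant_at (H \<inter> N) s x) \<and> (\<forall>b\<in>B. invariant_at G s b)"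
      if N: "N \<in> moved_labels Z" for N
    proof -
      obtain z where "z \<in> X" "\<not> H \<subseteq> stab z" "N = stab z"
        using N unfolding moved_labels_def H_def by blast
      then show ?thesis using IH[of z B] B stab_set_group(5)[of z Z] unfolding H_def by simp
    qed
    then have "\<forall>N\<in>moved_labels Z. \<exists>s. s \<in> term_ops A X \<and>
        (\<forall>x\<in>?P. invariant_at (H \<inter> N) s x) \<and> (\<forall>b\<in>B. invariant_at G s b)"
      by blast
    from bchoice[OF this] obtain T where "\<forall>N\<in>moved_labels Z. T N \<in> term_ops A X \<and>
        (\<forall>x\<in>?P. invariant_at (H \<inter> N) (T N) x) \<and> (\<forall>b\<in>B. invariant_at G (T N) b)" ..
    then show ?case unfolding good_def by (intro exI[of _ T]) simp
  next
    case (insert a S)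
    then obtain T where "good T S" by auto
    then show ?case using step[of T S a] insert.prems by simp
  qed
  moreover have "finite ?P" using A finite_X by (simp add: finite_algebra_def finite_PiE)
  ultimately obtain T where "good T ?P" by blast
  then show ?thesis using labels[OF z0(1)] z0(2) unfolding good_def H_def by blast
qed

text \<open>
  Induction on the number of orbit labels moved by \<open>H = stab_set Z\<close>, hence from the trivial group up
  to \<open>G\<close>: passing from a set \<open>Z\<close> to
  \<open>insert z Z\<close> with \<open>z\<close> moved removes the label of \<open>z\<close>, which pays for the additional tuple. If no
  label is left, \<open>H\<close> is trivial and the hypothesis applies.
\<close>

theorem local_to_global:
  fixes A :: "'a algebra"
  assumes A: "finite_algebra A"
    and M: "card (stab ` X) \<le> M"
    and loc: "\<And>B. finite B \<Longrightarrow> card B \<le> M \<Longrightarrow> B \<subseteq> X \<rightarrow>\<^sub>E universe A \<Longrightarrow>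
      \<exists>t\<in>term_ops A X. \<forall>b\<in>B. invariant_at G t b"
  shows "satisfies_loop A X G"
proof -
  let ?P = "X \<rightarrow>\<^sub>E universe A"
  have "\<exists>t\<in>term_ops A X. (\<forall>x\<in>?P. invariant_at (stab_set Z) t x) \<and> (\<forall>b\<in>B. invariant_at G t b)"
    if "finite B" "card B + card (moved_labels Z) \<le> M" "B \<subseteq> ?P" for B Z
    using that
  proof (induction "card (moved_labels Z)" arbitrary: Z B rule: less_induct)
    case less
    have fin: "finite (moved_labels Z)" for Z
      unfolding moved_labels_def using finite_X by (auto intro: finite_subset[of _ "stab ` X"])
    show ?case
    proof (cases "moved_labels Z = {}")
      case True
      have "h = id" if "h \<in> stab_set Z" for h
      proof
        fix z show "h z = id z"
        proof (cases "z \<in> X")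
          case True
          then have "h \<in> stab z" using \<open>moved_labels Z = {}\<close> that unfolding moved_labels_def by blast
          then show ?thesis by (simp add: stab_def)
        next
          case False
          have "h \<in> G" using that stab_set_group(4) by blast
          then show ?thesis using fixes_outside False by simp
        qed
      qed
      then have "invariant_at (stab_set Z) t x" for t :: "('x \<Rightarrow> 'a) \<Rightarrow> 'a" and x
        unfolding invariant_at_def by (metis comp_id)
      then show ?thesis using loc[of B] less.prems by auto
    next
      case False
      then obtain z0 where z0: "z0 \<in> X" "\<not> stab_set Z \<subseteq> stab z0" unfolding moved_labels_def by blast
      show ?thesis
      proof (rule improve[OF A z0 less.prems(1) order_refl less.prems(3)])
        fix z B'
        assume z: "z \<in> X" "\<not> stab_set Z \<subseteq> stab z"
          and B': "finite B'" "card B' \<le> Suc (card B)" "B' \<subseteq> ?P"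
        have "moved_labels (insert z Z) \<subset> moved_labels Z"
        proof
          show "moved_labels (insert z Z) \<subseteq> moved_labels Z"
            unfolding moved_labels_def stab_set_group(5) by blast
          have "stab z \<in> moved_labels Z" "stab z \<notin> moved_labels (insert z Z)"
            using z unfolding moved_labels_def stab_set_group(5) by auto
          then show "moved_labels (insert z Z) \<noteq> moved_labels Z" by blast
        qed
        from psubset_card_mono[OF fin this]
        show "\<exists>t\<in>term_ops A X. (\<forall>x\<in>?P. invariant_at (stab_set (insert z Z)) t x)
            \<and> (\<forall>b\<in>B'. invariant_at G t b)"
          using less.prems(2) B' by (intro less.hyps) auto
      qed
    qed
  qed
  from this[of "{}" "{}"]
  have "\<exists>t\<in>term_ops A X. \<forall>x\<in>?P. invariant_at (stab_set {}) t x"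
    using M card_mono[of "stab ` X" "moved_labels {}"] finite_X unfolding moved_labels_def by force
  then show ?thesis unfolding satisfies_loop_def invariant_at_def stab_set_def by (simp add: eq_commute) blast
qed

end

section \<open>Subpowers\<close>

inductive_set subpower :: "(nat \<times> ('a list \<Rightarrow> 'a)) list \<Rightarrow> nat \<Rightarrow> 'a list set \<Rightarrow> 'a list set"
  for F :: "(nat \<times> ('a list \<Rightarrow> 'a)) list" and D :: nat and E :: "'a list set" where
  gen: "e \<in> E \<Longrightarrow> e \<in> subpower F D E"
| app: "(k, f) \<in> set F \<Longrightarrow> length es = k \<Longrightarrow> (\<And>e. e \<in> set es \<Longrightarrow> e \<in> subpower F D E) \<Longrightarrow>
    map (\<lambda>d. f (map (\<lambda>e. e ! d) es)) [0..<D] \<in> subpower F D E"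

text \<open>
  Term operations and elements of the generated subalgebra are built by the same rules, projections
  corresponding to generators.
\<close>

lemma subpower_term:
  "e \<in> subpower (operations A) (length ps) ((\<lambda>x. map (\<lambda>p. p x) ps) ` X) \<longleftrightarrow>
   (\<exists>t\<in>term_ops A X. e = map t ps)" (is "_ \<in> ?S \<longleftrightarrow> _")
proof
  assume "e \<in> ?S"
  then show "\<exists>t\<in>term_ops A X. e = map t ps"
  proof induction
    case (gen e)
    then obtain x where "x \<in> X" "e = map (\<lambda>p. p x) ps" by blast
    then show ?case using term_ops.proj[of x X A] by blast
  next
    case (app k f es)
    then obtain T where T: "T e \<in> term_ops A X" "e = map (T e) ps" if "e \<in> set es" for e by metis
    have "(\<lambda>x. f (map (\<lambda>t. t x) (map T es))) \<in> term_ops A X"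
      using app(1,2) T(1) by (intro term_ops.comp) auto
    moreover have "map (\<lambda>d. f (map (\<lambda>e. e ! d) es)) [0..<length ps]
        = map (\<lambda>x. f (map (\<lambda>t. t x) (map T es))) ps"
    proof (rule nth_equalityI)
      fix d assume "d < length (map (\<lambda>d. f (map (\<lambda>e. e ! d) es)) [0..<length ps])"
      then have d: "d < length ps" by simp
      have "e ! d = T e (ps ! d)" if "e \<in> set es" for e
        using arg_cong[OF T(2)[OF that], of "\<lambda>l. l ! d"] d by simp
      then have "f (map (\<lambda>e. e ! d) es) = f (map (\<lambda>e. T e (ps ! d)) es)" by (simp cong: map_cong)
      then show "map (\<lambda>d. f (map (\<lambda>e. e ! d) es)) [0..<length ps] ! d
        = map (\<lambda>x. f (map (\<lambda>t. t x) (map T es))) ps ! d" using d by (simp add: comp_def)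
    qed simp
    ultimately show ?case by blast
  qed
next
  assume "\<exists>t\<in>term_ops A X. e = map t ps"
  then obtain t where "t \<in> term_ops A X" "e = map t ps" by blast
  then show "e \<in> ?S"
  proof (induction arbitrary: e)
    case (proj i)
    then show ?case by (auto intro: subpower.gen)
  next
    case (comp k f ts)
    have "map (\<lambda>d. f (map (\<lambda>e. e ! d) (map (\<lambda>t. map t ps) ts))) [0..<length ps] \<in> ?S"
      using comp by (intro subpower.app[of k]) auto
    moreover have "map (\<lambda>d. f (map (\<lambda>e. e ! d) (map (\<lambda>t. map t ps) ts))) [0..<length ps] = e"
    proof (rule nth_equalityI)
      fix d assume "d < length (map (\<lambda>d. f (map (\<lambda>e. e ! d) (map (\<lambda>t. map t ps) ts))) [0..<length ps])"
      then show "map (\<lambda>d. f (map (\<lambda>e. e ! d) (map (\<lambda>t. map t ps) ts))) [0..<length ps] ! d = e ! d"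
        using comp by (simp add: comp_def)
    qed (simp add: comp)
    ultimately show ?case by simp
  qed
qed

text \<open>Only the values of the operations on the universe matter.\<close>

lemma subpower_cong_subset:
  assumes E: "\<And>e. e \<in> E \<Longrightarrow> length e = D \<and> set e \<subseteq> U"
    and F: "\<And>k f. (k, f) \<in> set F \<Longrightarrow> \<exists>f'. (k, f') \<in> set F' \<and>
      (\<forall>xs. length xs = k \<and> set xs \<subseteq> U \<longrightarrow> f xs = f' xs \<and> f xs \<in> U)"
    and e: "e \<in> subpower F D E"
  shows "e \<in> subpower F' D E \<and> length e = D \<and> set e \<subseteq> U"
  using e
proof induction
  case (gen e)
  then show ?case using E subpower.gen by blast
next
  case (app k f es)
  obtain f' where f': "(k, f') \<in> set F'"
    "\<And>xs. length xs = k \<Longrightarrow> set xs \<subseteq> U \<Longrightarrow> f xs = f' xs \<and> f xs \<in> U"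
    using F[OF app(1)] by blast
  have arg: "length (map (\<lambda>e. e ! d) es) = k \<and> set (map (\<lambda>e. e ! d) es) \<subseteq> U" if "d < D" for d
    using app that by (auto simp: subset_iff)
  have eq: "map (\<lambda>d. f (map (\<lambda>e. e ! d) es)) [0..<D] = map (\<lambda>d. f' (map (\<lambda>e. e ! d) es)) [0..<D]"
    using f'(2) arg by simp
  have "map (\<lambda>d. f' (map (\<lambda>e. e ! d) es)) [0..<D] \<in> subpower F' D E"
    using app f'(1) by (intro subpower.app) auto
  moreover have "f (map (\<lambda>e. e ! d) es) \<in> U" if "d < D" for d
    using f'(2)[of "map (\<lambda>e. e ! d) es"] arg[OF that] by blast
  then have "set (map (\<lambda>d. f (map (\<lambda>e. e ! d) es)) [0..<D]) \<subseteq> U" by auto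
  ultimately show ?case unfolding eq by simp
qed

lemma subpower_closed_set:
  assumes "E \<subseteq> S" "S \<subseteq> subpower F D E"
    and "\<And>k f es. (k, f) \<in> set F \<Longrightarrow> length es = k \<Longrightarrow> set es \<subseteq> S \<Longrightarrow>
      map (\<lambda>d. f (map (\<lambda>e. e ! d) es)) [0..<D] \<in> S"
  shows "S = subpower F D E"
proof
  show "subpower F D E \<subseteq> S"
  proof
    fix e assume "e \<in> subpower F D E"
    then show "e \<in> S"
    proof induction
      case (app k f es)
      then show ?case using assms(3)[of k f es] by blast
    qed (use assms(1) in blast)
  qed
qed (rule assms(2))

subsection \<open>The criterion as a statement about lists of numbers\<close>

text \<open>
  The list \<open>a\<close> holds all entries of the chosen tuples. A generator is given by the positions in \<open>a\<close>
  of its coordinates, and \<open>eqs\<close> lists the pairs of coordinates that have to agree. In this form the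
  criterion depends on the group only through parameters of a program.
\<close>

definition digit_criterion ::
    "nat \<Rightarrow> (nat \<times> (nat list \<Rightarrow> nat)) list \<Rightarrow> nat \<Rightarrow> nat \<Rightarrow> nat list list \<Rightarrow> (nat \<times> nat) list \<Rightarrow> bool" where
  "digit_criterion N F n D gens eqs \<longleftrightarrow> (\<forall>a. length a = n \<and> set a \<subseteq> {..<N} \<longrightarrow>
     (\<exists>e \<in> subpower F D ((\<lambda>g. map ((!) a) g) ` set gens). \<forall>(i, j)\<in>set eqs. e ! i = e ! j))"

definition wellformed_scheme :: "nat \<Rightarrow> nat \<Rightarrow> nat list list \<Rightarrow> (nat \<times> nat) list \<Rightarrow> bool" where
  "wellformed_scheme n D gens eqs \<longleftrightarrow> (\<forall>g\<in>set gens. length g = D \<and> set g \<subseteq> {..<n}) \<and>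
     set eqs \<subseteq> {..<D} \<times> {..<D}"

definition solves :: "nat \<Rightarrow> nat \<Rightarrow> nat list list \<Rightarrow> (nat \<times> nat) list \<Rightarrow> 'x set \<Rightarrow> ('x \<Rightarrow> 'x) set \<Rightarrow> bool" where
  "solves n D gens eqs X G \<longleftrightarrow> wellformed_scheme n D gens eqs \<and> (gens = [] \<longleftrightarrow> X = {}) \<and>
     (\<forall>A. tabular A \<longrightarrow>
        (satisfies_loop A X G \<longleftrightarrow> digit_criterion (card (universe A)) (operations A) n D gens eqs))"

text \<open>
  The digits of \<open>a\<close> are indexed by pairs of a tuple number and a point, the coordinates of the power
  by pairs of a tuple number and a group element. Coordinates have to agree if they belong to the same
  tuple.
\<close>

lemma (in normal_stabilizers) scheme_exists:
  assumes M: "card (stab ` X) \<le> M"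
  shows "\<exists>gens eqs. solves (M * card X) (M * card G) gens eqs X G"
proof -
  obtain xs where xs: "set xs = X" "distinct xs" using finite_distinct_list[OF finite_X] by blast
  obtain gs where gs: "set gs = G" "distinct gs" using finite_distinct_list[OF finite_G] by blast
  define digits where "digits = List.product [0..<M] xs"
  define cs where "cs = List.product [0..<M] gs"
  define ix where "ix q = (SOME i. i < length digits \<and> digits ! i = q)" for q
  define gens where "gens = map (\<lambda>x. map (\<lambda>(j, g). ix (j, g x)) cs) xs"
  define eqs where "eqs = filter (\<lambda>(c, d). fst (cs ! c) = fst (cs ! d))
    (List.product [0..<length cs] [0..<length cs])"
  have set_digits: "set digits = {..<M} \<times> X" and set_cs: "set cs = {..<M} \<times> G"
    by (auto simp: digits_def cs_def xs gs)
  have len: "length digits = M * card X" "length cs = M * card G"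
    using distinct_card[OF xs(2)] distinct_card[OF gs(2)] xs(1) gs(1) by (simp_all add: digits_def cs_def)
  have ix: "ix q < length digits \<and> digits ! ix q = q" if "q \<in> set digits" for q
    unfolding ix_def by (rule someI_ex) (use that in \<open>simp add: in_set_conv_nth\<close>)
  have ix_in: "(j, g x) \<in> set digits" if "(j, g) \<in> set cs" "x \<in> X" for j g x
    using that maps by (auto simp: set_digits set_cs)
  have "wellformed_scheme (M * card X) (M * card G) gens eqs"
    unfolding wellformed_scheme_def
  proof (intro conjI ballI)
    fix g assume "g \<in> set gens"
    then obtain x where x: "x \<in> X" "g = map (\<lambda>(j, g). ix (j, g x)) cs" by (auto simp: gens_def xs)
    then show "length g = M * card G" by (simp add: len)
    show "set g \<subseteq> {..<M * card X}" using x ix[OF ix_in] len by (auto split: prod.splits)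
  qed (auto simp: eqs_def len)
  moreover have "satisfies_loop A X G \<longleftrightarrow>
      digit_criterion (card (universe A)) (operations A) (M * card X) (M * card G) gens eqs"
    if "tabular A" for A
  proof -
    let ?N = "card (universe A)"
    have A: "finite_algebra A" "universe A = {..<?N}" using that by (auto simp: tabular_def)
    let ?P = "X \<rightarrow>\<^sub>E universe A"
    define b where "b a j x = (if x \<in> X then a ! ix (j, x) else undefined)" for a :: "nat list" and j x
    define ps where "ps a = map (\<lambda>(j, g). b a j \<circ> g) cs" for a
    have gen_eq: "(\<lambda>g. map ((!) a) g) ` set gens = (\<lambda>x. map (\<lambda>p. p x) (ps a)) ` X" for a
    proof -
      have "map ((!) a) (map (\<lambda>(j, g). ix (j, g x)) cs) = map (\<lambda>p. p x) (ps a)" if "x \<in> X" for x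
        using that maps by (auto simp: ps_def b_def set_cs)
      then show ?thesis unfolding gens_def using xs(1) by (auto simp: image_image)
    qed
    have crit: "digit_criterion ?N (operations A) (M * card X) (M * card G) gens eqs \<longleftrightarrow>
      (\<forall>a. length a = M * card X \<and> set a \<subseteq> {..<?N} \<longrightarrow>
        (\<exists>t\<in>term_ops A X. \<forall>(c, d)\<in>set eqs. map t (ps a) ! c = map t (ps a) ! d))"
    proof -
      have "length (ps a) = M * card G" for a by (simp add: ps_def len)
      then have "subpower (operations A) (M * card G) ((\<lambda>g. map ((!) a) g) ` set gens)
         = (\<lambda>t. map t (ps a)) ` term_ops A X" for a
        using subpower_term[of _ A "ps a" X] gen_eq by auto
      then show ?thesis unfolding digit_criterion_def by simp
    qed
    have b_P: "b a j \<in> ?P" if "length a = M * card X" "set a \<subseteq> {..<?N}" "j < M" for a j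
    proof (rule PiE_I)
      fix x assume "x \<in> X"
      then have "(j, x) \<in> set digits" using that(3) by (auto simp: set_digits)
      from ix[OF this] have "a ! ix (j, x) \<in> set a" using that(1) len by simp
      then show "b a j x \<in> universe A" using that(2) A(2) \<open>x \<in> X\<close> by (auto simp: b_def)
    qed (simp add: b_def)
    show ?thesis unfolding crit
    proof
      assume "satisfies_loop A X G"
      then obtain t where t: "t \<in> term_ops A X" "\<And>g x. g \<in> G \<Longrightarrow> x \<in> ?P \<Longrightarrow> t x = t (x \<circ> g)"
        unfolding satisfies_loop_def by blast
      show "\<forall>a. length a = M * card X \<and> set a \<subseteq> {..<?N} \<longrightarrow>
        (\<exists>t\<in>term_ops A X. \<forall>(c, d)\<in>set eqs. map t (ps a) ! c = map t (ps a) ! d)"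
      proof (intro allI impI bexI[OF _ t(1)] ballI, clarify)
        fix a c d assume a: "length a = M * card X" "set a \<subseteq> {..<?N}" and "(c, d) \<in> set eqs"
        then have cd: "c < length cs" "d < length cs" "fst (cs ! c) = fst (cs ! d)"
          by (auto simp: eqs_def)
        obtain j g h where gh: "cs ! c = (j, g)" "cs ! d = (j, h)"
          using cd(3) by (metis prod.collapse)
        then have "j < M" "g \<in> G" "h \<in> G" using nth_mem[OF cd(1)] nth_mem[OF cd(2)] set_cs by auto
        then have "t (b a j \<circ> g) = t (b a j \<circ> h)" using t(2)[OF _ b_P[OF a]] by metis
        then show "map t (ps a) ! c = map t (ps a) ! d" using cd gh by (simp add: ps_def)
      qed
    next
      assume hyp: "\<forall>a. length a = M * card X \<and> set a \<subseteq> {..<?N} \<longrightarrow>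
        (\<exists>t\<in>term_ops A X. \<forall>(c, d)\<in>set eqs. map t (ps a) ! c = map t (ps a) ! d)"
      show "satisfies_loop A X G"
      proof (rule local_to_global[OF A(1) M])
        fix B assume B: "finite B" "card B \<le> M" "B \<subseteq> ?P"
        obtain bs where bs: "set bs = B" "distinct bs" using finite_distinct_list[OF B(1)] by blast
        \<comment> \<open>Fewer than \<open>M\<close> tuples are padded to a list of length \<open>M\<close>.\<close>
        obtain u where u: "u \<in> universe A" using A(1) by (auto simp: finite_algebra_def)
        define r where "r = (\<lambda>x. if x \<in> X then u else undefined)"
        define bs' where "bs' = bs @ replicate (M - length bs) r"
        have bs': "length bs' = M" "set bs' \<subseteq> ?P" "B \<subseteq> set bs'"
          using bs B distinct_card[OF bs(2)] u by (auto simp: bs'_def r_def)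
        define a where "a = map (\<lambda>(j, x). (bs' ! j) x) digits"
        have a: "length a = M * card X" by (simp add: a_def len)
        have "set a \<subseteq> {..<?N}"
        proof
          fix v assume "v \<in> set a"
          then obtain j x where "j < M" "x \<in> X" "v = (bs' ! j) x" by (auto simp: a_def set_digits)
          moreover from this have "bs' ! j \<in> ?P" using bs'(1,2) nth_mem by blast
          ultimately show "v \<in> {..<?N}" using A(2) PiE_mem by metis
        qed
        then obtain t where t: "t \<in> term_ops A X"
            "\<forall>(c, d)\<in>set eqs. map t (ps a) ! c = map t (ps a) ! d" using hyp a by blast
        have b_eq: "b a j = bs' ! j" if "j < M" for j
        proof
          fix x
          have in_P: "bs' ! j \<in> ?P" using bs' that nth_mem by blast
          show "b a j x = (bs' ! j) x"
          proof (cases "x \<in> X")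
            case True
            then have "(j, x) \<in> set digits" using that by (auto simp: set_digits)
            from ix[OF this] show ?thesis using True by (simp add: b_def a_def)
          qed (use PiE_arb[OF in_P] in \<open>simp add: b_def\<close>)
        qed
        have "invariant_at G t (bs' ! j)" if j: "j < M" for j
          unfolding invariant_at_def
        proof
          fix g assume g: "g \<in> G"
          obtain c where c: "c < length cs" "cs ! c = (j, g)"
            using g j set_cs by (metis SigmaI in_set_conv_nth lessThan_iff)
          obtain d where d: "d < length cs" "cs ! d = (j, id)"
            using id_in j set_cs by (metis SigmaI in_set_conv_nth lessThan_iff)
          have "(c, d) \<in> set eqs" using c d by (simp add: eqs_def)
          with t(2) have "map t (ps a) ! c = map t (ps a) ! d" by blast
          then show "t (bs' ! j \<circ> g) = t (bs' ! j)" using c d b_eq[OF j] by (simp add: ps_def)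
        qed
        then show "\<exists>t\<in>term_ops A X. \<forall>b\<in>B. invariant_at G t b"
          using t(1) bs'(1,3) by (metis in_set_conv_nth subsetD)
      qed
    qed
  qed
  moreover have "gens = [] \<longleftrightarrow> X = {}" using xs(1) by (auto simp: gens_def)
  ultimately show ?thesis unfolding solves_def by blast
qed

section \<open>Encodings\<close>

text \<open>
  The number with digits \<open>xs\<close> in base \<open>N\<close>, most significant digit first. It is the position of \<open>xs\<close>
  in the lexicographic order of the tuples of the same length, hence the index into a table.
\<close>

definition horner :: "nat \<Rightarrow> nat list \<Rightarrow> nat" where
  "horner N xs = foldl (\<lambda>i x. i * N + x) 0 xs"

lemma horner_snoc [simp]: "horner N (xs @ [x]) = horner N xs * N + x"
  by (simp add: horner_def)

lemma horner_Nil [simp]: "horner N [] = 0"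
  by (simp add: horner_def)

lemma foldl_horner: "foldl (\<lambda>i x. i * N + x) i xs = i * N ^ length xs + horner N xs"
proof (induction xs arbitrary: i)
  case (Cons x xs)
  have "horner N (x # xs) = x * N ^ length xs + horner N xs"
    using Cons[of x] by (simp add: horner_def)
  then show ?case using Cons[of "i * N + x"] by (simp add: add_mult_distrib mult.assoc)
qed simp

lemma horner_Cons: "horner N (x # xs) = x * N ^ length xs + horner N xs"
  using foldl_horner[of N x xs] by (simp add: horner_def)

lemma horner_less: "set xs \<subseteq> {..<N} \<Longrightarrow> horner N xs < N ^ length xs"
proof (induction xs)
  case (Cons x xs)
  have "x * N ^ length xs + horner N xs < Suc x * N ^ length xs" using Cons by simp
  also have "\<dots> \<le> N * N ^ length xs" using Cons by (intro mult_le_mono1) simp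
  finally show ?case by (simp add: horner_Cons)
qed simp

lemma nth_concat_blocks:
  assumes "\<And>x. x < N \<Longrightarrow> length (h x) = l" "x < N" "i < l"
  shows "concat (map h [0..<N]) ! (x * l + i) = h x ! i"
  using assms
proof (induction N)
  case (Suc N)
  have len: "length (concat (map h [0..<N])) = N * l"
  proof -
    have m: "map length (map h [0..<N]) = map (\<lambda>_. l) [0..<N]" using Suc.prems(1) by simp
    show ?thesis unfolding length_concat m by (simp add: sum_list_triv)
  qed
  show ?case
  proof (cases "x = N")
    case True
    then show ?thesis using len Suc.prems by (simp add: nth_append)
  next
    case False
    then have "x < N" using Suc.prems by simp
    then have "Suc x * l \<le> N * l" by (intro mult_le_mono1) simp
    then have "x * l + i < N * l" using Suc.prems(3) by simp
    then show ?thesis using len Suc \<open>x < N\<close> by (simp add: nth_append)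
  qed
qed simp

definition tuples :: "nat \<Rightarrow> nat \<Rightarrow> nat list list" where
  "tuples N k = product_lists (replicate k [0..<N])"

lemma length_tuples [simp]: "length (tuples N k) = N ^ k"
  by (induction k) (simp_all add: tuples_def length_concat comp_def sum_list_triv)

lemma set_tuples: "set (tuples N k) = {xs. length xs = k \<and> set xs \<subseteq> {..<N}}"
proof -
  have "(list_all2 (\<lambda>x ys. x \<in> set ys) xs (replicate k [0..<N])) \<longleftrightarrow> length xs = k \<and> set xs \<subseteq> {..<N}" for xs
    by (fastforce simp: list_all2_conv_all_nth set_conv_nth[of xs])
  then show ?thesis by (simp add: tuples_def product_lists_set)
qed

lemma tuples_horner: "set xs \<subseteq> {..<N} \<Longrightarrow> tuples N (length xs) ! horner N xs = xs"
proof (induction xs)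
  case Nil
  then show ?case by (simp add: tuples_def)
next
  case (Cons x xs)
  have "tuples N (length (x # xs)) = concat (map (\<lambda>x. map (Cons x) (tuples N (length xs))) [0..<N])"
    by (simp add: tuples_def)
  then show ?case
    using Cons horner_less[of xs N] nth_concat_blocks[of N "\<lambda>x. map (Cons x) (tuples N (length xs))"
        "N ^ length xs" x "horner N xs"] by (simp add: horner_Cons)
qed

lemma horner_inj:
  "length xs = length ys \<Longrightarrow> set xs \<subseteq> {..<N} \<Longrightarrow> set ys \<subseteq> {..<N} \<Longrightarrow> horner N xs = horner N ys \<Longrightarrow> xs = ys"
  using tuples_horner by metis

definition table_op :: "nat \<Rightarrow> nat \<times> nat list \<Rightarrow> nat \<times> (nat list \<Rightarrow> nat)" where
  "table_op N = (\<lambda>(k, tab). (k, \<lambda>xs. tab ! horner N xs))"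

definition valid_table :: "nat \<Rightarrow> nat \<times> nat list \<Rightarrow> bool" where
  "valid_table N = (\<lambda>(k, tab). length tab = N ^ k \<and> set tab \<subseteq> {..<N})"

fun parse :: "nat \<Rightarrow> nat \<Rightarrow> nat list \<Rightarrow> (nat \<times> nat list) list option" where
  "parse N 0 u = (if u = [] then Some [] else None)"
| "parse N (Suc r) [] = None"
| "parse N (Suc r) (k # u) = (if N ^ k \<le> length u \<and> set (take (N ^ k) u) \<subseteq> {..<N}
     then map_option ((#) (k, take (N ^ k) u)) (parse N r (drop (N ^ k) u)) else None)"

lemma parse_iff:
  "parse N r u = Some T \<longleftrightarrow> length T = r \<and> (\<forall>t\<in>set T. valid_table N t) \<and>
     u = concat (map (\<lambda>(k, tab). k # tab) T)"
proof (induction N r u arbitrary: T rule: parse.induct)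
  case (3 N r k u)
  show ?case
  proof
    assume "parse N (Suc r) (k # u) = Some T"
    then obtain T' where T': "N ^ k \<le> length u" "set (take (N ^ k) u) \<subseteq> {..<N}"
      "parse N r (drop (N ^ k) u) = Some T'" "T = (k, take (N ^ k) u) # T'"
      by (auto split: if_splits)
    then have "length T' = r" "\<forall>t\<in>set T'. valid_table N t"
      "drop (N ^ k) u = concat (map (\<lambda>(k, tab). k # tab) T')" using 3 by auto
    then show "length T = Suc r \<and> (\<forall>t\<in>set T. valid_table N t) \<and>
        k # u = concat (map (\<lambda>(k, tab). k # tab) T)"
      using T' append_take_drop_id[of "N ^ k" u] by (auto simp: valid_table_def)
  next
    assume T: "length T = Suc r \<and> (\<forall>t\<in>set T. valid_table N t) \<and>
        k # u = concat (map (\<lambda>(k, tab). k # tab) T)"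
    then obtain t T' where T': "T = t # T'" by (cases T) auto
    obtain tab where t: "t = (k, tab)" using T T' by (cases t) auto
    then have u: "u = tab @ concat (map (\<lambda>(k, tab). k # tab) T')" "length tab = N ^ k" "set tab \<subseteq> {..<N}"
      using T T' by (auto simp: valid_table_def)
    moreover from this have "parse N r (drop (N ^ k) u) = Some T'" using 3[of T'] T T' by auto
    ultimately show "parse N (Suc r) (k # u) = Some T" using T' t by simp
  qed
next
  case (2 N r)
  then show ?case by (cases T) auto
qed auto

definition table_algebra :: "nat \<Rightarrow> (nat \<times> nat list) list \<Rightarrow> nat algebra" where
  "table_algebra N T = \<lparr>universe = {..<N}, operations = map (table_op N) T\<rparr>"

lemma tabular_table_algebra:
  assumes "N \<ge> 1" "\<forall>t\<in>set T. valid_table N t"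
  shows "tabular (table_algebra N T)"
    "encode (table_algebra N T) = N # length T # concat (map (\<lambda>(k, tab). k # tab) T)"
proof -
  have "tab ! horner N xs < N" if "(k, tab) \<in> set T" "length xs = k" "set xs \<subseteq> {..<N}" for k tab xs
    using assms(2) horner_less[of xs N] that by (fastforce simp: valid_table_def subset_iff)
  then show "tabular (table_algebra N T)"
    using assms(1) by (fastforce simp: tabular_def finite_algebra_def table_algebra_def table_op_def lessThan_empty_iff)
  have "map (\<lambda>xs. tab ! horner N xs) (tuples N k) = tab" if "(k, tab) \<in> set T" for k tab
  proof (rule nth_equalityI)
    have l: "length tab = N ^ k" using that assms(2) by (auto simp: valid_table_def)
    then show "length (map (\<lambda>xs. tab ! horner N xs) (tuples N k)) = length tab" by simp
    fix i assume "i < length (map (\<lambda>xs. tab ! horner N xs) (tuples N k))"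
    then have i: "i < N ^ k" by simp
    have "horner N (tuples N k ! i) = i"
    proof -
      let ?h = "horner N"
      have inj: "inj_on ?h (set (tuples N k))"
        using horner_inj by (auto simp: inj_on_def set_tuples)
      have "distinct (tuples N k)" by (simp add: tuples_def distinct_product_lists)
      moreover have "tuples N k ! ?h (tuples N k ! i) = tuples N k ! i" "?h (tuples N k ! i) < N ^ k"
        using tuples_horner[of "tuples N k ! i" N] horner_less[of "tuples N k ! i" N]
          nth_mem[of i "tuples N k"] i by (auto simp: set_tuples)
      ultimately show ?thesis using i by (simp add: nth_eq_iff_index_eq)
    qed
    then show "map (\<lambda>xs. tab ! horner N xs) (tuples N k) ! i = tab ! i" using i by simp
  qed
  then show "encode (table_algebra N T) = N # length T # concat (map (\<lambda>(k, tab). k # tab) T)"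
    unfolding encode_def table_algebra_def table_op_def
    by (auto simp: tuples_def comp_def split_def intro!: arg_cong[of _ _ concat])
qed

text \<open>
  The information about an algebra that its encoding contains.
\<close>

definition tables_of :: "nat algebra \<Rightarrow> (nat \<times> nat list) list" where
  "tables_of A = map (\<lambda>(k, f). (k, map f (tuples (card (universe A)) k))) (operations A)"

lemma encode_tables:
  assumes "tabular A" "N = card (universe A)"
  shows "N \<ge> 1" "\<forall>t\<in>set (tables_of A). valid_table N t"
    "encode A = N # length (tables_of A) # concat (map (\<lambda>(k, tab). k # tab) (tables_of A))"
proof -
  have A: "finite_algebra A" "universe A = {..<N}" using assms by (auto simp: tabular_def)
  then show "N \<ge> 1" by (cases N) (auto simp: finite_algebra_def)
  show "\<forall>t\<in>set (tables_of A). valid_table N t"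
    using A assms(2) unfolding tables_of_def valid_table_def finite_algebra_def
    by (fastforce simp: set_tuples)
  show "encode A = N # length (tables_of A) # concat (map (\<lambda>(k, tab). k # tab) (tables_of A))"
    by (auto simp: encode_def tables_of_def tuples_def assms(2) comp_def split_def
        intro!: arg_cong[of _ _ concat])
qed

lemma digit_criterion_tables:
  assumes "tabular A" "N = card (universe A)" "wellformed_scheme n D gens eqs"
  shows "digit_criterion N (operations A) n D gens eqs \<longleftrightarrow>
    digit_criterion N (map (table_op N) (tables_of A)) n D gens eqs"
proof -
  have A: "finite_algebra A" "universe A = {..<N}" using assms by (auto simp: tabular_def)
  have op: "f xs \<in> {..<N}" if "(k, f) \<in> set (operations A)" "length xs = k \<and> set xs \<subseteq> {..<N}" for k f xs
    using A that unfolding finite_algebra_def by blast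
  have agree: "map f (tuples N k) ! horner N xs = f xs" if "length xs = k \<and> set xs \<subseteq> {..<N}" for k f xs
    using that tuples_horner[of xs N] horner_less[of xs N] by auto
  have "subpower (operations A) D E = subpower (map (table_op N) (tables_of A)) D E"
    if E: "\<And>e. e \<in> E \<Longrightarrow> length e = D \<and> set e \<subseteq> {..<N}" for E
  proof (intro equalityI subsetI)
    fix e assume "e \<in> subpower (operations A) D E"
    then show "e \<in> subpower (map (table_op N) (tables_of A)) D E"
    proof (rule conjunct1[OF subpower_cong_subset[OF E, rotated 2]])
      fix k f assume kf: "(k, f) \<in> set (operations A)"
      then have "(k, \<lambda>xs. map f (tuples N k) ! horner N xs) \<in> set (map (table_op N) (tables_of A))"
        unfolding tables_of_def assms(2)[symmetric] by (force simp: table_op_def)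
      then show "\<exists>f'. (k, f') \<in> set (map (table_op N) (tables_of A)) \<and>
          (\<forall>xs. length xs = k \<and> set xs \<subseteq> {..<N} \<longrightarrow> f xs = f' xs \<and> f xs \<in> {..<N})"
        using op[OF kf] agree by metis
    qed
  next
    fix e assume "e \<in> subpower (map (table_op N) (tables_of A)) D E"
    then show "e \<in> subpower (operations A) D E"
    proof (rule conjunct1[OF subpower_cong_subset[OF E, rotated 2]])
      fix k f assume "(k, f) \<in> set (map (table_op N) (tables_of A))"
      then obtain f' where "(k, f') \<in> set (operations A)" "f = (\<lambda>xs. map f' (tuples N k) ! horner N xs)"
        unfolding tables_of_def assms(2)[symmetric] by (auto simp: table_op_def)
      then show "\<exists>f'. (k, f') \<in> set (operations A) \<and>
          (\<forall>xs. length xs = k \<and> set xs \<subseteq> {..<N} \<longrightarrow> f xs = f' xs \<and> f xs \<in> {..<N})"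
        using op agree by metis
    qed
  qed
  moreover have "length (map ((!) a) g) = D \<and> set (map ((!) a) g) \<subseteq> {..<N}"
    if "length a = n \<and> set a \<subseteq> {..<N}" "g \<in> set gens" for a g
    using that assms(3) unfolding wellformed_scheme_def by (auto simp: subset_iff)
  ultimately have "subpower (operations A) D ((\<lambda>g. map ((!) a) g) ` set gens)
      = subpower (map (table_op N) (tables_of A)) D ((\<lambda>g. map ((!) a) g) ` set gens)"
    if "length a = n \<and> set a \<subseteq> {..<N}" for a
    using that by (metis (no_types, lifting) imageE)
  then show ?thesis unfolding digit_criterion_def by (intro iff_allI imp_cong refl) simp
qed

subsection \<open>The cases that need no search\<close>

lemma satisfies_loop_nullary:
  assumes "(0, f) \<in> set (operations A)" shows "satisfies_loop A X G"
proof -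
  have "(\<lambda>x. f (map (\<lambda>t. t x) [])) \<in> term_ops A X" by (rule term_ops.comp[OF assms]) auto
  then show ?thesis unfolding satisfies_loop_def by fastforce
qed

lemma term_ops_empty:
  "t \<in> term_ops A {} \<Longrightarrow> \<exists>f. (0, f) \<in> set (operations A)"
proof (induction rule: term_ops.induct)
  case (comp k f ts)
  then show ?case by (cases ts) auto
qed simp

lemma satisfies_loop_fixed_point:
  "z \<in> X \<Longrightarrow> \<forall>g\<in>G. g z = z \<Longrightarrow> satisfies_loop A X G"
  unfolding satisfies_loop_def by (rule bexI[OF _ term_ops.proj]) auto

lemma satisfies_loop_singleton:
  assumes "universe A = {u}" "X \<noteq> {}" "\<And>g z. g \<in> G \<Longrightarrow> z \<in> X \<Longrightarrow> g z \<in> X"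
  shows "satisfies_loop A X G"
proof -
  obtain z where z: "z \<in> X" using assms(2) by blast
  have "x z = (x \<circ> g) z" if "g \<in> G" "x \<in> X \<rightarrow>\<^sub>E universe A" for g x
    using PiE_mem[OF that(2)] z assms(1,3) that(1) by (metis comp_apply singletonD)
  then show ?thesis unfolding satisfies_loop_def by (intro bexI[OF _ term_ops.proj[OF z]]) blast
qed

lemma not_satisfies_loop_projections:
  assumes "operations A = []" "u \<in> universe A" "v \<in> universe A" "u \<noteq> v"
    and "\<And>z. z \<in> X \<Longrightarrow> \<exists>g\<in>G. g z \<in> X \<and> g z \<noteq> z"
  shows "\<not> satisfies_loop A X G"
proof
  assume "satisfies_loop A X G"
  then obtain t where t: "t \<in> term_ops A X" "\<And>g x. g \<in> G \<Longrightarrow> x \<in> X \<rightarrow>\<^sub>E universe A \<Longrightarrow> t x = t (x \<circ> g)"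
    unfolding satisfies_loop_def by blast
  from t(1) obtain z where z: "z \<in> X" "t = (\<lambda>x. x z)" using assms(1) by cases auto
  obtain g where g: "g \<in> G" "g z \<in> X" "g z \<noteq> z" using assms(5)[OF z(1)] by blast
  define x where "x = (\<lambda>y. if y \<in> X then if y = z then u else v else undefined)"
  have "x \<in> X \<rightarrow>\<^sub>E universe A" using assms(2,3) by (auto simp: x_def)
  from t(2)[OF g(1) this] show False using z g assms(4) by (simp add: x_def)
qed

section \<open>A structured language for random access machines\<close>

datatype ('v, 'a) exp =
    Num nat
  | Var 'v
  | Elt 'a "('v, 'a) exp"
  | Plus "('v, 'a) exp" "('v, 'a) exp"
  | Minus "('v, 'a) exp" "('v, 'a) exp"

datatype ('v, 'a) com =
    Skip
  | Assign 'v "('v, 'a) exp" (infix "::=" 61)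
  | Put 'a "('v, 'a) exp" "('v, 'a) exp"
  | Input 'v "('v, 'a) com" "('v, 'a) com"
  | Seq "('v, 'a) com" "('v, 'a) com" (infixr ";;" 60)
  | Cond "('v, 'a) exp" "('v, 'a) com" "('v, 'a) com"
  | Loop "('v, 'a) exp" "('v, 'a) com"

text \<open>
  The clock is a ghost component: no expression can read it. Keeping it in the state lets one
  postcondition speak of the result and of the running time.
\<close>

record ('v, 'a) state =
  vars :: "'v \<Rightarrow> nat"
  arrs :: "'a \<Rightarrow> nat \<Rightarrow> nat"
  inp :: "nat list"
  clk :: nat

fun val :: "('v, 'a) exp \<Rightarrow> ('v, 'a) state \<Rightarrow> nat" where
  "val (Num n) s = n"
| "val (Var x) s = vars s x"
| "val (Elt a e) s = arrs s a (val e s)"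
| "val (Plus e f) s = val e s + val f s"
| "val (Minus e f) s = val e s - val f s"

abbreviation tick :: "('v, 'a) state \<Rightarrow> ('v, 'a) state" where
  "tick s \<equiv> s\<lparr>clk := Suc (clk s)\<rparr>"

inductive bigstep :: "('v, 'a) com \<Rightarrow> ('v, 'a) state \<Rightarrow> ('v, 'a) state \<Rightarrow> bool" where
  Skip: "bigstep Skip s s"
| Assign: "bigstep (x ::= e) s (tick (s\<lparr>vars := (vars s)(x := val e s)\<rparr>))"
| Put: "bigstep (Put a e f) s
    (tick (s\<lparr>arrs := (arrs s)(a := (arrs s a)(val e s := val f s))\<rparr>))"
| Input: "inp s = i # w \<Longrightarrow> bigstep c (tick (s\<lparr>vars := (vars s)(x := i), inp := w\<rparr>)) s' \<Longrightarrow>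
    bigstep (Input x c d) s s'"
| Input_end: "inp s = [] \<Longrightarrow> bigstep d (tick s) s' \<Longrightarrow> bigstep (Input x c d) s s'"
| Seq: "bigstep c s s' \<Longrightarrow> bigstep d s' s'' \<Longrightarrow> bigstep (c ;; d) s s''"
| Cond_true: "val e s > 0 \<Longrightarrow> bigstep c (tick s) s' \<Longrightarrow> bigstep (Cond e c d) s s'"
| Cond_false: "val e s = 0 \<Longrightarrow> bigstep d (tick s) s' \<Longrightarrow> bigstep (Cond e c d) s s'"
| Loop_true: "val e s > 0 \<Longrightarrow> bigstep c (tick s) s' \<Longrightarrow> bigstep (Loop e c) s' s'' \<Longrightarrow>
    bigstep (Loop e c) s s''"
| Loop_false: "val e s = 0 \<Longrightarrow> bigstep (Loop e c) s (tick s)"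

subsection \<open>Compilation\<close>

text \<open>
  Registers are divided into \<open>K\<close> residue classes. Class \<open>0\<close> holds the variables (at even
  quotients) and the temporaries of expression evaluation (at odd ones); every other class holds
  one array. The machine cannot multiply, but \<open>K * i\<close> is a sum of \<open>K\<close> copies of \<open>i\<close>.
\<close>

definition var_adr :: "nat \<Rightarrow> 'v::countable \<Rightarrow> nat" where
  "var_adr K x = K * (2 * to_nat x)"

definition tmp_adr :: "nat \<Rightarrow> nat \<Rightarrow> nat" where
  "tmp_adr K d = K * (2 * d + 1)"

definition arr_class :: "'a::countable \<Rightarrow> nat" where
  "arr_class a = Suc (to_nat a)"

definition arr_adr :: "nat \<Rightarrow> 'a::countable \<Rightarrow> nat \<Rightarrow> nat" where
  "arr_adr K a i = K * i + arr_class a"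

text \<open>The temporary \<open>d\<close> is overwritten by the address of the cell of \<open>a\<close> whose index it holds.\<close>

definition adr_code :: "nat \<Rightarrow> 'a::countable \<Rightarrow> nat \<Rightarrow> instr list" where
  "adr_code K a d = Const (tmp_adr K (Suc d)) (arr_class a)
     # replicate K (Add (tmp_adr K (Suc d)) (tmp_adr K (Suc d)) (tmp_adr K d))
     @ [Const (tmp_adr K d) 0, Add (tmp_adr K d) (tmp_adr K d) (tmp_adr K (Suc d))]"

fun exp_code :: "nat \<Rightarrow> nat \<Rightarrow> ('v::countable, 'a::countable) exp \<Rightarrow> instr list" where
  "exp_code K d (Num n) = [Const (tmp_adr K d) n]"
| "exp_code K d (Var x) =
     [Const (tmp_adr K d) 0, Add (tmp_adr K d) (tmp_adr K d) (var_adr K x)]"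
| "exp_code K d (Elt a e) = exp_code K d e @ adr_code K a d @ [Load (tmp_adr K d) (tmp_adr K d)]"
| "exp_code K d (Plus e f) = exp_code K d e @ exp_code K (Suc d) f
     @ [Add (tmp_adr K d) (tmp_adr K d) (tmp_adr K (Suc d))]"
| "exp_code K d (Minus e f) = exp_code K d e @ exp_code K (Suc d) f
     @ [Sub (tmp_adr K d) (tmp_adr K d) (tmp_adr K (Suc d))]"

definition goto_code :: "nat \<Rightarrow> nat \<Rightarrow> instr list" where
  "goto_code K l = [Const (tmp_adr K 0) 1, Jump (tmp_adr K 0) l]"

fun com_size :: "nat \<Rightarrow> ('v::countable, 'a::countable) com \<Rightarrow> nat" where
  "com_size K Skip = 0"
| "com_size K (x ::= e) = length (exp_code K 0 e) + 2"
| "com_size K (Put a e f) = length (exp_code K 0 e) + (K + 3) + length (exp_code K 1 f) + 1"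
| "com_size K (Input x c d) = 1 + com_size K c + 2 + com_size K d"
| "com_size K (c ;; d) = com_size K c + com_size K d"
| "com_size K (Cond e c d) = length (exp_code K 0 e) + 1 + com_size K d + 2 + com_size K c"
| "com_size K (Loop e c) = length (exp_code K 0 e) + 3 + com_size K c + 2"

fun com_code :: "nat \<Rightarrow> nat \<Rightarrow> ('v::countable, 'a::countable) com \<Rightarrow> instr list" where
  "com_code K p Skip = []"
| "com_code K p (x ::= e) = exp_code K 0 e
     @ [Const (var_adr K x) 0, Add (var_adr K x) (var_adr K x) (tmp_adr K 0)]"
| "com_code K p (Put a e f) = exp_code K 0 e @ adr_code K a 0 @ exp_code K 1 f
     @ [Store (tmp_adr K 0) (tmp_adr K 1)]"
| "com_code K p (Input x c d) = (let e = Suc p + com_size K c + 2 in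
     [Read (var_adr K x) e] @ com_code K (Suc p) c @ goto_code K (e + com_size K d)
     @ com_code K e d)"
| "com_code K p (c ;; d) = com_code K p c @ com_code K (p + com_size K c) d"
| "com_code K p (Cond e c d) = (let q = p + length (exp_code K 0 e) + 1; r = q + com_size K d + 2 in
     exp_code K 0 e @ [Jump (tmp_adr K 0) r] @ com_code K q d @ goto_code K (r + com_size K c)
     @ com_code K r c)"
| "com_code K p (Loop e c) = (let q = p + length (exp_code K 0 e) + 3 in
     exp_code K 0 e @ [Jump (tmp_adr K 0) q] @ goto_code K (q + com_size K c + 2)
     @ com_code K q c @ goto_code K p)"

text \<open>
  Arrays whose class is not below \<open>K\<close> would share registers with others. Since a program mentions
  finitely many arrays, some \<open>K\<close> is large enough.
\<close>

primrec exp_ok :: "nat \<Rightarrow> ('v, 'a::countable) exp \<Rightarrow> bool" where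
  "exp_ok K (Num n) \<longleftrightarrow> True"
| "exp_ok K (Var x) \<longleftrightarrow> True"
| "exp_ok K (Elt a e) \<longleftrightarrow> arr_class a < K \<and> exp_ok K e"
| "exp_ok K (Plus e f) \<longleftrightarrow> exp_ok K e \<and> exp_ok K f"
| "exp_ok K (Minus e f) \<longleftrightarrow> exp_ok K e \<and> exp_ok K f"

primrec com_ok :: "nat \<Rightarrow> ('v, 'a::countable) com \<Rightarrow> bool" where
  "com_ok K Skip \<longleftrightarrow> True"
| "com_ok K (x ::= e) \<longleftrightarrow> exp_ok K e"
| "com_ok K (Put a e f) \<longleftrightarrow> arr_class a < K \<and> exp_ok K e \<and> exp_ok K f"
| "com_ok K (Input x c d) \<longleftrightarrow> com_ok K c \<and> com_ok K d"
| "com_ok K (c ;; d) \<longleftrightarrow> com_ok K c \<and> com_ok K d"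
| "com_ok K (Cond e c d) \<longleftrightarrow> exp_ok K e \<and> com_ok K c \<and> com_ok K d"
| "com_ok K (Loop e c) \<longleftrightarrow> exp_ok K e \<and> com_ok K c"

lemma exp_ok_mono: "exp_ok K e \<Longrightarrow> K \<le> L \<Longrightarrow> exp_ok L e"
  by (induction e) auto

lemma com_ok_mono: "com_ok K c \<Longrightarrow> K \<le> L \<Longrightarrow> com_ok L c"
  by (induction c) (auto intro: exp_ok_mono)

lemma exp_ok_exists: "\<exists>K. exp_ok K e"
proof (induction e)
  case (Elt a e)
  then obtain K where "exp_ok K e" by blast
  then have "exp_ok (K + Suc (arr_class a)) (Elt a e)" by (auto intro: exp_ok_mono)
  then show ?case by blast
qed (auto, (meson exp_ok_mono linear)+)

lemma com_ok_exists: "\<exists>K>0. com_ok K c"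
proof -
  have "\<exists>K. com_ok K c"
  proof (induction c)
    case (Assign x e)
    then show ?case using exp_ok_exists by simp
  next
    case (Put a e f)
    obtain K L where "exp_ok K e" "exp_ok L f" using exp_ok_exists by blast
    then have "com_ok (K + L + Suc (arr_class a)) (Put a e f)"
      by (auto intro: exp_ok_mono)
    then show ?case by blast
  next
    case (Cond e c d)
    then obtain J K L where "exp_ok J e" "com_ok K c" "com_ok L d" using exp_ok_exists by blast
    then have "com_ok (J + K + L) (Cond e c d)"
      by (auto intro: exp_ok_mono com_ok_mono)
    then show ?case by blast
  next
    case (Loop e c)
    then obtain J K where "exp_ok J e" "com_ok K c" using exp_ok_exists by blast
    then have "com_ok (J + K) (Loop e c)"
      by (auto intro: exp_ok_mono com_ok_mono)
    then show ?case by blast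
  qed (auto, (meson com_ok_mono linear)+)
  then show ?thesis by (meson com_ok_mono le_add1 zero_less_Suc le_SucI order_refl)
qed

lemma length_adr_code [simp]: "length (adr_code K a d) = K + 3"
  by (simp add: adr_code_def)

lemma length_com_code [simp]: "length (com_code K p c) = com_size K c"
  by (induction K p c rule: com_code.induct) (auto simp: Let_def goto_code_def)

subsection \<open>Correctness of the compilation\<close>

text \<open>
  Code without jumps and reads is determined by its effect on the registers.
\<close>

fun reg_code :: "instr list \<Rightarrow> (nat \<Rightarrow> nat) \<Rightarrow> (nat \<Rightarrow> nat)" where
  "reg_code [] X = X"
| "reg_code (i # is) X = reg_code is (fst (snd (exec i (0, X, []))))"

primrec straight :: "instr \<Rightarrow> bool" where
  "straight (Const i c) \<longleftrightarrow> True"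
| "straight (Add i j k) \<longleftrightarrow> True"
| "straight (Sub i j k) \<longleftrightarrow> True"
| "straight (Load i j) \<longleftrightarrow> True"
| "straight (Store i j) \<longleftrightarrow> True"
| "straight (Jump j l) \<longleftrightarrow> False"
| "straight (Read i l) \<longleftrightarrow> False"

lemma step_at: "p = u @ i # v \<Longrightarrow> step p (length u, X, w) = exec i (length u, X, w)"
  by (simp add: step_def halted_def)

lemma straight_exec:
  "straight i \<Longrightarrow> exec i (pc, X, w) = (Suc pc, fst (snd (exec i (0, X, []))), w)"
  by (cases i) auto

lemma straight_steps:
  "p = u @ cs @ v \<Longrightarrow> \<forall>i\<in>set cs. straight i \<Longrightarrow>
   (step p ^^ length cs) (length u, X, w) = (length u + length cs, reg_code cs X, w)"
proof (induction cs arbitrary: u X)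
  case (Cons i cs)
  have "step p (length u, X, w) = (Suc (length u), fst (snd (exec i (0, X, []))), w)"
    using step_at[of p u i "cs @ v" X w] straight_exec[of i "length u" X w] Cons.prems by simp
  moreover have "(step p ^^ length cs) (length (u @ [i]), fst (snd (exec i (0, X, []))), w)
      = (length (u @ [i]) + length cs, reg_code cs (fst (snd (exec i (0, X, [])))), w)"
    using Cons.prems by (intro Cons.IH) auto
  ultimately show ?case by (simp add: funpow_Suc_right del: funpow.simps)
qed simp

lemma reg_code_append [simp]: "reg_code (cs @ ds) X = reg_code ds (reg_code cs X)"
  by (induction cs arbitrary: X) auto

lemma straight_adr_code: "\<forall>i\<in>set (adr_code K a d). straight i"
  by (auto simp: adr_code_def)

lemma straight_exp_code: "\<forall>i\<in>set (exp_code K d e). straight i"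
  by (induction K d e rule: exp_code.induct) (auto simp: straight_adr_code)

lemma reg_code_repeated_add:
  "i \<noteq> j \<Longrightarrow> reg_code (replicate n (Add i i j)) X = X(i := X i + n * X j)"
  by (induction n arbitrary: X) (auto simp: fun_eq_iff)

lemma tmp_adr_inj [simp]: "K > 0 \<Longrightarrow> tmp_adr K d = tmp_adr K e \<longleftrightarrow> d = e"
  by (auto simp: tmp_adr_def)

lemma var_adr_inj [simp]: "K > 0 \<Longrightarrow> var_adr K x = var_adr K y \<longleftrightarrow> x = y"
  by (auto simp: var_adr_def)

lemma tmp_neq_var [simp]:
  assumes "K > 0" shows "tmp_adr K d \<noteq> var_adr K x" "var_adr K x \<noteq> tmp_adr K d"
proof -
  have "2 * d + 1 \<noteq> 2 * to_nat x" by presburger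
  then show "tmp_adr K d \<noteq> var_adr K x" "var_adr K x \<noteq> tmp_adr K d"
    using assms unfolding tmp_adr_def var_adr_def by (metis mult_left_cancel neq0_conv)+
qed

lemma arr_adr_mod: "arr_class a < K \<Longrightarrow> arr_adr K a i mod K = arr_class a"
  by (simp add: arr_adr_def)

lemma arr_adr_inj:
  assumes "arr_class a < K" "arr_class b < K"
  shows "arr_adr K a i = arr_adr K b j \<longleftrightarrow> a = b \<and> i = j"
proof
  assume eq: "arr_adr K a i = arr_adr K b j"
  then have "arr_class a = arr_class b" using arr_adr_mod[OF assms(1)] arr_adr_mod[OF assms(2)] by metis
  then show "a = b \<and> i = j" using eq assms by (auto simp: arr_class_def arr_adr_def)
qed auto

lemma arr_neq [simp]:
  assumes "arr_class a < K"
  shows "arr_adr K a i \<noteq> tmp_adr K d" "arr_adr K a i \<noteq> var_adr K x"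
    "tmp_adr K d \<noteq> arr_adr K a i" "var_adr K x \<noteq> arr_adr K a i"
proof -
  have "arr_adr K a i \<noteq> K * q" for q
    using arr_adr_mod[OF assms, of i] by (metis arr_class_def mod_mult_self1_is_0 nat.distinct(1))
  then show "arr_adr K a i \<noteq> tmp_adr K d" "arr_adr K a i \<noteq> var_adr K x"
    "tmp_adr K d \<noteq> arr_adr K a i" "var_adr K x \<noteq> arr_adr K a i"
    unfolding tmp_adr_def var_adr_def by metis+
qed

definition stored :: "nat \<Rightarrow> ('v::countable, 'a::countable) state \<Rightarrow> (nat \<Rightarrow> nat) \<Rightarrow> bool" where
  "stored K s X \<longleftrightarrow> (\<forall>x. X (var_adr K x) = vars s x) \<and>
     (\<forall>a i. arr_class a < K \<longrightarrow> X (arr_adr K a i) = arrs s a i)"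

lemma stored_tmp: "K > 0 \<Longrightarrow> stored K s X \<Longrightarrow> stored K s (X(tmp_adr K d := v))"
  by (auto simp: stored_def)

lemma stored_tmp': "K > 0 \<Longrightarrow> stored K s X \<Longrightarrow> stored K s (\<lambda>r. if r = tmp_adr K d then v else X r)"
  by (auto simp: stored_def)

lemma stored_var:
  "K > 0 \<Longrightarrow> stored K s X \<Longrightarrow> stored K (s\<lparr>vars := (vars s)(x := v)\<rparr>) (X(var_adr K x := v))"
  by (auto simp: stored_def)

lemma stored_arr:
  "K > 0 \<Longrightarrow> arr_class a < K \<Longrightarrow> stored K s X \<Longrightarrow>
   stored K (s\<lparr>arrs := (arrs s)(a := (arrs s a)(i := v))\<rparr>) (X(arr_adr K a i := v))"
  by (auto simp: stored_def arr_adr_inj)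

lemma stored_clk [simp]: "stored K (s\<lparr>clk := t\<rparr>) X = stored K s X"
  by (simp add: stored_def)

lemma stored_inp [simp]: "stored K (s\<lparr>inp := t\<rparr>) X = stored K s X"
  by (simp add: stored_def)

lemma adr_code_correct:
  assumes "K > 0"
  shows "reg_code (adr_code K a d) X =
    X(tmp_adr K d := arr_adr K a (X (tmp_adr K d)), tmp_adr K (Suc d) := arr_adr K a (X (tmp_adr K d)))"
  using assms by (auto simp: adr_code_def reg_code_repeated_add arr_adr_def fun_eq_iff)

text \<open>
  The operands of a binary operation use the temporaries \<open>d\<close> and \<open>Suc d\<close>, so the second one must not
  destroy temporaries below its own.
\<close>

lemma exp_code_correct:
  "K > 0 \<Longrightarrow> exp_ok K e \<Longrightarrow> stored K s X \<Longrightarrow>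
   reg_code (exp_code K d e) X (tmp_adr K d) = val e s \<and> stored K s (reg_code (exp_code K d e) X) \<and>
   (\<forall>c<d. reg_code (exp_code K d e) X (tmp_adr K c) = X (tmp_adr K c))"
proof (induction e arbitrary: d X)
  case (Var x)
  then show ?case by (auto simp: stored_def)
next
  case (Elt a e)
  then show ?case
    by (auto simp: adr_code_correct intro!: stored_tmp) (auto simp: stored_def)
next
  case (Plus e f)
  let ?X = "reg_code (exp_code K d e) X" let ?Y = "reg_code (exp_code K (Suc d) f) ?X"
  have "?X (tmp_adr K d) = val e s" "stored K s ?X" "\<forall>c<d. ?X (tmp_adr K c) = X (tmp_adr K c)"
    using Plus by auto
  moreover from this have "?Y (tmp_adr K (Suc d)) = val f s" "stored K s ?Y"
      "\<forall>c<Suc d. ?Y (tmp_adr K c) = ?X (tmp_adr K c)"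
    using Plus.IH(2)[of ?X "Suc d"] Plus.prems by auto
  ultimately show ?case using Plus.prems(1) by (auto intro!: stored_tmp stored_tmp')
next
  case (Minus e f)
  let ?X = "reg_code (exp_code K d e) X" let ?Y = "reg_code (exp_code K (Suc d) f) ?X"
  have "?X (tmp_adr K d) = val e s" "stored K s ?X" "\<forall>c<d. ?X (tmp_adr K c) = X (tmp_adr K c)"
    using Minus by auto
  moreover from this have "?Y (tmp_adr K (Suc d)) = val f s" "stored K s ?Y"
      "\<forall>c<Suc d. ?Y (tmp_adr K c) = ?X (tmp_adr K c)"
    using Minus.IH(2)[of ?X "Suc d"] Minus.prems by auto
  ultimately show ?case using Minus.prems(1) by (auto intro!: stored_tmp stored_tmp')
qed (auto intro!: stored_tmp)

definition runs_to :: "instr list \<Rightarrow> nat \<Rightarrow> config \<Rightarrow> config \<Rightarrow> bool" where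
  "runs_to p n c c' \<longleftrightarrow> (\<exists>t\<le>n. (step p ^^ t) c = c')"

lemma runs_to_refl: "runs_to p 0 c c"
  by (auto simp: runs_to_def)

lemma runs_to_trans:
  assumes "runs_to p m c c'" "runs_to p n c' c''" shows "runs_to p (m + n) c c''"
proof -
  obtain t t' where "t \<le> m" "t' \<le> n" "(step p ^^ t) c = c'" "(step p ^^ t') c' = c''"
    using assms by (auto simp: runs_to_def)
  then have "t' + t \<le> m + n" "(step p ^^ (t' + t)) c = c''" by (auto simp: funpow_add)
  then show ?thesis unfolding runs_to_def by blast
qed

lemma runs_to_mono:
  assumes "runs_to p m c c'" "m \<le> n" shows "runs_to p n c c'"
proof -
  obtain t where "t \<le> m" "(step p ^^ t) c = c'" using assms(1) unfolding runs_to_def by iprover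
  then show ?thesis using assms(2) unfolding runs_to_def by (intro exI[of _ t] conjI) (rule order.trans)
qed

lemma runs_to_straight:
  assumes "p = u @ cs @ v" "\<forall>i\<in>set cs. straight i" "length u = l" "l' = l + length cs"
    "Y = reg_code cs X"
  shows "runs_to p (length cs) (l, X, w) (l', Y, w)"
proof -
  have "(step p ^^ length cs) (l, X, w) = (l', Y, w)"
    unfolding assms(4,5) assms(3)[symmetric] by (rule straight_steps[OF assms(1,2)])
  then show ?thesis unfolding runs_to_def by (intro exI[of _ "length cs"] conjI order.refl)
qed

lemma runs_to_step:
  assumes "p = u @ i # v" "length u = l" "exec i (l, X, w) = c"
  shows "runs_to p 1 (l, X, w) c"
proof -
  have "(step p ^^ 1) (l, X, w) = c"
    using step_at[OF assms(1), of X w] unfolding assms(2,3) by simp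
  then show ?thesis unfolding runs_to_def by (intro exI[of _ 1] conjI order.refl)
qed

lemma runs_to_goto:
  assumes "p = u @ goto_code K l' @ v" "length u = l"
  shows "runs_to p 2 (l, X, w) (l', X(tmp_adr K 0 := 1), w)"
proof -
  have "runs_to p 1 (l, X, w) (Suc l, X(tmp_adr K 0 := 1), w)"
    using assms by (intro runs_to_step[of p u "Const (tmp_adr K 0) 1" "Jump (tmp_adr K 0) l' # v"])
      (auto simp: goto_code_def)
  moreover have "runs_to p 1 (Suc l, X(tmp_adr K 0 := 1), w) (l', X(tmp_adr K 0 := 1), w)"
    using assms by (intro runs_to_step[of p "u @ [Const (tmp_adr K 0) 1]" "Jump (tmp_adr K 0) l'" v])
      (auto simp: goto_code_def)
  ultimately show ?thesis using runs_to_trans by (metis one_add_one)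
qed

lemma runs_to_exp:
  assumes "p = u @ exp_code K 0 e @ v" "length u = l" "K > 0" "exp_ok K e" "stored K s X"
  obtains Y where "runs_to p (length (exp_code K 0 e)) (l, X, w) (l + length (exp_code K 0 e), Y, w)"
    "Y (tmp_adr K 0) = val e s" "stored K s Y"
  using exp_code_correct[OF assms(3-5), of 0]
    runs_to_straight[OF assms(1) straight_exp_code assms(2) refl refl, of X w] that by blast

lemma compile_conclude:
  "runs_to p n c (l, X', w) \<Longrightarrow> n \<le> m \<Longrightarrow> stored K s' X' \<Longrightarrow> t \<le> t' \<Longrightarrow>
   t \<le> t' \<and> (\<exists>X'. stored K s' X' \<and> runs_to p m c (l, X', w))"
  by (blast intro: runs_to_mono)

text \<open>
  Every tick of the clock pays for at most \<open>b\<close> machine steps, as between two ticks each instruction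
  is executed at most once. A compound command runs its parts from inside the same program, so the
  statement fixes the code around the compiled command.
\<close>

lemma compile_correct:
  "bigstep c s s' \<Longrightarrow> K > 0 \<Longrightarrow> com_ok K c \<Longrightarrow> p = u @ com_code K (length u) c @ v \<Longrightarrow>
   com_size K c \<le> b \<Longrightarrow> stored K s X \<Longrightarrow>
   clk s \<le> clk s' \<and> (\<exists>X'. stored K s' X' \<and>
     runs_to p (b * (clk s' - clk s)) (length u, X, inp s) (length u + com_size K c, X', inp s'))"
proof (induction c s s' arbitrary: u v X rule: bigstep.induct)
  case (Skip s)
  then show ?case using runs_to_refl by auto
next
  case (Assign x e s)
  obtain Y where Y: "runs_to p (length (exp_code K 0 e)) (length u, X, inp s)
      (length u + length (exp_code K 0 e), Y, inp s)" "Y (tmp_adr K 0) = val e s" "stored K s Y"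
    using runs_to_exp[of p u K e _ "length u" s X "inp s"] Assign.prems by auto
  have "runs_to p 2 (length u + length (exp_code K 0 e), Y, inp s)
      (length u + length (exp_code K 0 e) + 2, Y(var_adr K x := val e s), inp s)"
    unfolding numeral_2_eq_2
    using runs_to_straight[of p "u @ exp_code K 0 e"
        "[Const (var_adr K x) 0, Add (var_adr K x) (var_adr K x) (tmp_adr K 0)]" v _ _ _ Y]
      Assign.prems Y(2)
    by simp
  from runs_to_trans[OF Y(1) this] have "runs_to p (b * 1) (length u, X, inp s)
      (length u + com_size K (x ::= e), Y(var_adr K x := val e s), inp s)"
    using Assign.prems by (auto intro: runs_to_mono simp: add_ac)
  then show ?case using stored_var[OF _ Y(3), of x "val e s"] Assign.prems(1)
    by (auto intro!: exI[of _ "Y(var_adr K x := val e s)"])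
next
  case (Put a e f s)
  obtain Y where Y: "runs_to p (length (exp_code K 0 e)) (length u, X, inp s)
      (length u + length (exp_code K 0 e), Y, inp s)" "Y (tmp_adr K 0) = val e s" "stored K s Y"
    using runs_to_exp[of p u K e _ "length u" s X "inp s"] Put.prems by auto
  define Z where "Z = reg_code (exp_code K 1 f) (reg_code (adr_code K a 0) Y)"
  have st: "stored K s (reg_code (adr_code K a 0) Y)"
    using Put.prems Y by (auto simp: adr_code_correct intro!: stored_tmp)
  have Z: "Z (tmp_adr K 0) = arr_adr K a (val e s)" "Z (tmp_adr K 1) = val f s" "stored K s Z"
    using exp_code_correct[OF _ _ st, of f 1] Put.prems Y(2) by (auto simp: Z_def adr_code_correct)
  let ?cs = "adr_code K a 0 @ exp_code K 1 f @ [Store (tmp_adr K 0) (tmp_adr K 1)]"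
  have "runs_to p (length ?cs) (length u + length (exp_code K 0 e), Y, inp s)
      (length u + length (exp_code K 0 e) + length ?cs, Z(arr_adr K a (val e s) := val f s), inp s)"
  proof (rule runs_to_straight)
    show "p = (u @ exp_code K 0 e) @ ?cs @ v" using Put.prems(3) by simp
    show "\<forall>i\<in>set ?cs. straight i"
      using straight_adr_code[of K a 0] straight_exp_code[of K 1 f] by auto
    show "Z(arr_adr K a (val e s) := val f s) = reg_code ?cs Y"
      using Z(1,2) unfolding Z_def by simp
  qed simp_all
  from runs_to_trans[OF Y(1) this] have "runs_to p (b * 1) (length u, X, inp s)
      (length u + com_size K (Put a e f), Z(arr_adr K a (val e s) := val f s), inp s)"
    using Put.prems by (auto intro: runs_to_mono simp: add_ac)
  then show ?case using stored_arr[OF _ _ Z(3), of a "val e s" "val f s"] Put.prems(1,2)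
    by (auto intro!: exI[of _ "Z(arr_adr K a (val e s) := val f s)"])
next
  case (Input s i w c x s' d)
  let ?e = "Suc (length u) + com_size K c + 2"
  let ?t = "tick (s\<lparr>vars := (vars s)(x := i), inp := w\<rparr>)"
  have p: "p = u @ [Read (var_adr K x) ?e] @ com_code K (Suc (length u)) c
      @ goto_code K (?e + com_size K d) @ com_code K ?e d @ v"
    using Input.prems(3) by (simp add: Let_def)
  define X1 where "X1 = X(var_adr K x := i)"
  have 1: "runs_to p 1 (length u, X, inp s) (Suc (length u), X1, w)"
    using Input.hyps(1) unfolding X1_def by (intro runs_to_step[of p u "Read (var_adr K x) ?e"]) (auto simp: p)
  have st: "stored K ?t X1"
    using stored_var[OF Input.prems(1,5), of x i] by (simp add: X1_def)
  obtain X' where X': "clk ?t \<le> clk s'" "stored K s' X'"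
    "runs_to p (b * (clk s' - clk ?t)) (Suc (length u), X1, w)
       (Suc (length u) + com_size K c, X', inp s')"
    using Input.IH[of "u @ [Read (var_adr K x) ?e]", OF _ _ _ _ st] Input.prems p by auto
  have 3: "runs_to p 2 (Suc (length u) + com_size K c, X', inp s')
     (?e + com_size K d, X'(tmp_adr K 0 := 1), inp s')"
    by (rule runs_to_goto[of p "u @ [Read (var_adr K x) ?e] @ com_code K (Suc (length u)) c"])
      (auto simp: p)
  have "runs_to p (1 + b * (clk s' - clk ?t) + 2) (length u, X, inp s)
      (length u + com_size K (Input x c d), X'(tmp_adr K 0 := 1), inp s')"
    using runs_to_trans[OF runs_to_trans[OF 1 X'(3)] 3] by (simp add: add_ac)
  moreover have "1 + b * (clk s' - clk ?t) + 2 \<le> b * (clk s' - clk s)"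
  proof -
    have "clk s' - clk s = Suc (clk s' - clk ?t)" using X'(1) by simp
    then show ?thesis using Input.prems(4) by simp
  qed
  ultimately show ?case by (rule compile_conclude) (use X'(1,2) stored_tmp Input.prems(1) in simp_all)
next
  case (Input_end s d s' x c)
  let ?e = "Suc (length u) + com_size K c + 2"
  have p: "p = u @ [Read (var_adr K x) ?e] @ com_code K (Suc (length u)) c
      @ goto_code K (?e + com_size K d) @ com_code K ?e d @ v"
    using Input_end.prems(3) by (simp add: Let_def)
  have 1: "runs_to p 1 (length u, X, inp s) (?e, X, inp s)"
    using Input_end.hyps(1) by (intro runs_to_step[of p u "Read (var_adr K x) ?e"]) (auto simp: p)
  obtain X' where X': "clk (tick s) \<le> clk s'" "stored K s' X'"
    "runs_to p (b * (clk s' - clk (tick s))) (?e, X, inp s) (?e + com_size K d, X', inp s')"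
    using Input_end.IH[of "u @ [Read (var_adr K x) ?e] @ com_code K (Suc (length u)) c
      @ goto_code K (?e + com_size K d)" v X] Input_end.prems p by (auto simp: goto_code_def add_ac)
  have "runs_to p (1 + b * (clk s' - clk (tick s))) (length u, X, inp s)
      (length u + com_size K (Input x c d), X', inp s')"
    using runs_to_trans[OF 1 X'(3)] by (simp add: add_ac)
  moreover have "1 + b * (clk s' - clk (tick s)) \<le> b * (clk s' - clk s)"
  proof -
    have "clk s' - clk s = Suc (clk s' - clk (tick s))" using X'(1) by simp
    then show ?thesis using Input_end.prems(4) by simp
  qed
  ultimately show ?case by (rule compile_conclude) (use X'(1,2) in simp_all)
next
  case (Seq c s s' d s'')
  obtain X' where X': "clk s \<le> clk s'" "stored K s' X'"
    "runs_to p (b * (clk s' - clk s)) (length u, X, inp s) (length u + com_size K c, X', inp s')"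
    using Seq.IH(1)[of u _ X] Seq.prems by auto
  obtain X'' where X'': "clk s' \<le> clk s''" "stored K s'' X''"
    "runs_to p (b * (clk s'' - clk s')) (length u + com_size K c, X', inp s')
      (length u + com_size K c + com_size K d, X'', inp s'')"
    using Seq.IH(2)[of "u @ com_code K (length u) c" v X'] Seq.prems X'(2) by auto
  have "b * (clk s' - clk s) + b * (clk s'' - clk s') = b * (clk s'' - clk s)"
    using X'(1) X''(1) by (simp flip: add_mult_distrib2)
  then show ?case using runs_to_trans[OF X'(3) X''(3)] X'(1) X''(1,2) by (auto simp: add_ac)
next
  case (Cond_true e s c s' d)
  let ?q = "length u + length (exp_code K 0 e) + 1" let ?r = "?q + com_size K d + 2"
  have p: "p = u @ exp_code K 0 e @ [Jump (tmp_adr K 0) ?r] @ com_code K ?q d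
      @ goto_code K (?r + com_size K c) @ com_code K ?r c @ v"
    using Cond_true.prems(3) by (simp add: Let_def)
  obtain Y where Y: "runs_to p (length (exp_code K 0 e)) (length u, X, inp s)
      (length u + length (exp_code K 0 e), Y, inp s)" "Y (tmp_adr K 0) = val e s" "stored K s Y"
    using runs_to_exp[of p u K e _ "length u" s X "inp s"] Cond_true.prems(1,2,5) p by auto
  have 2: "runs_to p 1 (length u + length (exp_code K 0 e), Y, inp s) (?r, Y, inp s)"
    using Y(2) Cond_true.hyps(1)
    by (intro runs_to_step[of p "u @ exp_code K 0 e" "Jump (tmp_adr K 0) ?r"]) (auto simp: p)
  obtain X' where X': "clk (tick s) \<le> clk s'" "stored K s' X'"
    "runs_to p (b * (clk s' - clk (tick s))) (?r, Y, inp s) (?r + com_size K c, X', inp s')"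
    using Cond_true.IH[of "u @ exp_code K 0 e @ [Jump (tmp_adr K 0) ?r] @ com_code K ?q d
      @ goto_code K (?r + com_size K c)" v Y] Cond_true.prems p Y(3) by (auto simp: goto_code_def add_ac)
  have "runs_to p (length (exp_code K 0 e) + 1 + b * (clk s' - clk (tick s))) (length u, X, inp s)
      (length u + com_size K (Cond e c d), X', inp s')"
    using runs_to_trans[OF runs_to_trans[OF Y(1) 2] X'(3)] by (simp add: add_ac)
  moreover have "length (exp_code K 0 e) + 1 + b * (clk s' - clk (tick s)) \<le> b * (clk s' - clk s)"
  proof -
    have "clk s' - clk s = Suc (clk s' - clk (tick s))" using X'(1) by simp
    then show ?thesis using Cond_true.prems(4) by simp
  qed
  ultimately show ?case by (rule compile_conclude) (use X'(1,2) in simp_all)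
next
  case (Cond_false e s d s' c)
  let ?q = "length u + length (exp_code K 0 e) + 1" let ?r = "?q + com_size K d + 2"
  have p: "p = u @ exp_code K 0 e @ [Jump (tmp_adr K 0) ?r] @ com_code K ?q d
      @ goto_code K (?r + com_size K c) @ com_code K ?r c @ v"
    using Cond_false.prems(3) by (simp add: Let_def)
  obtain Y where Y: "runs_to p (length (exp_code K 0 e)) (length u, X, inp s)
      (length u + length (exp_code K 0 e), Y, inp s)" "Y (tmp_adr K 0) = val e s" "stored K s Y"
    using runs_to_exp[of p u K e _ "length u" s X "inp s"] Cond_false.prems(1,2,5) p by auto
  have 2: "runs_to p 1 (length u + length (exp_code K 0 e), Y, inp s) (?q, Y, inp s)"
    using Y(2) Cond_false.hyps(1)
    by (intro runs_to_step[of p "u @ exp_code K 0 e" "Jump (tmp_adr K 0) ?r"]) (auto simp: p)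
  obtain X' where X': "clk (tick s) \<le> clk s'" "stored K s' X'"
    "runs_to p (b * (clk s' - clk (tick s))) (?q, Y, inp s) (?q + com_size K d, X', inp s')"
    using Cond_false.IH[of "u @ exp_code K 0 e @ [Jump (tmp_adr K 0) ?r]" _ Y] Cond_false.prems p Y(3)
    by auto
  have 3: "runs_to p 2 (?q + com_size K d, X', inp s')
     (?r + com_size K c, X'(tmp_adr K 0 := 1), inp s')"
    by (rule runs_to_goto[of p "u @ exp_code K 0 e @ [Jump (tmp_adr K 0) ?r] @ com_code K ?q d"])
      (auto simp: p)
  have "runs_to p (length (exp_code K 0 e) + 1 + b * (clk s' - clk (tick s)) + 2) (length u, X, inp s)
      (length u + com_size K (Cond e c d), X'(tmp_adr K 0 := 1), inp s')"
    using runs_to_trans[OF runs_to_trans[OF runs_to_trans[OF Y(1) 2] X'(3)] 3] by (simp add: add_ac)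
  moreover have "length (exp_code K 0 e) + 1 + b * (clk s' - clk (tick s)) + 2 \<le> b * (clk s' - clk s)"
  proof -
    have "clk s' - clk s = Suc (clk s' - clk (tick s))" using X'(1) by simp
    then show ?thesis using Cond_false.prems(4) by simp
  qed
  ultimately show ?case by (rule compile_conclude) (use X'(1,2) stored_tmp Cond_false.prems(1) in simp_all)
next
  case (Loop_true e s c s' s'')
  let ?q = "length u + length (exp_code K 0 e) + 3"
  have p: "p = u @ exp_code K 0 e @ [Jump (tmp_adr K 0) ?q] @ goto_code K (?q + com_size K c + 2)
      @ com_code K ?q c @ goto_code K (length u) @ v"
    using Loop_true.prems(3) by (simp add: Let_def)
  obtain Y where Y: "runs_to p (length (exp_code K 0 e)) (length u, X, inp s)
      (length u + length (exp_code K 0 e), Y, inp s)" "Y (tmp_adr K 0) = val e s" "stored K s Y"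
    using runs_to_exp[of p u K e _ "length u" s X "inp s"] Loop_true.prems(1,2,5) p by auto
  have 2: "runs_to p 1 (length u + length (exp_code K 0 e), Y, inp s) (?q, Y, inp s)"
    using Y(2) Loop_true.hyps(1)
    by (intro runs_to_step[of p "u @ exp_code K 0 e" "Jump (tmp_adr K 0) ?q"]) (auto simp: p)
  obtain X' where X': "clk (tick s) \<le> clk s'" "stored K s' X'"
    "runs_to p (b * (clk s' - clk (tick s))) (?q, Y, inp s) (?q + com_size K c, X', inp s')"
  proof -
    let ?u = "u @ exp_code K 0 e @ [Jump (tmp_adr K 0) ?q] @ goto_code K (?q + com_size K c + 2)"
    have len: "length ?u = ?q" by (simp add: goto_code_def)
    have "clk (tick s) \<le> clk s' \<and> (\<exists>X'. stored K s' X' \<and> runs_to p (b * (clk s' - clk (tick s)))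
        (length ?u, Y, inp (tick s)) (length ?u + com_size K c, X', inp s'))"
    proof (rule Loop_true.IH(1))
      show "p = ?u @ com_code K (length ?u) c @ (goto_code K (length u) @ v)"
        unfolding len by (simp add: p)
    qed (use Loop_true.prems Y(3) in simp_all)
    then show thesis unfolding len using that by auto
  qed
  have 3: "runs_to p 2 (?q + com_size K c, X', inp s') (length u, X'(tmp_adr K 0 := 1), inp s')"
    by (rule runs_to_goto[of p "u @ exp_code K 0 e @ [Jump (tmp_adr K 0) ?q]
        @ goto_code K (?q + com_size K c + 2) @ com_code K ?q c"]) (auto simp: p goto_code_def)
  have st: "stored K s' (X'(tmp_adr K 0 := 1))" using stored_tmp[OF Loop_true.prems(1) X'(2)] .
  obtain X'' where X'': "clk s' \<le> clk s''" "stored K s'' X''"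
    "runs_to p (b * (clk s'' - clk s')) (length u, X'(tmp_adr K 0 := 1), inp s')
      (length u + com_size K (Loop e c), X'', inp s'')"
    using Loop_true.IH(2)[OF Loop_true.prems(1,2,3,4) st] by blast
  have "runs_to p (length (exp_code K 0 e) + 1 + b * (clk s' - clk (tick s)) + 2 + b * (clk s'' - clk s'))
      (length u, X, inp s) (length u + com_size K (Loop e c), X'', inp s'')"
    using runs_to_trans[OF runs_to_trans[OF runs_to_trans[OF runs_to_trans[OF Y(1) 2] X'(3)] 3] X''(3)]
    by (simp add: add_ac)
  moreover have "length (exp_code K 0 e) + 1 + b * (clk s' - clk (tick s)) + 2 + b * (clk s'' - clk s')
      \<le> b * (clk s'' - clk s)"
  proof -
    have eq: "clk s'' - clk s = Suc (clk s' - clk (tick s) + (clk s'' - clk s'))"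
      using X'(1) X''(1) by simp
    show ?thesis unfolding eq using Loop_true.prems(4) by (simp add: add_mult_distrib2)
  qed
  ultimately show ?case by (rule compile_conclude) (use X'(1) X''(1,2) in simp_all)
next
  case (Loop_false e s c)
  let ?q = "length u + length (exp_code K 0 e) + 3"
  have p: "p = u @ exp_code K 0 e @ [Jump (tmp_adr K 0) ?q] @ goto_code K (?q + com_size K c + 2)
      @ com_code K ?q c @ goto_code K (length u) @ v"
    using Loop_false.prems(3) by (simp add: Let_def)
  obtain Y where Y: "runs_to p (length (exp_code K 0 e)) (length u, X, inp s)
      (length u + length (exp_code K 0 e), Y, inp s)" "Y (tmp_adr K 0) = val e s" "stored K s Y"
    using runs_to_exp[of p u K e _ "length u" s X "inp s"] Loop_false.prems(1,2,5) p by auto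
  have 2: "runs_to p 1 (length u + length (exp_code K 0 e), Y, inp s)
      (Suc (length u + length (exp_code K 0 e)), Y, inp s)"
    using Y(2) Loop_false.hyps(1)
    by (intro runs_to_step[of p "u @ exp_code K 0 e" "Jump (tmp_adr K 0) ?q"]) (auto simp: p)
  have 3: "runs_to p 2 (Suc (length u + length (exp_code K 0 e)), Y, inp s)
      (?q + com_size K c + 2, Y(tmp_adr K 0 := 1), inp s)"
    by (rule runs_to_goto[of p "u @ exp_code K 0 e @ [Jump (tmp_adr K 0) ?q]"]) (auto simp: p)
  have "runs_to p (length (exp_code K 0 e) + 1 + 2) (length u, X, inp s)
      (length u + com_size K (Loop e c), Y(tmp_adr K 0 := 1), inp (tick s))"
    using runs_to_trans[OF runs_to_trans[OF Y(1) 2] 3] by (simp add: add_ac)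
  then show ?case
    by (rule compile_conclude) (use Loop_false.prems(1,4) Y(3) stored_tmp in simp_all)
qed

text \<open>
  The compiled command is followed by two instructions that copy the answer to register 0, where
  the acceptance condition looks.
\<close>

theorem compiled_program_exists:
  fixes c :: "('v::countable, 'a::countable) com"
  shows "\<exists>p b. \<forall>w s'. bigstep c \<lparr>vars = \<lambda>_. 0, arrs = \<lambda>_ _. 0, inp = w, clk = 0\<rparr> s' \<longrightarrow>
    (\<exists>t \<le> b * Suc (clk s'). halted p (run p w t) \<and> (accepting (run p w t) \<longleftrightarrow> vars s' x > 0))"
proof -
  obtain K where K: "K > 0" "com_ok K c" using com_ok_exists by blast
  define cs where "cs = [Const (tmp_adr K 0) 0, Add 0 (tmp_adr K 0) (var_adr K x)]"
  define p where "p = com_code K 0 c @ cs"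
  show ?thesis
  proof (rule exI[of _ p], rule exI[of _ "com_size K c + 2"], intro allI impI)
    fix w and s' :: "('v, 'a) state"
    let ?s = "\<lparr>vars = \<lambda>_. 0, arrs = \<lambda>_ _. 0, inp = w, clk = 0\<rparr> :: ('v, 'a) state"
    assume "bigstep c ?s s'"
    from compile_correct[OF this K, of p "[]" cs "com_size K c + 2" "\<lambda>_. 0"]
    obtain X' where X': "stored K s' X'"
      "runs_to p ((com_size K c + 2) * clk s') (0, \<lambda>_. 0, w) (com_size K c, X', inp s')"
      by (auto simp: p_def stored_def)
    let ?Y = "(X'(tmp_adr K 0 := 0))(0 := vars s' x)"
    have "tmp_adr K 0 \<noteq> 0" using K by (simp add: tmp_adr_def)
    then have "runs_to p 2 (com_size K c, X', inp s') (com_size K c + 2, ?Y, inp s')"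
      unfolding numeral_2_eq_2
      using runs_to_straight[of p "com_code K 0 c" cs "[]" "com_size K c" "com_size K c + 2" ?Y X' "inp s'"]
        X'(1) K(1)
      by (auto simp: p_def cs_def stored_def)
    from runs_to_trans[OF X'(2) this]
    obtain t where "t \<le> (com_size K c + 2) * clk s' + 2" "run p w t = (com_size K c + 2, ?Y, inp s')"
      by (auto simp: runs_to_def run_def)
    then show "\<exists>t \<le> (com_size K c + 2) * Suc (clk s'). halted p (run p w t) \<and>
        (accepting (run p w t) \<longleftrightarrow> vars s' x > 0)"
      by (intro exI[of _ t]) (auto simp: halted_def accepting_def p_def cs_def)
  qed
qed

section \<open>Weakest preconditions\<close>

definition wp :: "('v, 'a) com \<Rightarrow> (('v, 'a) state \<Rightarrow> bool) \<Rightarrow> ('v, 'a) state \<Rightarrow> bool" where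
  "wp c Q s \<longleftrightarrow> (\<exists>s'. bigstep c s s' \<and> Q s')"

lemma wp_Skip [simp]: "wp Skip Q s = Q s"
  unfolding wp_def by (auto intro: bigstep.Skip elim: bigstep.cases)

lemma wp_Assign [simp]: "wp (x ::= e) Q s = Q (tick (s\<lparr>vars := (vars s)(x := val e s)\<rparr>))"
  unfolding wp_def by (auto intro: bigstep.Assign elim: bigstep.cases)

lemma wp_Put [simp]:
  "wp (Put a e f) Q s = Q (tick (s\<lparr>arrs := (arrs s)(a := (arrs s a)(val e s := val f s))\<rparr>))"
  unfolding wp_def by (auto intro: bigstep.Put elim: bigstep.cases)

lemma wp_Input [simp]:
  "wp (Input x c d) Q s = (case inp s of [] \<Rightarrow> wp d Q (tick s)
     | i # w \<Rightarrow> wp c Q (tick (s\<lparr>vars := (vars s)(x := i), inp := w\<rparr>)))"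
proof (cases "inp s")
  case Nil
  then have "bigstep (Input x c d) s s' \<longleftrightarrow> bigstep d (tick s) s'" for s'
    by (auto intro: bigstep.Input_end elim: bigstep.cases)
  then show ?thesis using Nil by (simp add: wp_def)
next
  case (Cons i w)
  have "bigstep c (tick (s\<lparr>vars := (vars s)(x := i), inp := w\<rparr>)) s'"
    if "bigstep (Input x c d) s s'" for s'
    using that by cases (use Cons in simp_all)
  then have "bigstep (Input x c d) s s' \<longleftrightarrow>
      bigstep c (tick (s\<lparr>vars := (vars s)(x := i), inp := w\<rparr>)) s'" for s'
    using bigstep.Input[OF Cons, of c x s' d] by blast
  then show ?thesis using Cons by (simp add: wp_def)
qed

lemma wp_Seq [simp]: "wp (c ;; d) Q = wp c (wp d Q)"
proof
  fix s
  have "bigstep (c ;; d) s s'' \<longleftrightarrow> (\<exists>s'. bigstep c s s' \<and> bigstep d s' s'')" for s''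
    by (auto intro: bigstep.Seq elim: bigstep.cases)
  then show "wp (c ;; d) Q s = wp c (wp d Q) s" unfolding wp_def by blast
qed

lemma wp_Cond [simp]:
  "wp (Cond e c d) Q s = (if val e s > 0 then wp c Q (tick s) else wp d Q (tick s))"
  unfolding wp_def by (auto intro: bigstep.Cond_true bigstep.Cond_false elim: bigstep.cases)

lemma wp_mono: "wp c P s \<Longrightarrow> (\<And>s'. P s' \<Longrightarrow> Q s') \<Longrightarrow> wp c Q s"
  unfolding wp_def by blast

primrec wvars :: "('v, 'a) com \<Rightarrow> 'v set" where
  "wvars Skip = {}"
| "wvars (x ::= e) = {x}"
| "wvars (Put a e f) = {}"
| "wvars (Input x c d) = insert x (wvars c \<union> wvars d)"
| "wvars (c ;; d) = wvars c \<union> wvars d"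
| "wvars (Cond e c d) = wvars c \<union> wvars d"
| "wvars (Loop e c) = wvars c"

primrec warrs :: "('v, 'a) com \<Rightarrow> 'a set" where
  "warrs Skip = {}"
| "warrs (x ::= e) = {}"
| "warrs (Put a e f) = {a}"
| "warrs (Input x c d) = warrs c \<union> warrs d"
| "warrs (c ;; d) = warrs c \<union> warrs d"
| "warrs (Cond e c d) = warrs c \<union> warrs d"
| "warrs (Loop e c) = warrs c"

text \<open>
  What a command cannot change is visible in its text. The rules for loops and for consequence
  supply this information, so that invariants need to mention only what changes.
\<close>

definition unchanged :: "'v set \<Rightarrow> 'a set \<Rightarrow> ('v, 'a) state \<Rightarrow> ('v, 'a) state \<Rightarrow> bool" where
  "unchanged V W s s' \<longleftrightarrow> (\<forall>x. x \<notin> V \<longrightarrow> vars s' x = vars s x) \<and> (\<forall>a. a \<notin> W \<longrightarrow> arrs s' a = arrs s a)"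

lemma unchanged_refl [simp]: "unchanged V W s s"
  by (simp add: unchanged_def)

lemma unchanged_trans: "unchanged V W s s' \<Longrightarrow> unchanged V W s' s'' \<Longrightarrow> unchanged V W s s''"
  by (simp add: unchanged_def)

lemma unchanged_mono: "unchanged V W s s' \<Longrightarrow> V \<subseteq> V' \<Longrightarrow> W \<subseteq> W' \<Longrightarrow> unchanged V' W' s s'"
  by (auto simp: unchanged_def)

lemma unchanged_var: "unchanged V W s s' \<Longrightarrow> x \<notin> V \<Longrightarrow> vars s' x = vars s x"
  by (simp add: unchanged_def)

lemma unchanged_arr: "unchanged V W s s' \<Longrightarrow> a \<notin> W \<Longrightarrow> arrs s' a = arrs s a"
  by (simp add: unchanged_def)

lemma bigstep_unchanged: "bigstep c s s' \<Longrightarrow> unchanged (wvars c) (warrs c) s s'"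
  by (induction rule: bigstep.induct) (auto simp: unchanged_def)

lemma wp_conseq:
  "wp c P s \<Longrightarrow> (\<And>s'. P s' \<Longrightarrow> unchanged (wvars c) (warrs c) s s' \<Longrightarrow> Q s') \<Longrightarrow> wp c Q s"
  unfolding wp_def using bigstep_unchanged by blast

lemma wp_loop:
  assumes "I s"
    and "\<And>t. I t \<Longrightarrow> unchanged (wvars c) (warrs c) s t \<Longrightarrow> val e t > 0 \<Longrightarrow>
      wp c (\<lambda>t'. I t' \<and> V t' < (V t :: nat)) (tick t)"
    and "\<And>t. I t \<Longrightarrow> unchanged (wvars c) (warrs c) s t \<Longrightarrow> val e t = 0 \<Longrightarrow> Q (tick t)"
  shows "wp (Loop e c) Q s"
proof -
  have "wp (Loop e c) Q t" if "I t" "unchanged (wvars c) (warrs c) s t" for t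
    using that
  proof (induction "V t" arbitrary: t rule: less_induct)
    case less
    show ?case
    proof (cases "val e t > 0")
      case True
      from assms(2)[OF less.prems True]
      obtain t' where t': "bigstep c (tick t) t'" "I t'" "V t' < V t" unfolding wp_def by blast
      have "unchanged (wvars c) (warrs c) s t'"
        using less.prems(2) bigstep_unchanged[OF t'(1)] by (simp add: unchanged_def)
      from less.hyps[OF t'(3,2) this] show ?thesis
        using bigstep.Loop_true[OF True t'(1)] unfolding wp_def by blast
    next
      case False
      then show ?thesis
        using assms(3)[OF less.prems] bigstep.Loop_false[of e t c] unfolding wp_def by auto
    qed
  qed
  then show ?thesis using assms(1) by simp
qed

subsection \<open>Derived commands\<close>

abbreviation less_exp :: "('v, 'a) exp \<Rightarrow> ('v, 'a) exp \<Rightarrow> ('v, 'a) exp" where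
  "less_exp e f \<equiv> Minus f e"

definition and_exp :: "('v, 'a) exp \<Rightarrow> ('v, 'a) exp \<Rightarrow> ('v, 'a) exp" where
  "and_exp e f = Minus (Num 1) (Plus (Minus (Num 1) e) (Minus (Num 1) f))"

definition neq_exp :: "('v, 'a) exp \<Rightarrow> ('v, 'a) exp \<Rightarrow> ('v, 'a) exp" where
  "neq_exp e f = Plus (Minus e f) (Minus f e)"

lemma val_and_exp [simp]:
  "0 < val (and_exp e f) s \<longleftrightarrow> 0 < val e s \<and> 0 < val f s"
  "val (and_exp e f) s = 0 \<longleftrightarrow> \<not> (0 < val e s \<and> 0 < val f s)"
  by (auto simp: and_exp_def)

lemma val_neq_exp [simp]:
  "0 < val (neq_exp e f) s \<longleftrightarrow> val e s \<noteq> val f s" "val (neq_exp e f) s = 0 \<longleftrightarrow> val e s = val f s"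
  by (auto simp: neq_exp_def)

abbreviation inc :: "'v \<Rightarrow> ('v, 'a) com" where
  "inc x \<equiv> x ::= Plus (Var x) (Num 1)"

definition for_loop :: "'v \<Rightarrow> ('v, 'a) exp \<Rightarrow> ('v, 'a) com \<Rightarrow> ('v, 'a) com" where
  "for_loop x e c = x ::= Num 0 ;; Loop (less_exp (Var x) e) (c ;; inc x)"

lemma wvars_for_loop [simp]: "wvars (for_loop x e c) = insert x (wvars c)"
  by (auto simp: for_loop_def)

lemma warrs_for_loop [simp]: "warrs (for_loop x e c) = warrs c"
  by (auto simp: for_loop_def)

text \<open>
  The invariant is indexed by the number of completed rounds; by the second assumption it ignores
  the counter and the clock.
\<close>

lemma wp_for_loop:
  fixes I :: "nat \<Rightarrow> ('v, 'a) state \<Rightarrow> bool"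
  assumes start: "I 0 s"
    and ind: "\<And>i t t'. I i t \<Longrightarrow> unchanged {x} {} t t' \<Longrightarrow> I i t'"
    and bound: "\<And>i t. I i t \<Longrightarrow> unchanged (insert x (wvars c)) (warrs c) s t \<Longrightarrow> val e t = n"
    and body: "\<And>i t. i < n \<Longrightarrow> I i t \<Longrightarrow> vars t x = i \<Longrightarrow>
      unchanged (insert x (wvars c)) (warrs c) s t \<Longrightarrow>
      wp c (\<lambda>t'. I (Suc i) t' \<and> vars t' x = i \<and> clk t' \<le> clk t + \<tau>) t"
  shows "wp (for_loop x e c) (\<lambda>s'. I n s' \<and> clk s' \<le> clk s + 2 + n * (\<tau> + 2)) s"
proof -
  let ?U = "unchanged (insert x (wvars c)) (warrs c) s"
  let ?s = "tick (s\<lparr>vars := (vars s)(x := 0)\<rparr>)"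
  define J where "J t \<longleftrightarrow> (\<exists>i\<le>n. vars t x = i \<and> I i t \<and> ?U t \<and>
    clk t \<le> clk s + 1 + i * (\<tau> + 2))" for t
  have "wp (Loop (less_exp (Var x) e) (c ;; inc x))
      (\<lambda>s'. I n s' \<and> clk s' \<le> clk s + 2 + n * (\<tau> + 2)) ?s"
  proof (rule wp_loop[where I = J and V = "\<lambda>t. n - vars t x"])
    have "I 0 ?s" using ind[OF start] by (simp add: unchanged_def)
    then show "J ?s" by (simp add: J_def unchanged_def)
  next
    fix t assume "J t" and pos: "0 < val (less_exp (Var x) e) t"
    then obtain i where i: "vars t x = i" "I i t" "?U t" "clk t \<le> clk s + 1 + i * (\<tau> + 2)"
      by (auto simp: J_def)
    have U: "?U (tick t)" using i(3) by (simp add: unchanged_def)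
    have "I i (tick t)" using ind[OF i(2)] by (simp add: unchanged_def)
    moreover have "i < n" using bound[OF i(2,3)] i(1) pos by simp
    ultimately have "wp c (\<lambda>t'. I (Suc i) t' \<and> vars t' x = i \<and> clk t' \<le> clk (tick t) + \<tau>) (tick t)"
      using body[of i "tick t"] i(1) U by simp
    then have "wp c (wp (inc x) (\<lambda>t'. J t' \<and> n - vars t' x < n - vars t x)) (tick t)"
    proof (rule wp_conseq)
      fix t' assume t': "I (Suc i) t' \<and> vars t' x = i \<and> clk t' \<le> clk (tick t) + \<tau>"
        and "unchanged (wvars c) (warrs c) (tick t) t'"
      then have "?U (tick (t'\<lparr>vars := (vars t')(x := Suc i)\<rparr>))"
        using i(3) by (simp add: unchanged_def)
      moreover have "I (Suc i) (tick (t'\<lparr>vars := (vars t')(x := Suc i)\<rparr>))"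
        using ind[of "Suc i" t'] t' by (simp add: unchanged_def)
      ultimately show "wp (inc x) (\<lambda>t'. J t' \<and> n - vars t' x < n - vars t x) t'"
        using t' i(1,4) \<open>i < n\<close> by (simp add: J_def)
    qed
    then show "wp (c ;; inc x) (\<lambda>t'. J t' \<and> n - vars t' x < n - vars t x) (tick t)" by simp
  next
    fix t assume "J t" and zero: "val (less_exp (Var x) e) t = 0"
    then obtain i where i: "i \<le> n" "vars t x = i" "I i t" "?U t" "clk t \<le> clk s + 1 + i * (\<tau> + 2)"
      by (auto simp: J_def)
    then have "i = n" using bound[OF i(3,4)] zero by simp
    moreover have "I i (tick t)" using ind[OF i(3)] by (simp add: unchanged_def)
    ultimately show "I n (tick t) \<and> clk (tick t) \<le> clk s + 2 + n * (\<tau> + 2)" using i by simp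
  qed
  then show ?thesis by (simp add: for_loop_def)
qed

definition block :: "('v, 'a) com list \<Rightarrow> ('v, 'a) com" where
  "block cs = foldr Seq cs Skip"

lemma wvars_block [simp]: "wvars (block cs) = \<Union> (wvars ` set cs)"
  by (induction cs) (auto simp: block_def)

lemma warrs_block [simp]: "warrs (block cs) = \<Union> (warrs ` set cs)"
  by (induction cs) (auto simp: block_def)

lemma wp_block:
  fixes I :: "nat \<Rightarrow> ('v, 'a) state \<Rightarrow> bool"
  assumes start: "I 0 s"
    and body: "\<And>i t. i < length cs \<Longrightarrow> I i t \<Longrightarrow>
      unchanged (\<Union> (wvars ` set cs)) (\<Union> (warrs ` set cs)) s t \<Longrightarrow>
      wp (cs ! i) (\<lambda>t'. I (Suc i) t' \<and> clk t' \<le> clk t + \<tau>) t"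
  shows "wp (block cs) (\<lambda>s'. I (length cs) s' \<and> clk s' \<le> clk s + length cs * \<tau>) s"
proof -
  let ?U = "unchanged (\<Union> (wvars ` set cs)) (\<Union> (warrs ` set cs)) s"
  have "wp (block (drop i cs)) (\<lambda>s'. I (length cs) s' \<and> clk s' \<le> clk s + length cs * \<tau>) t"
    if "i \<le> length cs" "I i t" "?U t" "clk t \<le> clk s + i * \<tau>" for i t
    using that
  proof (induction "length cs - i" arbitrary: i t)
    case 0
    then show ?case by (simp add: block_def)
  next
    case (Suc m)
    then have i: "i < length cs" by simp
    have "wp (cs ! i) (wp (block (drop (Suc i) cs))
        (\<lambda>s'. I (length cs) s' \<and> clk s' \<le> clk s + length cs * \<tau>)) t"
      using body[OF i Suc.prems(2,3)]
    proof (rule wp_conseq)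
      fix t' assume t': "I (Suc i) t' \<and> clk t' \<le> clk t + \<tau>"
        "unchanged (wvars (cs ! i)) (warrs (cs ! i)) t t'"
      have "unchanged (\<Union> (wvars ` set cs)) (\<Union> (warrs ` set cs)) t t'"
        by (rule unchanged_mono[OF t'(2)]) (use nth_mem[OF i] in auto)
      then have "?U t'" using Suc.prems(3) unchanged_trans by blast
      then show "wp (block (drop (Suc i) cs))
          (\<lambda>s'. I (length cs) s' \<and> clk s' \<le> clk s + length cs * \<tau>) t'"
        using Suc t' i by (intro Suc.hyps(1)) auto
    qed
    moreover have "block (drop i cs) = cs ! i ;; block (drop (Suc i) cs)"
      using i by (simp add: block_def flip: Cons_nth_drop_Suc)
    ultimately show ?case by simp
  qed
  from this[of 0 s] show ?thesis using start by simp
qed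

subsection \<open>Enumerating boxes\<close>

text \<open>Boxes \<open>lo i \<le> x i \<le> h\<close> for \<open>i < k\<close>, in mixed-radix order with the digit \<open>0\<close> running fastest.\<close>

definition box :: "(nat \<Rightarrow> nat) \<Rightarrow> nat \<Rightarrow> nat \<Rightarrow> (nat \<Rightarrow> nat) set" where
  "box lo h k = {x. \<forall>i<k. lo i \<le> x i \<and> x i \<le> h}"

definition weight :: "(nat \<Rightarrow> nat) \<Rightarrow> nat \<Rightarrow> nat \<Rightarrow> nat" where
  "weight lo h i = (\<Prod>j<i. Suc h - lo j)"

definition rank :: "(nat \<Rightarrow> nat) \<Rightarrow> nat \<Rightarrow> nat \<Rightarrow> (nat \<Rightarrow> nat) \<Rightarrow> nat" where
  "rank lo h k x = (\<Sum>i<k. (x i - lo i) * weight lo h i)"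

lemma weight_Suc: "weight lo h (Suc i) = weight lo h i * (Suc h - lo i)"
  by (simp add: weight_def)

lemma rank_Suc: "rank lo h (Suc k) x = rank lo h k x + (x k - lo k) * weight lo h k"
  by (simp add: rank_def)

lemma box_Suc: "x \<in> box lo h (Suc k) \<longleftrightarrow> x \<in> box lo h k \<and> lo k \<le> x k \<and> x k \<le> h"
  by (auto simp: box_def less_Suc_eq)

lemma rank_less_weight: "x \<in> box lo h k \<Longrightarrow> rank lo h k x < weight lo h k"
proof (induction k)
  case (Suc k)
  then have "rank lo h (Suc k) x < weight lo h k + (x k - lo k) * weight lo h k"
    by (simp add: rank_Suc box_Suc)
  also have "\<dots> = weight lo h k * Suc (x k - lo k)" by simp
  also have "\<dots> \<le> weight lo h k * (Suc h - lo k)" using Suc.prems unfolding box_Suc by (intro mult_le_mono2) linarith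
  finally show ?case by (simp add: weight_Suc)
qed (simp add: rank_def weight_def)

lemma rank_inj:
  "x \<in> box lo h k \<Longrightarrow> y \<in> box lo h k \<Longrightarrow> rank lo h k x = rank lo h k y \<Longrightarrow> i < k \<Longrightarrow> x i = y i"
proof (induction k)
  case (Suc k)
  let ?w = "weight lo h k"
  have less: "rank lo h k x < ?w" "rank lo h k y < ?w" using Suc.prems rank_less_weight box_Suc by blast+
  have eq: "rank lo h k x + (x k - lo k) * ?w = rank lo h k y + (y k - lo k) * ?w"
    using Suc.prems(3) by (simp add: rank_Suc)
  have "(rank lo h k x + (x k - lo k) * ?w) div ?w = x k - lo k"
    "(rank lo h k y + (y k - lo k) * ?w) div ?w = y k - lo k"
    using less by auto
  then have diff: "x k - lo k = y k - lo k" using eq by metis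
  then have "rank lo h k x = rank lo h k y" using eq by simp
  moreover have "x k = y k" using diff Suc.prems(1,2) unfolding box_Suc by linarith
  ultimately show ?case using Suc by (auto simp: box_Suc less_Suc_eq)
qed simp

lemma rank_start: "(\<And>i. i < k \<Longrightarrow> x i = lo i) \<Longrightarrow> rank lo h k x = 0"
  by (simp add: rank_def)

text \<open>
  Changing the digit at place \<open>i\<close>, as an equation of sums to avoid subtraction.
\<close>

lemma rank_upd:
  assumes "i < k"
  shows "rank lo h k (x(i := v)) + (x i - lo i) * weight lo h i = rank lo h k x + (v - lo i) * weight lo h i"
proof -
  have "rank lo h k y = (y i - lo i) * weight lo h i + (\<Sum>j\<in>{..<k} - {i}. (y j - lo j) * weight lo h j)" for y
    unfolding rank_def using assms by (simp add: sum.remove)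
  from this[of x] this[of "x(i := v)"] show ?thesis by simp
qed

text \<open>
  The successor in a box: a carry runs from the digit \<open>0\<close> upwards, and it is still there at the
  end exactly if the last tuple has been replaced by the first one.
\<close>

definition next_tuple :: "'v \<Rightarrow> 'v \<Rightarrow> 'a \<Rightarrow> 'a \<Rightarrow> ('v, 'a) exp \<Rightarrow> ('v, 'a) exp \<Rightarrow> ('v, 'a) com" where
  "next_tuple carry i pos lo h k = i ::= Num 0 ;; carry ::= Num 1 ;;
     Loop (and_exp (Var carry) (less_exp (Var i) k))
      (Cond (less_exp (Elt pos (Var i)) h)
        (Put pos (Var i) (Plus (Elt pos (Var i)) (Num 1)) ;; carry ::= Num 0)
        (Put pos (Var i) (Elt lo (Var i)) ;; inc i))"

lemma wvars_next_tuple [simp]: "wvars (next_tuple carry i pos lo h k) = {carry, i}"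
  by (auto simp: next_tuple_def)

lemma warrs_next_tuple [simp]: "warrs (next_tuple carry i pos lo h k) = {pos}"
  by (auto simp: next_tuple_def)

lemma wp_next_tuple:
  fixes s :: "('v, 'a) state" and lo :: 'a
  defines "lov \<equiv> arrs s lo"
  assumes distinct: "carry \<noteq> i" "pos \<noteq> lo"
    and x: "arrs s pos = x" "x \<in> box lov hv kv"
    and h: "\<And>t. unchanged {carry, i} {pos} s t \<Longrightarrow> val h t = hv"
    and k: "\<And>t. unchanged {carry, i} {pos} s t \<Longrightarrow> val k t = kv"
  shows "wp (next_tuple carry i pos lo h k) (\<lambda>s'. arrs s' pos \<in> box lov hv kv \<and>
     (if vars s' carry > 0 then Suc (rank lov hv kv x) = weight lov hv kv
      else rank lov hv kv (arrs s' pos) = Suc (rank lov hv kv x)) \<and>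
     clk s' \<le> clk s + 4 * kv + 7) s"
proof -
  let ?w = "weight lov hv" and ?r = "rank lov hv kv"
  let ?s = "tick (tick (s\<lparr>vars := ((vars s)(i := 0))(carry := 1)\<rparr>))"
  \<comment> \<open>As long as there is a carry at place \<open>i\<close>, all lower digits have been reset, and adding the weight of place \<open>i\<close> would give the successor of the original rank.\<close>
  define I where "I t \<longleftrightarrow> unchanged {carry, i} {pos} s t \<and> arrs t pos \<in> box lov hv kv \<and>
    vars t i \<le> kv \<and>
    (if vars t carry > 0 then (\<forall>j<vars t i. arrs t pos j = lov j) \<and>
        ?r (arrs t pos) + ?w (vars t i) = Suc (?r x) \<and> clk t \<le> clk s + 2 + 4 * vars t i
     else ?r (arrs t pos) = Suc (?r x) \<and> clk t \<le> clk s + 6 + 4 * vars t i)" for t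
  have "wp (Loop (and_exp (Var carry) (less_exp (Var i) k))
      (Cond (less_exp (Elt pos (Var i)) h)
        (Put pos (Var i) (Plus (Elt pos (Var i)) (Num 1)) ;; carry ::= Num 0)
        (Put pos (Var i) (Elt lo (Var i)) ;; inc i))) (\<lambda>s'. arrs s' pos \<in> box lov hv kv \<and>
     (if vars s' carry > 0 then Suc (?r x) = ?w kv else ?r (arrs s' pos) = Suc (?r x)) \<and>
     clk s' \<le> clk s + 4 * kv + 7) ?s"
  proof (rule wp_loop[where I = I and V = "\<lambda>t. (if vars t carry > 0 then 1 else 0) + (kv - vars t i)"])
    show "I ?s" using x distinct by (simp add: I_def unchanged_def weight_def)
  next
    fix t assume I: "I t" and pos: "0 < val (and_exp (Var carry) (less_exp (Var i) k)) t"
    have U: "unchanged {carry, i} {pos} s t" using I by (simp add: I_def)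
    have hk: "val h t = hv" "val k t = kv" using h k U by blast+
    have lo: "arrs t lo = lov" using unchanged_arr[OF U, of lo] distinct by (simp add: lov_def)
    have I': "arrs t pos \<in> box lov hv kv" "\<forall>j<vars t i. arrs t pos j = lov j" "vars t i < kv"
      "?r (arrs t pos) + ?w (vars t i) = Suc (?r x)" "clk t \<le> clk s + 2 + 4 * vars t i" "vars t carry > 0"
      using I pos hk by (auto simp: I_def split: if_splits)
    let ?i = "vars t i" let ?p = "arrs t pos"
    have pi: "lov ?i \<le> ?p ?i" "?p ?i \<le> hv" using I'(1,3) by (auto simp: box_def)
    have tick: "val h (tick t) = hv" using h[of "tick t"] U by (simp add: unchanged_def)
    show "wp (Cond (less_exp (Elt pos (Var i)) h)
        (Put pos (Var i) (Plus (Elt pos (Var i)) (Num 1)) ;; carry ::= Num 0)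
        (Put pos (Var i) (Elt lo (Var i)) ;; inc i))
      (\<lambda>t'. I t' \<and> (if vars t' carry > 0 then 1 else 0) + (kv - vars t' i)
         < (if vars t carry > 0 then 1 else 0) + (kv - vars t i)) (tick t)"
    proof (cases "?p ?i < hv")
      case True
      have "?r (?p(?i := Suc (?p ?i))) + (?p ?i - lov ?i) * ?w ?i = ?r ?p + (Suc (?p ?i) - lov ?i) * ?w ?i"
        by (rule rank_upd[OF I'(3)])
      then have "?r (?p(?i := Suc (?p ?i))) = Suc (?r x)" using pi I'(4) by (simp add: Suc_diff_le)
      moreover have "?p(?i := Suc (?p ?i)) \<in> box lov hv kv" using I'(1) True pi by (auto simp: box_def)
      ultimately show ?thesis using True tick I'(3,5,6) U distinct by (simp add: I_def unchanged_def)
    next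
      case False
      then have hv: "?p ?i = hv" using pi by simp
      have "?r (?p(?i := lov ?i)) + (?p ?i - lov ?i) * ?w ?i = ?r ?p + (lov ?i - lov ?i) * ?w ?i"
        by (rule rank_upd[OF I'(3)])
      moreover have "?w (Suc ?i) = ?w ?i + (hv - lov ?i) * ?w ?i" using pi by (simp add: weight_Suc Suc_diff_le)
      ultimately have "?r (?p(?i := lov ?i)) + ?w (Suc ?i) = Suc (?r x)" using I'(4) hv by simp
      moreover have "?p(?i := lov ?i) \<in> box lov hv kv" using I'(1) pi by (auto simp: box_def)
      moreover have "\<forall>j<Suc ?i. (?p(?i := lov ?i)) j = lov j" using I'(2) by (simp add: less_Suc_eq)
      ultimately show ?thesis using False tick lo I'(3,5,6) U distinct
        by (simp add: I_def unchanged_def)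
    qed
  next
    fix t assume I: "I t" and zero: "val (and_exp (Var carry) (less_exp (Var i) k)) t = 0"
    have U: "unchanged {carry, i} {pos} s t" using I by (simp add: I_def)
    have "?r (arrs t pos) = 0" if "vars t i = kv" "vars t carry > 0"
      using I that by (intro rank_start) (auto simp: I_def)
    then show "arrs (tick t) pos \<in> box lov hv kv \<and>
     (if vars (tick t) carry > 0 then Suc (?r x) = ?w kv else ?r (arrs (tick t) pos) = Suc (?r x)) \<and>
     clk (tick t) \<le> clk s + 4 * kv + 7"
      using I zero k[OF U] by (auto simp: I_def split: if_splits)
  qed
  then show ?thesis using distinct by (simp add: next_tuple_def)
qed

text \<open>The tuple that is held by \<open>pos\<close> at the beginning must be the first one of the box.\<close>

definition enumerate_box :: "'v \<Rightarrow> 'v \<Rightarrow> 'v \<Rightarrow> 'a \<Rightarrow> 'a \<Rightarrow> ('v, 'a) exp \<Rightarrow> ('v, 'a) exp \<Rightarrow> ('v, 'a) com \<Rightarrow>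
    ('v, 'a) com" where
  "enumerate_box busy carry i pos lo h k c = busy ::= Num 1 ;;
     Loop (Var busy) (c ;; next_tuple carry i pos lo h k ;; busy ::= Minus (Num 1) (Var carry))"

lemma wvars_enumerate_box [simp]:
  "wvars (enumerate_box busy carry i pos lo h k c) = {busy, carry, i} \<union> wvars c"
  by (auto simp: enumerate_box_def)

lemma warrs_enumerate_box [simp]:
  "warrs (enumerate_box busy carry i pos lo h k c) = insert pos (warrs c)"
  by (auto simp: enumerate_box_def)

text \<open>
  \<open>J r\<close> says that the tuples of rank below \<open>r\<close> have been treated. The body may rely on the current
  tuple being in the box, and it must leave the tuple alone.
\<close>

lemma wp_enumerate_box:
  fixes s :: "('v, 'a) state" and lo :: 'a and J :: "nat \<Rightarrow> ('v, 'a) state \<Rightarrow> bool"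
  defines "lov \<equiv> arrs s lo"
  assumes distinct: "carry \<noteq> i" "busy \<noteq> carry" "busy \<noteq> i" "pos \<noteq> lo"
    and free: "busy \<notin> wvars c" "pos \<notin> warrs c" "lo \<notin> warrs c"
    and start: "J 0 s" "\<And>j. j < kv \<Longrightarrow> arrs s pos j = lov j" "\<And>j. j < kv \<Longrightarrow> lov j \<le> hv"
    and ind: "\<And>r t t'. J r t \<Longrightarrow> unchanged {busy, carry, i} {pos} t t' \<Longrightarrow> J r t'"
    and h: "\<And>t. unchanged ({busy, carry, i} \<union> wvars c) (insert pos (warrs c)) s t \<Longrightarrow> val h t = hv"
    and k: "\<And>t. unchanged ({busy, carry, i} \<union> wvars c) (insert pos (warrs c)) s t \<Longrightarrow> val k t = kv"
    and body: "\<And>t. arrs t pos \<in> box lov hv kv \<Longrightarrow> J (rank lov hv kv (arrs t pos)) t \<Longrightarrow>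
      unchanged ({busy, carry, i} \<union> wvars c) (insert pos (warrs c)) s t \<Longrightarrow>
      wp c (\<lambda>t'. J (Suc (rank lov hv kv (arrs t pos))) t' \<and> clk t' \<le> clk t + \<tau>) t"
  shows "wp (enumerate_box busy carry i pos lo h k c) (\<lambda>s'. J (weight lov hv kv) s' \<and>
     clk s' \<le> clk s + 2 + weight lov hv kv * (\<tau> + 4 * kv + 9)) s"
proof -
  let ?V = "{busy, carry, i} \<union> wvars c" let ?W = "insert pos (warrs c)"
  let ?U = "unchanged ?V ?W s" let ?w = "weight lov hv kv" and ?r = "rank lov hv kv"
  let ?T = "\<tau> + 4 * kv + 9"
  let ?s = "tick (s\<lparr>vars := (vars s)(busy := 1)\<rparr>)"
  define I where "I t \<longleftrightarrow> ?U t \<and> vars t busy \<le> 1 \<and>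
    (if vars t busy > 0 then arrs t pos \<in> box lov hv kv \<and> J (?r (arrs t pos)) t \<and>
       clk t \<le> clk s + 1 + ?r (arrs t pos) * ?T
     else J ?w t \<and> clk t \<le> clk s + 1 + ?w * ?T)" for t
  have "wp (Loop (Var busy) (c ;; next_tuple carry i pos lo h k ;; busy ::= Minus (Num 1) (Var carry)))
    (\<lambda>s'. J ?w s' \<and> clk s' \<le> clk s + 2 + ?w * ?T) ?s"
  proof (rule wp_loop[where I = I and V = "\<lambda>t. if vars t busy > 0 then ?w - ?r (arrs t pos) else 0"])
    have "arrs s pos \<in> box lov hv kv" using start(2,3) by (auto simp: box_def)
    moreover have "?r (arrs s pos) = 0" using start(2) by (rule rank_start)
    moreover have "J 0 ?s" using ind[OF start(1)] by (simp add: unchanged_def)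
    ultimately show "I ?s" by (simp add: I_def unchanged_def)
  next
    fix t assume I: "I t" and busy: "0 < val (Var busy) t"
    then have t: "?U t" "arrs t pos \<in> box lov hv kv" "J (?r (arrs t pos)) t"
      "clk t \<le> clk s + 1 + ?r (arrs t pos) * ?T"
      by (auto simp: I_def)
    let ?x = "arrs t pos"
    have U: "?U (tick t)" using t(1) by (simp add: unchanged_def)
    have "J (?r ?x) (tick t)" using ind[OF t(3)] by (simp add: unchanged_def)
    then have "wp c (\<lambda>t'. J (Suc (?r ?x)) t' \<and> clk t' \<le> clk (tick t) + \<tau>) (tick t)"
      using body[of "tick t"] t(2) U by simp
    then have "wp c (wp (next_tuple carry i pos lo h k) (wp (busy ::= Minus (Num 1) (Var carry))
       (\<lambda>t'. I t' \<and> (if vars t' busy > 0 then ?w - ?r (arrs t' pos) else 0)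
         < (if vars t busy > 0 then ?w - ?r (arrs t pos) else 0)))) (tick t)"
    proof (rule wp_conseq)
      fix t1 assume t1: "J (Suc (?r ?x)) t1 \<and> clk t1 \<le> clk (tick t) + \<tau>"
        and U1: "unchanged (wvars c) (warrs c) (tick t) t1"
      have pos1: "arrs t1 pos = ?x" "arrs t1 lo = lov"
        using unchanged_arr[OF U1] free unchanged_arr[OF t(1), of lo] distinct by (auto simp: lov_def)
      have "unchanged ?V ?W (tick t) t1" by (rule unchanged_mono[OF U1]) auto
      then have Ut1: "?U t1" using U unchanged_trans by blast
      have U2: "?U t'" if "unchanged {carry, i} {pos} t1 t'" for t'
        by (rule unchanged_trans[OF Ut1 unchanged_mono[OF that]]) auto
      have "wp (next_tuple carry i pos lo h k) (\<lambda>s'. arrs s' pos \<in> box (arrs t1 lo) hv kv \<and>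
         (if vars s' carry > 0 then Suc (rank (arrs t1 lo) hv kv ?x) = weight (arrs t1 lo) hv kv
          else rank (arrs t1 lo) hv kv (arrs s' pos) = Suc (rank (arrs t1 lo) hv kv ?x)) \<and>
         clk s' \<le> clk t1 + 4 * kv + 7) t1"
        using h[OF U2] k[OF U2] distinct(1,4) pos1 t(2) by (intro wp_next_tuple) auto
      then show "wp (next_tuple carry i pos lo h k) (wp (busy ::= Minus (Num 1) (Var carry))
       (\<lambda>t'. I t' \<and> (if vars t' busy > 0 then ?w - ?r (arrs t' pos) else 0)
         < (if vars t busy > 0 then ?w - ?r (arrs t pos) else 0))) t1"
      proof (rule wp_conseq)
        fix t2 assume t2: "arrs t2 pos \<in> box (arrs t1 lo) hv kv \<and>
         (if vars t2 carry > 0 then Suc (rank (arrs t1 lo) hv kv ?x) = weight (arrs t1 lo) hv kv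
          else rank (arrs t1 lo) hv kv (arrs t2 pos) = Suc (rank (arrs t1 lo) hv kv ?x)) \<and>
         clk t2 \<le> clk t1 + 4 * kv + 7"
          and U3: "unchanged (wvars (next_tuple carry i pos lo h k)) (warrs (next_tuple carry i pos lo h k)) t1 t2"
        let ?t3 = "tick (t2\<lparr>vars := (vars t2)(busy := 1 - vars t2 carry)\<rparr>)"
        have J3: "J (Suc (?r ?x)) ?t3"
          using ind[OF conjunct1[OF t1], of ?t3] U3 by (simp add: unchanged_def)
        have "unchanged {carry, i} {pos} t1 t2" using U3 by simp
        note Ut2 = U2[OF this]
        have U4: "?U ?t3" using Ut2 by (simp add: unchanged_def)
        have rank: "?r ?x < ?w" using rank_less_weight[OF t(2)] .
        have rank2: "?r (arrs t2 pos) < ?w" using rank_less_weight t2 pos1(2) by blast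
        have clk3: "clk ?t3 \<le> clk s + 1 + Suc (?r ?x) * ?T" using t1 t2 t(4) by simp
        show "wp (busy ::= Minus (Num 1) (Var carry))
          (\<lambda>t'. I t' \<and> (if vars t' busy > 0 then ?w - ?r (arrs t' pos) else 0)
           < (if vars t busy > 0 then ?w - ?r (arrs t pos) else 0)) t2"
        proof (cases "vars t2 carry > 0")
          case True
          then have "Suc (?r ?x) = ?w" using t2 pos1(2) by simp
          then show ?thesis using True J3 U4 clk3 rank busy by (simp add: I_def)
        next
          case False
          then have "?r (arrs t2 pos) = Suc (?r ?x)" using t2 pos1(2) by simp
          then show ?thesis using False J3 U4 clk3 rank rank2 busy t2 pos1(2) by (simp add: I_def)
        qed
      qed
    qed
    then show "wp (c ;; next_tuple carry i pos lo h k ;; busy ::= Minus (Num 1) (Var carry))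
       (\<lambda>t'. I t' \<and> (if vars t' busy > 0 then ?w - ?r (arrs t' pos) else 0)
         < (if vars t busy > 0 then ?w - ?r (arrs t pos) else 0)) (tick t)" unfolding wp_Seq .
  next
    fix t assume I: "I t" and "val (Var busy) t = 0"
    then have "J ?w t" "clk t \<le> clk s + 1 + ?w * ?T" by (auto simp: I_def)
    moreover from this have "J ?w (tick t)" using ind by (simp add: unchanged_def)
    ultimately show "J ?w (tick t) \<and> clk (tick t) \<le> clk s + 2 + ?w * ?T" by simp
  qed
  then show ?thesis by (simp add: enumerate_box_def)
qed

section \<open>The search program\<close>

datatype reg = Answer | Length | Item | Reading | Univ | Ops | Ptr | Ok | Nullary
  | Op | Arity | Base | Power | Arg | Pivot | Filled | Stamp | Every | Hit | Count | Head
  | Code | Index | Good | Busy | Carry | Place | Busy_outer | Carry_outer | Place_outer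
  | Coord nat

datatype mem = Word | Times | Arities | Bases | Seen | Tuple | Zeros | Digits | Low | Queue nat

instance reg :: countable
proof
  have "x \<in> {Answer, Length, Item, Reading, Univ, Ops, Ptr, Ok, Nullary, Op, Arity, Base, Power, Arg,
      Pivot, Filled, Stamp, Every, Hit, Count, Head, Code, Index, Good, Busy, Carry, Place,
      Busy_outer, Carry_outer, Place_outer} \<union> range Coord" for x
    by (cases x) blast+
  then have "(UNIV :: reg set) = {Answer, Length, Item, Reading, Univ, Ops, Ptr, Ok, Nullary, Op, Arity,
      Base, Power, Arg, Pivot, Filled, Stamp, Every, Hit, Count, Head, Code, Index, Good, Busy, Carry,
      Place, Busy_outer, Carry_outer, Place_outer} \<union> range Coord"
    by blast
  moreover have "countable ({Answer, Length, Item, Reading, Univ, Ops, Ptr, Ok, Nullary, Op, Arity,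
      Base, Power, Arg, Pivot, Filled, Stamp, Every, Hit, Count, Head, Code, Index, Good, Busy, Carry,
      Place, Busy_outer, Carry_outer, Place_outer} \<union> range Coord)"
    by (rule countable_Un) (auto intro: countable_finite)
  ultimately show "\<exists>to_nat :: reg \<Rightarrow> nat. inj to_nat" by (simp add: countable_def)
qed

instance mem :: countable
proof
  have "x \<in> {Word, Times, Arities, Bases, Seen, Tuple, Zeros, Digits, Low} \<union> range Queue" for x
    by (cases x) blast+
  then have "(UNIV :: mem set) = {Word, Times, Arities, Bases, Seen, Tuple, Zeros, Digits, Low} \<union> range Queue"
    by blast
  moreover have "countable ({Word, Times, Arities, Bases, Seen, Tuple, Zeros, Digits, Low} \<union> range Queue)"
    by (rule countable_Un) (auto intro: countable_finite)
  ultimately show "\<exists>to_nat :: mem \<Rightarrow> nat. inj to_nat" by (simp add: countable_def)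
qed

type_synonym prog = "(reg, mem) com"
type_synonym pstate = "(reg, mem) state"

subsection \<open>Multiplication by the size of the universe\<close>

text \<open>
  The array \<open>Times\<close> replaces multiplication by \<open>N\<close>, so that codes of tuples are computed with
  one lookup per digit. It is filled by repeated addition up to the index \<open>Filled\<close>.
\<close>

definition times_ok :: "nat \<Rightarrow> pstate \<Rightarrow> bool" where
  "times_ok N s \<longleftrightarrow> vars s Univ = N \<and> (\<forall>v\<le>vars s Filled. arrs s Times v = v * N)"

lemma times_ok_unchanged:
  "times_ok N s \<Longrightarrow> unchanged V W s t \<Longrightarrow> Univ \<notin> V \<Longrightarrow> Filled \<notin> V \<Longrightarrow> Times \<notin> W \<Longrightarrow> times_ok N t"
  by (simp add: times_ok_def unchanged_def)

definition extend_times :: "(reg, mem) exp \<Rightarrow> prog" where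
  "extend_times e = Loop (less_exp (Var Filled) e)
     (Put Times (Plus (Var Filled) (Num 1)) (Plus (Elt Times (Var Filled)) (Var Univ)) ;; inc Filled)"

lemma frame_extend_times [simp]:
  "wvars (extend_times e) = {Filled}" "warrs (extend_times e) = {Times}"
  by (auto simp: extend_times_def)

lemma wp_extend_times:
  assumes s: "times_ok N s" and e: "\<And>t. unchanged {Filled} {Times} s t \<Longrightarrow> val e t = b"
  shows "wp (extend_times e) (\<lambda>t. times_ok N t \<and> vars t Filled = max (vars s Filled) b \<and>
    clk t \<le> clk s + 1 + 3 * b) s"
  unfolding extend_times_def
proof (rule wp_loop[where V = "\<lambda>t. b - vars t Filled" and
      I = "\<lambda>t. times_ok N t \<and> vars s Filled \<le> vars t Filled \<and> vars t Filled \<le> max (vars s Filled) b \<and>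
        clk t \<le> clk s + 3 * (vars t Filled - vars s Filled)"])
  fix t assume I: "times_ok N t \<and> vars s Filled \<le> vars t Filled \<and> vars t Filled \<le> max (vars s Filled) b \<and>
        clk t \<le> clk s + 3 * (vars t Filled - vars s Filled)"
    and U: "unchanged (wvars (Put Times (Plus (Var Filled) (Num 1)) (Plus (Elt Times (Var Filled)) (Var Univ)) ;; inc Filled))
      (warrs (Put Times (Plus (Var Filled) (Num 1)) (Plus (Elt Times (Var Filled)) (Var Univ)) ;; inc Filled)) s t"
  have eb: "val e t = b" using e U by simp
  {
    assume "0 < val (less_exp (Var Filled) e) t"
    then have "vars t Filled < b" using eb by simp
    then show "wp (Put Times (Plus (Var Filled) (Num 1)) (Plus (Elt Times (Var Filled)) (Var Univ)) ;; inc Filled)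
      (\<lambda>t'. (times_ok N t' \<and> vars s Filled \<le> vars t' Filled \<and> vars t' Filled \<le> max (vars s Filled) b \<and>
        clk t' \<le> clk s + 3 * (vars t' Filled - vars s Filled)) \<and> b - vars t' Filled < b - vars t Filled) (tick t)"
      using I by (auto simp: times_ok_def le_Suc_eq)
  next
    assume "val (less_exp (Var Filled) e) t = 0"
    then have "b \<le> vars t Filled" using eb by simp
    moreover have "3 * (vars t Filled - vars s Filled) \<le> 3 * b" using I by (auto simp: max_def split: if_splits)
    ultimately show "times_ok N (tick t) \<and> vars (tick t) Filled = max (vars s Filled) b \<and>
        clk (tick t) \<le> clk s + 1 + 3 * b"
      using I by (auto simp: times_ok_def)
  }
qed (use s in auto)

definition extend_times_to_power :: "nat \<Rightarrow> prog" where
  "extend_times_to_power D = Power ::= Num 1 ;;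
     block (replicate D (Power ::= Elt Times (Var Power) ;; extend_times (Var Power)))"

lemma frame_extend_times_to_power:
  "wvars (extend_times_to_power D) \<subseteq> {Power, Filled}" "warrs (extend_times_to_power D) \<subseteq> {Times}"
  by (auto simp: extend_times_to_power_def set_replicate_conv_if)

lemma wp_extend_times_to_power:
  assumes s: "times_ok N s" "vars s Filled \<ge> 1" and N: "N \<ge> 1"
  shows "wp (extend_times_to_power D) (\<lambda>t. times_ok N t \<and> vars t Filled \<ge> N ^ D \<and>
    vars t Filled \<ge> vars s Filled \<and> clk t \<le> clk s + 1 + D * (2 + 3 * N ^ D)) s"
proof -
  let ?cs = "replicate D (Power ::= Elt Times (Var Power) ;; extend_times (Var Power))"
  let ?s = "tick (s\<lparr>vars := (vars s)(Power := 1)\<rparr>)"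
  define I where "I i t \<longleftrightarrow> times_ok N t \<and> vars t Power = N ^ i \<and> N ^ i \<le> vars t Filled \<and>
    vars s Filled \<le> vars t Filled" for i and t :: pstate
  have "wp (block ?cs) (\<lambda>t. I (length ?cs) t \<and> clk t \<le> clk ?s + length ?cs * (2 + 3 * N ^ D)) ?s"
  proof (rule wp_block)
    show "I 0 ?s" using s by (auto simp: I_def times_ok_def)
  next
    fix i t assume i: "i < length ?cs" and I: "I i t"
    let ?t = "tick (t\<lparr>vars := (vars t)(Power := N ^ Suc i)\<rparr>)"
    have val: "arrs t Times (N ^ i) = N ^ Suc i" using I by (simp add: I_def times_ok_def)
    have "wp (extend_times (Var Power)) (\<lambda>t'. times_ok N t' \<and>
        vars t' Filled = max (vars ?t Filled) (N ^ Suc i) \<and> clk t' \<le> clk ?t + 1 + 3 * N ^ Suc i) ?t"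
      using I by (intro wp_extend_times) (auto simp: times_ok_def I_def unchanged_def)
    then have "wp (extend_times (Var Power)) (\<lambda>t'. I (Suc i) t' \<and> clk t' \<le> clk t + (2 + 3 * N ^ D)) ?t"
    proof (rule wp_conseq)
      fix t' assume t': "times_ok N t' \<and> vars t' Filled = max (vars ?t Filled) (N ^ Suc i) \<and>
          clk t' \<le> clk ?t + 1 + 3 * N ^ Suc i"
        and "unchanged (wvars (extend_times (Var Power))) (warrs (extend_times (Var Power))) ?t t'"
      then have "vars t' Power = N ^ Suc i" by (simp add: unchanged_def)
      moreover have "N ^ Suc i \<le> N ^ D" using i N by (intro power_increasing) auto
      ultimately show "I (Suc i) t' \<and> clk t' \<le> clk t + (2 + 3 * N ^ D)"
        using t' I by (auto simp: I_def)
    qed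
    then show "wp (?cs ! i) (\<lambda>t'. I (Suc i) t' \<and> clk t' \<le> clk t + (2 + 3 * N ^ D)) t"
      using i I val by (simp add: I_def)
  qed
  then have "wp (block ?cs) (\<lambda>t. times_ok N t \<and> vars t Filled \<ge> N ^ D \<and>
      vars t Filled \<ge> vars s Filled \<and> clk t \<le> clk s + 1 + D * (2 + 3 * N ^ D)) ?s"
    by (rule wp_mono) (simp add: I_def)
  then show ?thesis by (simp add: extend_times_to_power_def)
qed

subsection \<open>Applying an operation to elements of the queue\<close>

text \<open>The elements are tuples of length \<open>D\<close>, so every step on elements is unrolled \<open>D\<close> times.\<close>

definition apply_op :: "nat \<Rightarrow> prog" where
  "apply_op D = block (map (\<lambda>d. Index ::= Num 0 ;;
     for_loop Arg (Var Arity)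
       (Index ::= Plus (Elt Times (Var Index)) (Elt (Queue d) (Elt Digits (Var Arg)))) ;;
     Coord d ::= Elt Word (Plus (Var Base) (Var Index))) [0..<D])"

lemma frame_apply_op:
  "wvars (apply_op D) \<subseteq> {Index, Arg} \<union> range Coord" "warrs (apply_op D) = {}"
  by (auto simp: apply_op_def)

lemma wp_apply_op:
  fixes s :: pstate
  defines "q d l \<equiv> arrs s (Queue d) (arrs s Digits l)"
  assumes ok: "times_ok N s" and k: "vars s Arity = k" "N ^ k \<le> vars s Filled"
    and N: "N \<ge> 1" and args: "\<And>d l. d < D \<Longrightarrow> l < k \<Longrightarrow> q d l < N"
    and tab: "\<And>i. i < N ^ k \<Longrightarrow> arrs s Word (vars s Base + i) = tab ! i"
  shows "wp (apply_op D) (\<lambda>t. (\<forall>d<D. vars t (Coord d) = tab ! horner N (map (q d) [0..<k])) \<and>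
    clk t \<le> clk s + D * (4 + 3 * k)) s"
proof -
  let ?c = "\<lambda>d. Index ::= Num 0 ;; for_loop Arg (Var Arity)
       (Index ::= Plus (Elt Times (Var Index)) (Elt (Queue d) (Elt Digits (Var Arg)))) ;;
     Coord d ::= Elt Word (Plus (Var Base) (Var Index))"
  let ?cs = "map ?c [0..<D]"
  define I where "I i t \<longleftrightarrow> (\<forall>d<i. vars t (Coord d) = tab ! horner N (map (q d) [0..<k]))"
    for i and t :: pstate
  have "wp (block ?cs) (\<lambda>t. I (length ?cs) t \<and> clk t \<le> clk s + length ?cs * (4 + 3 * k)) s"
  proof (rule wp_block)
    show "I 0 s" by (simp add: I_def)
  next
    fix d t assume d: "d < length ?cs" and I: "I d t"
      and U: "unchanged (\<Union> (wvars ` set ?cs)) (\<Union> (warrs ` set ?cs)) s t"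
    have U': "unchanged ({Index, Arg} \<union> range Coord) {} s t" by (rule unchanged_mono[OF U]) auto
    let ?t = "tick (t\<lparr>vars := (vars t)(Index := 0)\<rparr>)"
    have Ut: "unchanged ({Index, Arg} \<union> range Coord) {} s ?t" using U' by (simp add: unchanged_def)
    have "wp (for_loop Arg (Var Arity)
         (Index ::= Plus (Elt Times (Var Index)) (Elt (Queue d) (Elt Digits (Var Arg)))))
       (\<lambda>t'. vars t' Index = horner N (map (q d) [0..<k]) \<and> clk t' \<le> clk ?t + 2 + k * (1 + 2)) ?t"
    proof (rule wp_for_loop[where I = "\<lambda>i t. vars t Index = horner N (map (q d) [0..<i])" and n = k
          and \<tau> = 1])
      fix i t' assume "i < k" and Index: "vars t' Index = horner N (map (q d) [0..<i])" and i: "vars t' Arg = i"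
        and "unchanged (insert Arg (wvars (Index ::= Plus (Elt Times (Var Index)) (Elt (Queue d) (Elt Digits (Var Arg))))))
          (warrs (Index ::= Plus (Elt Times (Var Index)) (Elt (Queue d) (Elt Digits (Var Arg))))) ?t t'"
      then have U2: "unchanged ({Index, Arg} \<union> range Coord) {} s t'"
        by (intro unchanged_trans[OF Ut]) (auto simp: unchanged_def)
      have "set (map (q d) [0..<i]) \<subseteq> {..<N}" using args d \<open>i < k\<close> by auto
      from horner_less[OF this] have "horner N (map (q d) [0..<i]) < N ^ i" by simp
      also have "N ^ i \<le> N ^ k" using N \<open>i < k\<close> by (intro power_increasing) auto
      finally have "horner N (map (q d) [0..<i]) \<le> vars t' Filled"
        using k(2) unchanged_var[OF U2, of Filled] by (simp add: image_iff)
      moreover have "times_ok N t'" by (rule times_ok_unchanged[OF ok U2]) auto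
      ultimately show "wp (Index ::= Plus (Elt Times (Var Index)) (Elt (Queue d) (Elt Digits (Var Arg))))
         (\<lambda>t''. vars t'' Index = horner N (map (q d) [0..<Suc i]) \<and> vars t'' Arg = i \<and> clk t'' \<le> clk t' + 1) t'"
        using Index i unchanged_arr[OF U2] by (simp add: times_ok_def q_def)
    next
      show "vars ?t Index = horner N (map (q d) [0..<0])" by simp
      show "val (Var Arity) t' = k" if "unchanged (insert Arg (wvars (Index ::= Plus (Elt Times (Var Index)) (Elt (Queue d) (Elt Digits (Var Arg))))))
          (warrs (Index ::= Plus (Elt Times (Var Index)) (Elt (Queue d) (Elt Digits (Var Arg))))) ?t t'" for t'
        using that k(1) unchanged_var[OF U', of Arity] by (simp add: unchanged_def image_iff)
    qed (auto simp: unchanged_def)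
    then have "wp (for_loop Arg (Var Arity)
         (Index ::= Plus (Elt Times (Var Index)) (Elt (Queue d) (Elt Digits (Var Arg)))))
       (wp (Coord d ::= Elt Word (Plus (Var Base) (Var Index))) (\<lambda>t'. I (Suc d) t' \<and> clk t' \<le> clk t + (4 + 3 * k))) ?t"
    proof (rule wp_conseq)
      fix t' assume t': "vars t' Index = horner N (map (q d) [0..<k]) \<and> clk t' \<le> clk ?t + 2 + k * (1 + 2)"
        and "unchanged (wvars (for_loop Arg (Var Arity)
         (Index ::= Plus (Elt Times (Var Index)) (Elt (Queue d) (Elt Digits (Var Arg))))))
          (warrs (for_loop Arg (Var Arity)
         (Index ::= Plus (Elt Times (Var Index)) (Elt (Queue d) (Elt Digits (Var Arg)))))) ?t t'"
      then have U1: "unchanged {Index, Arg} {} t t'" by (simp add: unchanged_def)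
      have U2: "unchanged ({Index, Arg} \<union> range Coord) {} s t'"
        by (rule unchanged_trans[OF U' unchanged_mono[OF U1]]) auto
      have "set (map (q d) [0..<k]) \<subseteq> {..<N}" using args d by auto
      from horner_less[OF this] have "arrs s Word (vars s Base + horner N (map (q d) [0..<k]))
          = tab ! horner N (map (q d) [0..<k])" by (intro tab) simp
      then have "arrs t' Word (vars t' Base + vars t' Index) = tab ! horner N (map (q d) [0..<k])"
        using t' unchanged_arr[OF U2] unchanged_var[OF U2, of Base] by (simp add: image_iff)
      moreover have "vars t' (Coord d') = vars t (Coord d')" for d' using unchanged_var[OF U1] by simp
      ultimately show "wp (Coord d ::= Elt Word (Plus (Var Base) (Var Index)))
         (\<lambda>t'. I (Suc d) t' \<and> clk t' \<le> clk t + (4 + 3 * k)) t'"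
        using I t' by (auto simp: I_def less_Suc_eq)
    qed
    then show "wp (?cs ! d) (\<lambda>t'. I (Suc d) t' \<and> clk t' \<le> clk t + (4 + 3 * k)) t"
      using d by simp
  qed
  then show ?thesis unfolding apply_op_def by (rule wp_mono) (simp add: I_def)
qed

subsection \<open>Inserting an element into the queue\<close>

text \<open>
  An element is in the queue if the cell of \<open>Seen\<close> whose index is the code of the element holds
  the number of the current search. Hence no cell has to be cleared before the next search.
\<close>

definition insert_code :: "nat \<Rightarrow> (nat \<times> nat) list \<Rightarrow> prog" where
  "insert_code D eqs = Code ::= Num 0 ;;
     block (map (\<lambda>d. Code ::= Plus (Elt Times (Var Code)) (Var (Coord d))) [0..<D]) ;;
     Cond (neq_exp (Elt Seen (Var Code)) (Var Stamp))
      (Put Seen (Var Code) (Var Stamp) ;;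
       block (map (\<lambda>d. Put (Queue d) (Var Count) (Var (Coord d))) [0..<D]) ;;
       inc Count ;; Good ::= Num 1 ;;
       block (map (\<lambda>(i, j). Cond (neq_exp (Var (Coord i)) (Var (Coord j))) (Good ::= Num 0) Skip) eqs) ;;
       Cond (Var Good) (Hit ::= Num 1) Skip)
      Skip"

lemma frame_insert_code:
  "wvars (insert_code D eqs) \<subseteq> {Code, Count, Good, Hit}" "warrs (insert_code D eqs) \<subseteq> {Seen} \<union> range Queue"
  by (auto simp: insert_code_def)

definition solved :: "(nat \<times> nat) list \<Rightarrow> nat list \<Rightarrow> bool" where
  "solved eqs e \<longleftrightarrow> (\<forall>(i, j)\<in>set eqs. e ! i = e ! j)"

definition vectors :: "nat \<Rightarrow> nat \<Rightarrow> nat list set" where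
  "vectors N D = {e. length e = D \<and> set e \<subseteq> {..<N}}"

definition stamps_ok :: "pstate \<Rightarrow> bool" where
  "stamps_ok s \<longleftrightarrow> (\<forall>v. arrs s Seen v \<le> vars s Stamp)"

text \<open>
  \<open>es\<close> is the list of elements found so far; \<open>Hit\<close> records whether one of them solves the equations.
\<close>

definition queue :: "nat \<Rightarrow> nat \<Rightarrow> (nat \<times> nat) list \<Rightarrow> nat list list \<Rightarrow> pstate \<Rightarrow> bool" where
  "queue N D eqs es s \<longleftrightarrow> vars s Count = length es \<and> distinct es \<and> set es \<subseteq> vectors N D \<and>
     (\<forall>c<length es. \<forall>d<D. arrs s (Queue d) c = es ! c ! d) \<and>
     (\<forall>e\<in>vectors N D. arrs s Seen (horner N e) = vars s Stamp \<longleftrightarrow> e \<in> set es) \<and>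
     (vars s Hit > 0 \<longleftrightarrow> (\<exists>e\<in>set es. solved eqs e)) \<and> stamps_ok s"

lemma queue_unchanged:
  assumes "queue N D eqs es s" "unchanged V W s t" "V \<inter> {Count, Stamp, Hit} = {}"
    "W \<inter> ({Seen} \<union> range Queue) = {}"
  shows "queue N D eqs es t"
proof -
  have "vars t Count = vars s Count" "vars t Stamp = vars s Stamp" "vars t Hit = vars s Hit"
    "arrs t Seen = arrs s Seen" "arrs t (Queue d) = arrs s (Queue d)" for d
    using assms(2-4) by (auto simp: unchanged_def)
  then show ?thesis using assms(1) by (simp add: queue_def stamps_ok_def)
qed

lemma wp_insert_code:
  fixes s :: pstate and D :: nat
  defines "e \<equiv> map (\<lambda>d. vars s (Coord d)) [0..<D]"
  assumes s: "queue N D eqs es s" "times_ok N s" "N ^ D \<le> vars s Filled" and N: "N \<ge> 1"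
    and e: "set e \<subseteq> {..<N}" and eqs: "set eqs \<subseteq> {..<D} \<times> {..<D}"
  shows "wp (insert_code D eqs) (\<lambda>t. queue N D eqs (if e \<in> set es then es else es @ [e]) t \<and>
    clk t \<le> clk s + (2 * D + 2 * length eqs + 8)) s"
proof -
  have e_vec: "e \<in> vectors N D" using e by (simp add: vectors_def e_def)
  have e_nth: "e ! d = vars s (Coord d)" if "d < D" for d using that by (simp add: e_def)
  let ?code = "map (\<lambda>d. Code ::= Plus (Elt Times (Var Code)) (Var (Coord d))) [0..<D] :: prog list"
  let ?copy = "map (\<lambda>d. Put (Queue d) (Var Count) (Var (Coord d))) [0..<D] :: prog list"
  let ?test = "map (\<lambda>(i, j). Cond (neq_exp (Var (Coord i)) (Var (Coord j))) (Good ::= Num 0) Skip) eqs :: prog list"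
  let ?s0 = "tick (s\<lparr>vars := (vars s)(Code := 0)\<rparr>)"
  let ?Q = "\<lambda>t. queue N D eqs (if e \<in> set es then es else es @ [e]) t \<and>
    clk t \<le> clk s + (2 * D + 2 * length eqs + 8)"
  have code: "wp (block ?code) (\<lambda>t. vars t Code = horner N (take (length ?code) e) \<and>
      clk t \<le> clk ?s0 + length ?code * 1) ?s0"
  proof (rule wp_block)
    fix d t assume d: "d < length ?code" and Code: "vars t Code = horner N (take d e)"
      and U: "unchanged (\<Union> (wvars ` set ?code)) (\<Union> (warrs ` set ?code)) ?s0 t"
    have U': "unchanged {Code} {} s t"
      using unchanged_mono[OF U, of "{Code}" "{}"] by (auto simp: unchanged_def)
    have d': "d < D" using d by simp
    have take: "take (Suc d) e = take d e @ [e ! d]" using d' by (simp add: take_Suc_conv_app_nth e_def)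
    have "set (take d e) \<subseteq> {..<N}" using e set_take_subset by fastforce
    from horner_less[OF this] have "horner N (take d e) < N ^ d" using d' by (simp add: e_def)
    also have "N ^ d \<le> N ^ D" using d' N by (intro power_increasing) auto
    finally have "horner N (take d e) \<le> vars t Filled" using s(3) unchanged_var[OF U'] by simp
    moreover have "times_ok N t" by (rule times_ok_unchanged[OF s(2) U']) auto
    ultimately show "wp (?code ! d) (\<lambda>t'. vars t' Code = horner N (take (Suc d) e) \<and> clk t' \<le> clk t + 1) t"
      using d' Code unchanged_var[OF U'] unfolding take by (simp add: times_ok_def e_nth)
  qed simp
  then have "wp (block ?code) (wp (Cond (neq_exp (Elt Seen (Var Code)) (Var Stamp))
      (Put Seen (Var Code) (Var Stamp) ;; block ?copy ;; inc Count ;; Good ::= Num 1 ;; block ?test ;;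
       Cond (Var Good) (Hit ::= Num 1) Skip) Skip) ?Q) ?s0"
  proof (rule wp_conseq)
    fix t assume t: "vars t Code = horner N (take (length ?code) e) \<and> clk t \<le> clk ?s0 + length ?code * 1"
      and U: "unchanged (wvars (block ?code)) (warrs (block ?code)) ?s0 t"
    have U': "unchanged {Code} {} s t"
      using unchanged_mono[OF U, of "{Code}" "{}"] by (auto simp: unchanged_def)
    have Code: "vars t Code = horner N e" using t by (simp add: e_def)
    have q: "queue N D eqs es t" by (rule queue_unchanged[OF s(1) U']) auto
    have seen: "arrs t Seen (vars t Code) = vars t Stamp \<longleftrightarrow> e \<in> set es"
      using q e_vec Code unfolding queue_def by simp
    have coord: "vars t (Coord d) = e ! d" if "d < D" for d
      using unchanged_var[OF U'] that by (simp add: e_nth)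
    show "wp (Cond (neq_exp (Elt Seen (Var Code)) (Var Stamp))
      (Put Seen (Var Code) (Var Stamp) ;; block ?copy ;; inc Count ;; Good ::= Num 1 ;; block ?test ;;
       Cond (Var Good) (Hit ::= Num 1) Skip) Skip) ?Q t"
    proof (cases "e \<in> set es")
      case True
      have "queue N D eqs es (tick t)" by (rule queue_unchanged[OF q, of "{}" "{}"]) (auto simp: unchanged_def)
      then show ?thesis using True seen t by simp
    next
      case False
      let ?t1 = "tick ((tick t)\<lparr>arrs := (arrs t)(Seen := (arrs t Seen)(horner N e := vars t Stamp))\<rparr>)"
      define C where "C i u \<longleftrightarrow> (\<forall>d. arrs u (Queue d) =
        (if d < i then (arrs t (Queue d))(vars t Count := e ! d) else arrs t (Queue d)))" for i and u :: pstate
      have "wp (block ?copy) (\<lambda>u. C (length ?copy) u \<and> clk u \<le> clk ?t1 + length ?copy * 1) ?t1"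
      proof (rule wp_block)
        fix d u assume d: "d < length ?copy" and C: "C d u"
          and U2: "unchanged (\<Union> (wvars ` set ?copy)) (\<Union> (warrs ` set ?copy)) ?t1 u"
        have "unchanged {} (range Queue) ?t1 u" by (rule unchanged_mono[OF U2]) auto
        then have "vars u (Coord d) = e ! d" "vars u Count = vars t Count"
          using coord[of d] d by (auto simp: unchanged_def)
        then show "wp (?copy ! d) (\<lambda>u'. C (Suc d) u' \<and> clk u' \<le> clk u + 1) u"
          using C d by (auto simp: C_def less_Suc_eq)
      qed (simp add: C_def)
      then have "wp (block ?copy) (wp (inc Count ;; Good ::= Num 1 ;; block ?test ;;
          Cond (Var Good) (Hit ::= Num 1) Skip) ?Q) ?t1"
      proof (rule wp_conseq)
        fix u assume u: "C (length ?copy) u \<and> clk u \<le> clk ?t1 + length ?copy * 1"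
          and U2: "unchanged (wvars (block ?copy)) (warrs (block ?copy)) ?t1 u"
        have U3: "unchanged {} (range Queue) ?t1 u" by (rule unchanged_mono[OF U2]) auto
        let ?u = "tick (tick (u\<lparr>vars := ((vars u)(Count := Suc (vars u Count)))(Good := 1)\<rparr>))"
        define H where "H i v \<longleftrightarrow> (vars v Good > 0 \<longleftrightarrow> solved (take i eqs) e)" for i and v :: pstate
        have "wp (block ?test) (\<lambda>v. H (length ?test) v \<and> clk v \<le> clk ?u + length ?test * 2) ?u"
        proof (rule wp_block)
          fix i v assume i: "i < length ?test" and H: "H i v"
            and U4: "unchanged (\<Union> (wvars ` set ?test)) (\<Union> (warrs ` set ?test)) ?u v"
          have U5: "unchanged {Good} {} ?u v" by (rule unchanged_mono[OF U4]) auto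
          obtain a b where ab: "eqs ! i = (a, b)" "a < D" "b < D"
            using i eqs nth_mem[of i eqs] by (cases "eqs ! i") auto
          have "vars v (Coord d) = e ! d" if "d < D" for d
            using U5 U3 coord[OF that] by (simp add: unchanged_def)
          moreover have "take (Suc i) eqs = take i eqs @ [(a, b)]"
            using i ab by (simp add: take_Suc_conv_app_nth)
          ultimately show "wp (?test ! i) (\<lambda>v'. H (Suc i) v' \<and> clk v' \<le> clk v + 2) v"
            using H i ab by (auto simp: H_def solved_def)
        qed (simp add: H_def solved_def)
        then have "wp (block ?test) (wp (Cond (Var Good) (Hit ::= Num 1) Skip) ?Q) ?u"
        proof (rule wp_conseq)
          fix v assume v: "H (length ?test) v \<and> clk v \<le> clk ?u + length ?test * 2"
            and U5: "unchanged (wvars (block ?test)) (warrs (block ?test)) ?u v"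
          have U4: "unchanged {Good} {} ?u v" by (rule unchanged_mono[OF U5]) auto
          define v' where "v' = tick (if vars v Good > 0 then tick (v\<lparr>vars := (vars v)(Hit := 1)\<rparr>) else v)"
          have vars: "vars v' Count = Suc (length es)" "vars v' Stamp = vars t Stamp"
            "arrs v' Seen = (arrs t Seen)(horner N e := vars t Stamp)"
            "vars v' Hit > 0 \<longleftrightarrow> vars t Hit > 0 \<or> solved eqs e"
            using U4 U3 v q by (auto simp: v'_def unchanged_def queue_def H_def)
          have queue_d: "arrs v' (Queue d) = (arrs t (Queue d))(length es := e ! d)" if "d < D" for d
            using U4 u that q by (auto simp: v'_def unchanged_def C_def queue_def)
          have "(arrs v' Seen (horner N f) = vars v' Stamp) = (f \<in> set (es @ [e]))" if "f \<in> vectors N D" for f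
          proof (cases "f = e")
            case False
            then have "horner N f \<noteq> horner N e"
              using horner_inj[of f e N] that e_vec by (auto simp: vectors_def)
            then show ?thesis using False vars q that by (simp add: queue_def)
          qed (simp add: vars)
          then have "queue N D eqs (es @ [e]) v'"
            using q vars queue_d False e_vec
            by (auto simp: queue_def stamps_ok_def nth_append less_Suc_eq)
          moreover have "clk v' \<le> clk s + (2 * D + 2 * length eqs + 8)"
            using v u t by (auto simp: v'_def)
          ultimately have "?Q v'" using False by simp
          moreover have "wp (Cond (Var Good) (Hit ::= Num 1) Skip) ?Q v = ?Q v'"
            by (simp add: v'_def)
          ultimately show "wp (Cond (Var Good) (Hit ::= Num 1) Skip) ?Q v" by (simp only:)
        qed
        then show "wp (inc Count ;; Good ::= Num 1 ;; block ?test ;;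
          Cond (Var Good) (Hit ::= Num 1) Skip) ?Q u" by simp
      qed
      then show ?thesis using False seen Code by simp
    qed
  qed
  then show ?thesis unfolding insert_code_def by simp
qed

subsection \<open>Generating a subpower\<close>

text \<open>
  Applies one operation to all arguments from the queue that have the head at place \<open>Pivot\<close> and do
  not go beyond the head. The lower bounds of the box are \<open>0\<close> except at \<open>Pivot\<close>, where the lower
  and the upper bound are the position of the head, so for arity \<open>k\<close> and head \<open>q\<close> there are only
  \<open>Suc q ^ (k - 1)\<close> rounds.
\<close>

definition pivot_code :: "nat \<Rightarrow> (nat \<times> nat) list \<Rightarrow> prog" where
  "pivot_code D eqs =
     for_loop Arg (Var Arity) (Put Digits (Var Arg) (Num 0) ;; Put Low (Var Arg) (Num 0)) ;;
     Put Digits (Var Pivot) (Var Head) ;; Put Low (Var Pivot) (Var Head) ;;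
     enumerate_box Busy Carry Place Digits Low (Var Head) (Var Arity) (apply_op D ;; insert_code D eqs)"

definition op_code :: "nat \<Rightarrow> (nat \<times> nat) list \<Rightarrow> prog" where
  "op_code D eqs = Arity ::= Elt Arities (Var Op) ;; Base ::= Elt Bases (Var Op) ;;
     for_loop Pivot (Var Arity) (pivot_code D eqs)"

definition close_code :: "nat \<Rightarrow> (nat \<times> nat) list \<Rightarrow> prog" where
  "close_code D eqs = Head ::= Num 0 ;;
     Loop (less_exp (Var Head) (Var Count)) (for_loop Op (Var Ops) (op_code D eqs) ;; inc Head)"

definition body_vars :: "reg set" where
  "body_vars = {Index, Code, Count, Good, Hit} \<union> range Coord"

lemma frame_pivot_code:
  "wvars (pivot_code D eqs) \<subseteq> {Arg, Busy, Carry, Place} \<union> body_vars"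
  "warrs (pivot_code D eqs) \<subseteq> {Digits, Low, Seen} \<union> range Queue"
  using frame_apply_op[of D] frame_insert_code[of D eqs] by (auto simp: pivot_code_def body_vars_def)

lemma frame_op_code:
  "wvars (op_code D eqs) \<subseteq> {Arity, Base, Pivot, Arg, Busy, Carry, Place} \<union> body_vars"
  "warrs (op_code D eqs) \<subseteq> {Digits, Low, Seen} \<union> range Queue"
  using frame_pivot_code[of D eqs] by (auto simp: op_code_def)

lemma frame_close_code:
  "wvars (close_code D eqs) \<subseteq> {Head, Op, Arity, Base, Pivot, Arg, Busy, Carry, Place} \<union> body_vars"
  "warrs (close_code D eqs) \<subseteq> {Digits, Low, Seen} \<union> range Queue"
  using frame_op_code[of D eqs] by (auto simp: close_code_def)

lemma weight_pivot:
  assumes "j < k" "lo j = q" "\<And>l. l < k \<Longrightarrow> l \<noteq> j \<Longrightarrow> lo l = 0"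
  shows "weight lo q k = Suc q ^ (k - 1)"
proof -
  have "weight lo q k = (Suc q - lo j) * (\<Prod>l\<in>{..<k} - {j}. Suc q - lo l)"
    unfolding weight_def using assms(1) by (simp add: prod.remove)
  also have "(\<Prod>l\<in>{..<k} - {j}. Suc q - lo l) = (\<Prod>l\<in>{..<k} - {j}. Suc q)"
    using assms(3) by (intro prod.cong) auto
  finally show ?thesis using assms(1,2) by simp
qed

locale search =
  fixes N D \<kappa> :: nat and T :: "(nat \<times> nat list) list" and eqs :: "(nat \<times> nat) list"
  assumes N: "N \<ge> 1"
    and valid: "\<And>t. t \<in> set T \<Longrightarrow> valid_table N t"
    and arity: "\<And>t. t \<in> set T \<Longrightarrow> 1 \<le> fst t \<and> fst t \<le> \<kappa>"
    and eqs: "set eqs \<subseteq> {..<D} \<times> {..<D}"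
    and T: "T \<noteq> []"
begin

lemma \<kappa>: "\<kappa> \<ge> 1"
  using T arity[of "hd T"] by simp

text \<open>
  Bounds for the parts of a search. They use the maximal arity \<open>\<kappa>\<close> for every operation, which is
  wasteful, but still good enough for \<open>search_time_core\<close>.
\<close>

definition step_time :: nat where
  "step_time = 9 * D + 2 * length eqs + 31"

definition op_time :: nat where
  "op_time = (step_time + 6) * (\<kappa> * \<kappa> * (N ^ D) ^ (\<kappa> - 1))"

definition close_time :: nat where
  "close_time = 2 + N ^ D * (4 + length T * (op_time + 2))"

definition env :: "pstate \<Rightarrow> bool" where
  "env s \<longleftrightarrow> vars s Ops = length T \<and> (\<forall>p<length T. arrs s Arities p = fst (T ! p) \<and>
       (\<forall>i<N ^ fst (T ! p). arrs s Word (arrs s Bases p + i) = snd (T ! p) ! i) \<and>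
       N ^ fst (T ! p) \<le> vars s Filled) \<and>
     times_ok N s \<and> N ^ D \<le> vars s Filled"

lemma env_unchanged:
  assumes "env s" "unchanged V W s t" "V \<inter> {Ops, Univ, Filled} = {}"
    "W \<inter> {Arities, Bases, Word, Times} = {}"
  shows "env t"
proof -
  have "vars t Ops = vars s Ops" "vars t Filled = vars s Filled"
    "arrs t Arities = arrs s Arities" "arrs t Bases = arrs s Bases" "arrs t Word = arrs s Word"
    using assms(2-4) by (auto simp: unchanged_def)
  moreover have "times_ok N t"
    using assms by (intro times_ok_unchanged[OF _ assms(2)]) (auto simp: env_def)
  ultimately show ?thesis using assms(1) by (simp add: env_def)
qed

definition result :: "nat \<Rightarrow> nat list list \<Rightarrow> nat list" where
  "result p es = map (\<lambda>d. snd (T ! p) ! horner N (map (\<lambda>e. e ! d) es)) [0..<D]"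

text \<open>
  The results that are due when the element at position \<open>q\<close> is the head and \<open>j\<close> is the pivot.
\<close>

definition produced :: "nat list list \<Rightarrow> nat \<Rightarrow> nat \<Rightarrow> nat \<Rightarrow> nat list set" where
  "produced es q p j = {result p (map (\<lambda>l. es ! x l) [0..<fst (T ! p)]) |x.
     (\<forall>l<fst (T ! p). x l \<le> q) \<and> x j = q}"

text \<open>
  The queue has grown from \<open>es\<close> without leaving \<open>S\<close>, and it contains all of \<open>P\<close>.
\<close>

definition reach :: "nat list set \<Rightarrow> nat list list \<Rightarrow> nat list set \<Rightarrow> pstate \<Rightarrow> bool" where
  "reach S es P s \<longleftrightarrow> (\<exists>fs. queue N D eqs (es @ fs) s \<and> set (es @ fs) \<subseteq> S \<and> P \<subseteq> set (es @ fs))"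

lemma reach_unchanged:
  "reach S es P s \<Longrightarrow> unchanged V W s t \<Longrightarrow> V \<inter> {Count, Stamp, Hit} = {} \<Longrightarrow>
   W \<inter> ({Seen} \<union> range Queue) = {} \<Longrightarrow> reach S es P t"
  unfolding reach_def using queue_unchanged by blast

lemma reach_subset: "reach S es P s \<Longrightarrow> Q \<subseteq> P \<Longrightarrow> reach S es Q s"
  unfolding reach_def by blast

lemma wp_insert_reach:
  assumes s: "reach S es P s" "times_ok N s" "N ^ D \<le> vars s Filled"
    and e: "map (\<lambda>d. vars s (Coord d)) [0..<D] = e" "e \<in> S" "S \<subseteq> vectors N D"
  shows "wp (insert_code D eqs) (\<lambda>t. reach S es (insert e P) t \<and>
    clk t \<le> clk s + (2 * D + 2 * length eqs + 8)) s"
proof -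
  obtain fs where fs: "queue N D eqs (es @ fs) s" "set (es @ fs) \<subseteq> S" "P \<subseteq> set (es @ fs)"
    using s(1) unfolding reach_def by blast
  have "set (map (\<lambda>d. vars s (Coord d)) [0..<D]) \<subseteq> {..<N}"
    using e unfolding e(1) by (auto simp: vectors_def)
  from wp_insert_code[OF fs(1) s(2,3) N this eqs]
  show ?thesis
  proof (rule wp_mono)
    fix t assume t: "queue N D eqs (if map (\<lambda>d. vars s (Coord d)) [0..<D] \<in> set (es @ fs) then es @ fs
        else (es @ fs) @ [map (\<lambda>d. vars s (Coord d)) [0..<D]]) t \<and>
        clk t \<le> clk s + (2 * D + 2 * length eqs + 8)"
    show "reach S es (insert e P) t \<and> clk t \<le> clk s + (2 * D + 2 * length eqs + 8)"
    proof (cases "e \<in> set (es @ fs)")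
      case True
      then have "queue N D eqs (es @ fs) t" using t unfolding e(1) by simp
      then show ?thesis using True fs t unfolding reach_def by blast
    next
      case False
      then have "queue N D eqs (es @ (fs @ [e])) t" using t unfolding e(1) by simp
      moreover have "set (es @ (fs @ [e])) \<subseteq> S" "insert e P \<subseteq> set (es @ (fs @ [e]))"
        using fs e(2) by auto
      ultimately show ?thesis using t unfolding reach_def by blast
    qed
  qed
qed

end

text \<open>
  \<open>S\<close> is a subuniverse of the power of the algebra given by the tables.
\<close>

locale search_subpower = search +
  fixes S :: "nat list set"
  assumes S: "S \<subseteq> vectors N D"
    and closed: "\<And>p es. p < length T \<Longrightarrow> length es = fst (T ! p) \<Longrightarrow> set es \<subseteq> S \<Longrightarrow> result p es \<in> S"
begin

lemma wp_pivot_code: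
  assumes s: "env s" "reach S es P s" and p: "p < length T" and k: "vars s Arity = fst (T ! p)"
    and base: "vars s Base = arrs s Bases p" and j: "vars s Pivot = j" "j < fst (T ! p)"
    and q: "vars s Head = q" "q < length es"
  shows "wp (pivot_code D eqs) (\<lambda>t. reach S es (P \<union> produced es q p j) t \<and>
    clk t \<le> clk s + step_time * fst (T ! p) * Suc q ^ (fst (T ! p) - 1)) s"
proof -
  let ?k = "fst (T ! p)"
  let ?init = "Put Digits (Var Arg) (Num 0) ;; Put Low (Var Arg) (Num 0) :: prog"
  let ?c = "apply_op D ;; insert_code D eqs"
  let ?Q = "\<lambda>t. reach S es (P \<union> produced es q p j) t \<and>
    clk t \<le> clk s + step_time * ?k * Suc q ^ (?k - 1)"
  have k1: "?k \<ge> 1" using arity p nth_mem by blast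
  have "wp (for_loop Arg (Var Arity) ?init)
    (\<lambda>t. (\<forall>l<?k. arrs t Digits l = 0 \<and> arrs t Low l = 0) \<and> clk t \<le> clk s + 2 + ?k * (2 + 2)) s"
    by (rule wp_for_loop[where I = "\<lambda>i t. \<forall>l<i. arrs t Digits l = 0 \<and> arrs t Low l = 0" and n = ?k])
      (auto simp: unchanged_def less_Suc_eq k)
  then have "wp (for_loop Arg (Var Arity) ?init)
    (wp (Put Digits (Var Pivot) (Var Head) ;; Put Low (Var Pivot) (Var Head) ;;
      enumerate_box Busy Carry Place Digits Low (Var Head) (Var Arity) ?c) ?Q) s"
  proof (rule wp_conseq)
    fix t assume t: "(\<forall>l<?k. arrs t Digits l = 0 \<and> arrs t Low l = 0) \<and> clk t \<le> clk s + 2 + ?k * (2 + 2)"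
      and "unchanged (wvars (for_loop Arg (Var Arity) ?init)) (warrs (for_loop Arg (Var Arity) ?init)) s t"
    then have U: "unchanged {Arg} {Digits, Low} s t" by (simp add: unchanged_def)
    define u where "u = tick (tick (t\<lparr>arrs := (arrs t)(Digits := (arrs t Digits)(j := q),
      Low := (arrs t Low)(j := q))\<rparr>))"
    have Uu: "unchanged {Arg} {Digits, Low} s u" using U by (simp add: unchanged_def u_def)
    define lo where "lo = arrs u Low"
    have lo: "lo j = q" "l < ?k \<Longrightarrow> l \<noteq> j \<Longrightarrow> lo l = 0" for l using t by (simp_all add: lo_def u_def)
    define B where "B = box lo q ?k"
    have B: "x \<in> B \<longleftrightarrow> (\<forall>l<?k. x l \<le> q) \<and> x j = q" for x
      using lo j(2) unfolding B_def box_def by (force intro: antisym)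
    define elem where "elem x = result p (map (\<lambda>l. es ! x l) [0..<?k])" for x
    define J where "J r = reach S es (P \<union> {elem x |x. x \<in> B \<and> rank lo q ?k x < r})" for r
    let ?V = "{Arg, Busy, Carry, Place} \<union> body_vars" let ?W = "{Digits, Low, Seen} \<union> range Queue"
    have frame_c: "{Busy, Carry, Place} \<union> wvars ?c \<subseteq> ?V" "insert Digits (warrs ?c) \<subseteq> ?W"
      using frame_apply_op[of D] frame_insert_code[of D eqs] by (auto simp: body_vars_def)
    have Us: "unchanged ?V ?W s v"
      if "unchanged ({Busy, Carry, Place} \<union> wvars ?c) (insert Digits (warrs ?c)) u v" for v
    proof -
      have "unchanged ?V ?W s u" by (rule unchanged_mono[OF Uu]) auto
      moreover have "unchanged ?V ?W u v" using unchanged_mono[OF that frame_c] .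
      ultimately show ?thesis using unchanged_trans by blast
    qed
    have "wp (enumerate_box Busy Carry Place Digits Low (Var Head) (Var Arity) ?c)
      (\<lambda>v. J (weight (arrs u Low) q ?k) v \<and> clk v \<le> clk u + 2 + weight (arrs u Low) q ?k *
        ((D * (4 + 3 * ?k) + (2 * D + 2 * length eqs + 8)) + 4 * ?k + 9)) u"
    proof (rule wp_enumerate_box)
      show "J 0 u" unfolding J_def by (rule reach_unchanged[OF reach_subset[OF s(2)] Uu]) auto
      show "arrs u Digits l = arrs u Low l" if "l < ?k" for l using that t by (simp add: u_def)
      show "arrs u Low l \<le> q" if "l < ?k" for l using that lo(1) lo(2)[of l] unfolding lo_def by (cases "l = j") auto
      show "J r v'" if "J r v" "unchanged {Busy, Carry, Place} {Digits} v v'" for r v v'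
        unfolding J_def by (rule reach_unchanged[OF that[unfolded J_def]]) auto
      show "val (Var Head) v = q"
        if "unchanged ({Busy, Carry, Place} \<union> wvars ?c) (insert Digits (warrs ?c)) u v" for v
        using unchanged_var[OF Us[OF that], of Head] q by (auto simp: body_vars_def)
      show "val (Var Arity) v = ?k"
        if "unchanged ({Busy, Carry, Place} \<union> wvars ?c) (insert Digits (warrs ?c)) u v" for v
        using unchanged_var[OF Us[OF that], of Arity] k by (auto simp: body_vars_def)
    next
      fix v assume x: "arrs v Digits \<in> box (arrs u Low) q ?k"
        and Jv: "J (rank (arrs u Low) q ?k (arrs v Digits)) v"
        and "unchanged ({Busy, Carry, Place} \<union> wvars ?c) (insert Digits (warrs ?c)) u v"
      then have Uv: "unchanged ?V ?W s v" using Us by blast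
      let ?x = "arrs v Digits"
      let ?r = "rank lo q ?k ?x"
      let ?P = "P \<union> {elem x |x. x \<in> B \<and> rank lo q ?k x < ?r}"
      have xB: "?x \<in> B" using x by (simp add: B_def lo_def)
      have env: "env v" by (rule env_unchanged[OF s(1) Uv]) (auto simp: body_vars_def)
      have reach: "reach S es ?P v" using Jv unfolding J_def lo_def .
      then obtain fs where fs: "queue N D eqs (es @ fs) v" "set (es @ fs) \<subseteq> S" unfolding reach_def by blast
      have es_S: "set es \<subseteq> S" using fs(2) by auto
      have x_less: "?x l < length es" if "l < ?k" for l using B xB that q(2) by fastforce
      have queue_nth: "arrs v (Queue d) (?x l) = es ! ?x l ! d" if "d < D" "l < ?k" for d l
        using fs(1) that x_less[OF that(2)] unfolding queue_def by (simp add: nth_append)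
      have less_N: "es ! ?x l ! d < N" if "d < D" "l < ?k" for d l
      proof -
        have "es ! ?x l \<in> vectors N D" using x_less[OF that(2)] es_S S nth_mem by blast
        then show ?thesis using that(1) nth_mem by (fastforce simp: vectors_def)
      qed
      have vals: "vars v Arity = ?k" "vars v Base = arrs v Bases p"
        using unchanged_var[OF Uv, of Arity] unchanged_var[OF Uv, of Base] unchanged_arr[OF Uv, of Bases] k base
        by (auto simp: body_vars_def image_iff)
      have "wp (apply_op D) (\<lambda>w. (\<forall>d<D. vars w (Coord d) = snd (T ! p) !
          horner N (map (\<lambda>l. arrs v (Queue d) (arrs v Digits l)) [0..<?k])) \<and>
          clk w \<le> clk v + D * (4 + 3 * ?k)) v"
        using env p vals less_N queue_nth N by (intro wp_apply_op) (auto simp: env_def)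
      then have "wp (apply_op D) (wp (insert_code D eqs) (\<lambda>w. J (Suc ?r) w \<and>
          clk w \<le> clk v + (D * (4 + 3 * ?k) + (2 * D + 2 * length eqs + 8)))) v"
      proof (rule wp_conseq)
        fix w assume w: "(\<forall>d<D. vars w (Coord d) = snd (T ! p) !
            horner N (map (\<lambda>l. arrs v (Queue d) (arrs v Digits l)) [0..<?k])) \<and>
            clk w \<le> clk v + D * (4 + 3 * ?k)"
          and Uw0: "unchanged (wvars (apply_op D)) (warrs (apply_op D)) v w"
        have Uw: "unchanged ({Index, Arg} \<union> range Coord) {} v w"
          by (rule unchanged_mono[OF Uw0]) (use frame_apply_op in auto)
        have env_w: "env w" by (rule env_unchanged[OF env Uw]) auto
        have "map (\<lambda>d. vars w (Coord d)) [0..<D] = elem ?x"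
        proof -
          have m: "map (\<lambda>l. arrs v (Queue d) (arrs v Digits l)) [0..<?k] = map (\<lambda>l. es ! ?x l ! d) [0..<?k]"
            if "d < D" for d
            using queue_nth[OF that] by simp
          have "vars w (Coord d) = snd (T ! p) ! horner N (map (\<lambda>l. es ! ?x l ! d) [0..<?k])"
            if "d < D" for d
            using w that unfolding m[OF that, symmetric] by blast
          then show ?thesis unfolding elem_def result_def by (auto simp: comp_def)
        qed
        moreover have "elem ?x \<in> S"
          unfolding elem_def using x_less es_S nth_mem by (intro closed[OF p]) fastforce+
        moreover have "reach S es ?P w" by (rule reach_unchanged[OF reach Uw]) auto
        ultimately have "wp (insert_code D eqs) (\<lambda>w'. reach S es (insert (elem ?x) ?P) w' \<and>
          clk w' \<le> clk w + (2 * D + 2 * length eqs + 8)) w"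
          using env_w S by (intro wp_insert_reach) (auto simp: env_def)
        then show "wp (insert_code D eqs) (\<lambda>w. J (Suc ?r) w \<and>
          clk w \<le> clk v + (D * (4 + 3 * ?k) + (2 * D + 2 * length eqs + 8))) w"
        proof (rule wp_mono)
          fix w' assume w': "reach S es (insert (elem ?x) ?P) w' \<and> clk w' \<le> clk w + (2 * D + 2 * length eqs + 8)"
          have "P \<union> {elem x |x. x \<in> B \<and> rank lo q ?k x < Suc ?r} \<subseteq> insert (elem ?x) ?P"
          proof -
            have "elem y = elem ?x" if "y \<in> B" "rank lo q ?k y = ?r" for y
            proof -
              have "y l = ?x l" if "l < ?k" for l
                using rank_inj[of y lo q ?k ?x l] that xB \<open>y \<in> B\<close> \<open>rank lo q ?k y = ?r\<close>
                unfolding B_def by blast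
              then have "map (\<lambda>l. es ! y l) [0..<?k] = map (\<lambda>l. es ! ?x l) [0..<?k]" by simp
              then show ?thesis unfolding elem_def by (simp only:)
            qed
            then show ?thesis by (auto simp: less_Suc_eq)
          qed
          then show "J (Suc ?r) w' \<and> clk w' \<le> clk v + (D * (4 + 3 * ?k) + (2 * D + 2 * length eqs + 8))"
            using w w' reach_subset unfolding J_def by auto
        qed
      qed
      then show "wp ?c (\<lambda>w. J (Suc (rank (arrs u Low) q ?k (arrs v Digits))) w \<and>
          clk w \<le> clk v + (D * (4 + 3 * ?k) + (2 * D + 2 * length eqs + 8))) v"
        by (simp add: lo_def)
    qed (use frame_apply_op[of D] frame_insert_code[of D eqs] in auto)
    then have "wp (enumerate_box Busy Carry Place Digits Low (Var Head) (Var Arity) ?c) ?Q u"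
    proof (rule wp_mono)
      fix v assume v: "J (weight (arrs u Low) q ?k) v \<and> clk v \<le> clk u + 2 + weight (arrs u Low) q ?k *
        ((D * (4 + 3 * ?k) + (2 * D + 2 * length eqs + 8)) + 4 * ?k + 9)"
      let ?w = "Suc q ^ (?k - 1)"
      have w: "weight (arrs u Low) q ?k = ?w"
        using weight_pivot[OF j(2)] lo unfolding lo_def by blast
      have "produced es q p j \<subseteq> {elem x |x. x \<in> B \<and> rank lo q ?k x < ?w}"
        unfolding produced_def elem_def using B rank_less_weight[of _ lo q ?k] w
        by (auto simp: B_def lo_def)
      then have "P \<union> produced es q p j \<subseteq> P \<union> {elem x |x. x \<in> B \<and> rank lo q ?k x < ?w}" by blast
      moreover have "reach S es (P \<union> {elem x |x. x \<in> B \<and> rank lo q ?k x < ?w}) v"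
        using v unfolding J_def w by blast
      ultimately have "reach S es (P \<union> produced es q p j) v" using reach_subset by blast
      moreover have "clk v \<le> clk s + step_time * ?k * ?w"
      proof -
        let ?X = "9 * D + 2 * length eqs + 21"
        have "(D * (4 + 3 * ?k) + (2 * D + 2 * length eqs + 8)) + 4 * ?k + 9 \<le> ?X * ?k"
        proof -
          have "6 * D + 2 * length eqs + 17 \<le> (6 * D + 2 * length eqs + 17) * ?k" using k1 by simp
          then show ?thesis by (simp add: algebra_simps)
        qed
        then have "?w * ((D * (4 + 3 * ?k) + (2 * D + 2 * length eqs + 8)) + 4 * ?k + 9) \<le> ?w * (?X * ?k)"
          by (intro mult_le_mono2)
        moreover have "clk u \<le> clk s + 4 + 4 * ?k" using t by (simp add: u_def)
        moreover have "6 + 4 * ?k \<le> 10 * ?k * ?w"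
        proof -
          have "6 + 4 * ?k \<le> 10 * ?k" using k1 by simp
          also have "\<dots> \<le> 10 * ?k * ?w" by simp
          finally show ?thesis .
        qed
        ultimately have "clk v \<le> clk s + 10 * ?k * ?w + ?w * (?X * ?k)"
          using conjunct2[OF v, unfolded w] by linarith
        then show ?thesis by (simp add: step_time_def algebra_simps)
      qed
      ultimately show "?Q v" by blast
    qed
    moreover have "vars t Pivot = j" "vars t Head = q" using U j q by (simp_all add: unchanged_def)
    ultimately show "wp (Put Digits (Var Pivot) (Var Head) ;; Put Low (Var Pivot) (Var Head) ;;
      enumerate_box Busy Carry Place Digits Low (Var Head) (Var Arity) ?c) ?Q t"
      by (simp add: u_def)
  qed
  then show ?thesis unfolding pivot_code_def by simp
qed

lemma wp_op_code:
  assumes s: "env s" "reach S es P s" and p: "vars s Op = p" "p < length T"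
    and q: "vars s Head = q" "q < length es" "length es \<le> N ^ D"
  shows "wp (op_code D eqs) (\<lambda>t. reach S es (P \<union> (\<Union>j<fst (T ! p). produced es q p j)) t \<and>
    clk t \<le> clk s + op_time) s"
proof -
  let ?k = "fst (T ! p)"
  let ?s = "tick (tick (s\<lparr>vars := (vars s)(Arity := ?k, Base := arrs s Bases p)\<rparr>))"
  let ?V = "{Arity, Base, Pivot, Arg, Busy, Carry, Place} \<union> body_vars"
  let ?W = "{Digits, Low, Seen} \<union> range Queue"
  have k: "1 \<le> ?k" "?k \<le> \<kappa>" using arity p(2) nth_mem by blast+
  let ?\<tau> = "step_time * ?k * Suc q ^ (?k - 1)"
  have "wp (for_loop Pivot (Var Arity) (pivot_code D eqs))
    (\<lambda>t. reach S es (P \<union> (\<Union>j<?k. produced es q p j)) t \<and> clk t \<le> clk ?s + 2 + ?k * (?\<tau> + 2)) ?s"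
  proof (rule wp_for_loop[where I = "\<lambda>i. reach S es (P \<union> (\<Union>j<i. produced es q p j))"])
    show "reach S es (P \<union> (\<Union>j<0. produced es q p j)) ?s"
      using reach_unchanged[OF s(2), of "{Arity, Base}" "{}" ?s] by (simp add: unchanged_def)
    show "reach S es (P \<union> (\<Union>j<i. produced es q p j)) t'"
      if "reach S es (P \<union> (\<Union>j<i. produced es q p j)) t" "unchanged {Pivot} {} t t'" for i t t'
      by (rule reach_unchanged[OF that]) auto
  next
    fix t assume "unchanged (insert Pivot (wvars (pivot_code D eqs))) (warrs (pivot_code D eqs)) ?s t"
    then have "unchanged ({Pivot, Arg, Busy, Carry, Place} \<union> body_vars) ?W ?s t"
      by (rule unchanged_mono) (use frame_pivot_code in auto)
    from unchanged_var[OF this, of Arity] show "val (Var Arity) t = ?k" by (simp add: body_vars_def image_iff)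
  next
    fix j t assume j: "j < ?k" and R: "reach S es (P \<union> (\<Union>j<j. produced es q p j)) t" and Pivot: "vars t Pivot = j"
      and U0: "unchanged (insert Pivot (wvars (pivot_code D eqs))) (warrs (pivot_code D eqs)) ?s t"
    have U: "unchanged ({Pivot, Arg, Busy, Carry, Place} \<union> body_vars) ?W ?s t"
      by (rule unchanged_mono[OF U0]) (use frame_pivot_code in auto)
    have Ut: "unchanged ?V ?W s t"
      by (rule unchanged_trans[of _ _ _ ?s])
        (simp add: unchanged_def, rule unchanged_mono[OF U], auto)
    have "env t" by (rule env_unchanged[OF s(1) Ut]) (auto simp: body_vars_def)
    then have "wp (pivot_code D eqs) (\<lambda>t'. reach S es ((P \<union> (\<Union>j<j. produced es q p j)) \<union> produced es q p j) t' \<and>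
      clk t' \<le> clk t + ?\<tau>) t"
      using R p(2) j Pivot q(1,2) unchanged_var[OF U, of Arity] unchanged_var[OF U, of Base]
        unchanged_arr[OF U, of Bases] unchanged_var[OF U, of Head]
      by (intro wp_pivot_code) (auto simp: body_vars_def image_iff)
    then show "wp (pivot_code D eqs) (\<lambda>t'. reach S es (P \<union> (\<Union>j<Suc j. produced es q p j)) t' \<and>
      vars t' Pivot = j \<and> clk t' \<le> clk t + ?\<tau>) t"
    proof (rule wp_conseq)
      fix t' assume t': "reach S es ((P \<union> (\<Union>j<j. produced es q p j)) \<union> produced es q p j) t' \<and>
          clk t' \<le> clk t + ?\<tau>"
        and U': "unchanged (wvars (pivot_code D eqs)) (warrs (pivot_code D eqs)) t t'"
      have "Pivot \<notin> wvars (pivot_code D eqs)" using frame_pivot_code(1)[of D eqs] by (auto simp: body_vars_def)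
      then have "vars t' Pivot = j" using unchanged_var[OF U'] Pivot by simp
      then show "reach S es (P \<union> (\<Union>j<Suc j. produced es q p j)) t' \<and> vars t' Pivot = j \<and> clk t' \<le> clk t + ?\<tau>"
        using t' by (simp add: lessThan_Suc Un_ac)
    qed
  qed
  moreover have "2 + (2 + ?k * (?\<tau> + 2)) \<le> op_time"
  proof -
    let ?W = "(N ^ D) ^ (\<kappa> - 1)"
    have "Suc q ^ (?k - 1) \<le> (N ^ D) ^ (?k - 1)" using q by (intro power_mono) auto
    also have "\<dots> \<le> ?W" using k N by (intro power_increasing) auto
    finally have "?k * (step_time * ?k * Suc q ^ (?k - 1)) \<le> \<kappa> * (step_time * \<kappa> * ?W)"
      using k by (intro mult_le_mono) auto
    moreover have "4 + 2 * ?k \<le> 6 * (\<kappa> * \<kappa> * ?W)"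
    proof -
      have "1 \<le> \<kappa> * \<kappa> * ?W" "?k \<le> \<kappa> * \<kappa> * ?W"
        using k N mult_le_mono[of 1 \<kappa> ?k \<kappa>] mult_le_mono[of ?k "\<kappa> * \<kappa>" 1 ?W] by simp_all
      then show ?thesis by linarith
    qed
    moreover have "2 + (2 + ?k * (?\<tau> + 2)) = ?k * (step_time * ?k * Suc q ^ (?k - 1)) + (4 + 2 * ?k)"
      by (simp add: algebra_simps)
    moreover have "op_time = \<kappa> * (step_time * \<kappa> * ?W) + 6 * (\<kappa> * \<kappa> * ?W)"
      by (simp add: op_time_def algebra_simps)
    ultimately show ?thesis by linarith
  qed
  ultimately have "wp (for_loop Pivot (Var Arity) (pivot_code D eqs))
    (\<lambda>t. reach S es (P \<union> (\<Union>j<?k. produced es q p j)) t \<and> clk t \<le> clk s + op_time) ?s"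
    by (elim wp_mono) simp
  moreover have "arrs s Arities p = ?k" using s(1) p by (simp add: env_def)
  ultimately show ?thesis unfolding op_code_def using p(1) by simp
qed

lemma produced_append: "q < length es \<Longrightarrow> produced (es @ fs) q p j = produced es q p j"
proof -
  assume q: "q < length es"
  have "map (\<lambda>l. (es @ fs) ! x l) [0..<k] = map (\<lambda>l. es ! x l) [0..<k]" if "\<forall>l<k. x l \<le> q" for x k
    using that q by (auto simp: nth_append intro: le_less_trans)
  then show ?thesis unfolding produced_def by (intro Collect_cong) (metis (mono_tags, lifting))
qed

lemma length_queue_le: "distinct es \<Longrightarrow> set es \<subseteq> vectors N D \<Longrightarrow> length es \<le> N ^ D"
proof -
  assume "distinct es" and es: "set es \<subseteq> vectors N D"
  then have "length es = card (set es)" by (simp add: distinct_card)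
  also have "\<dots> \<le> card (set (tuples N D))" using es by (intro card_mono[OF finite_set]) (auto simp: set_tuples vectors_def)
  also have "\<dots> \<le> N ^ D" using card_length[of "tuples N D"] by simp
  finally show ?thesis .
qed

text \<open>
  If the head has passed the end of the queue, the queue is closed under the operations: the
  arguments were all treated when the one that is last in the queue was the head, with its place as
  pivot. Here \<open>S\<close> is any set that is least among the closed sets containing \<open>P\<close>.
\<close>

lemma wp_close_code:
  assumes s: "env s" "reach S [] P s"
    and S_min: "\<And>Q. P \<subseteq> Q \<Longrightarrow> Q \<subseteq> S \<Longrightarrow> (\<And>p es. p < length T \<Longrightarrow> length es = fst (T ! p) \<Longrightarrow> set es \<subseteq> Q \<Longrightarrow>
      result p es \<in> Q) \<Longrightarrow> Q = S"
  shows "wp (close_code D eqs) (\<lambda>t. (vars t Hit > 0 \<longleftrightarrow> (\<exists>e\<in>S. solved eqs e)) \<and> stamps_ok t \<and>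
    clk t \<le> clk s + close_time) s"
proof -
  let ?s = "tick (s\<lparr>vars := (vars s)(Head := 0)\<rparr>)"
  let ?head = "for_loop Op (Var Ops) (op_code D eqs)"
  let ?V = "{Head, Op, Arity, Base, Pivot, Arg, Busy, Carry, Place} \<union> body_vars"
  let ?W = "{Digits, Low, Seen} \<union> range Queue"
  let ?\<tau> = "4 + length T * (op_time + 2)"
  define I where "I t \<longleftrightarrow> (\<exists>es. queue N D eqs es t \<and> P \<subseteq> set es \<and> set es \<subseteq> S \<and> vars t Head \<le> length es \<and>
    (\<forall>q<vars t Head. \<forall>p<length T. \<forall>j<fst (T ! p). produced es q p j \<subseteq> set es) \<and>
    clk t \<le> clk s + 1 + vars t Head * ?\<tau>)" for t
  have frame: "wvars (?head ;; inc Head) \<subseteq> ?V" "warrs (?head ;; inc Head) \<subseteq> ?W"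
    using frame_op_code[of D eqs] by auto
  have Us: "unchanged ?V ?W s t" if "unchanged (wvars (?head ;; inc Head)) (warrs (?head ;; inc Head)) ?s t" for t
    by (rule unchanged_trans[of _ _ _ ?s]) (simp add: unchanged_def, rule unchanged_mono[OF that frame])
  have "wp (Loop (less_exp (Var Head) (Var Count)) (?head ;; inc Head))
    (\<lambda>t. (vars t Hit > 0 \<longleftrightarrow> (\<exists>e\<in>S. solved eqs e)) \<and> stamps_ok t \<and> clk t \<le> clk s + close_time) ?s"
  proof (rule wp_loop[where I = I and V = "\<lambda>t. N ^ D - vars t Head"])
    have "reach S [] P ?s" by (rule reach_unchanged[OF s(2), of "{Head}" "{}"]) (auto simp: unchanged_def)
    then show "I ?s" by (auto simp: I_def reach_def)
  next
    fix t assume It: "I t" and U: "unchanged (wvars (?head ;; inc Head)) (warrs (?head ;; inc Head)) ?s t"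
      and pos: "0 < val (less_exp (Var Head) (Var Count)) t"
    obtain es where es: "queue N D eqs es t" "P \<subseteq> set es" "set es \<subseteq> S" "vars t Head \<le> length es"
      "\<And>q p j. q < vars t Head \<Longrightarrow> p < length T \<Longrightarrow> j < fst (T ! p) \<Longrightarrow> produced es q p j \<subseteq> set es"
      "clk t \<le> clk s + 1 + vars t Head * ?\<tau>"
      using It unfolding I_def by blast
    let ?q = "vars t Head"
    have q: "?q < length es" using pos es(1) by (simp add: queue_def)
    have len: "length es \<le> N ^ D" using es(1) length_queue_le by (simp add: queue_def)
    have Ut: "unchanged ?V ?W s (tick t)" using Us[OF U] by (simp add: unchanged_def)
    have env: "env (tick t)" by (rule env_unchanged[OF s(1) Ut]) (auto simp: body_vars_def)
    define R where "R i = (\<Union>p<i. \<Union>j<fst (T ! p). produced es ?q p j)" for i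
    have "wp ?head (\<lambda>t'. reach S es (P \<union> R (length T)) t' \<and>
        clk t' \<le> clk (tick t) + 2 + length T * (op_time + 2)) (tick t)"
    proof (rule wp_for_loop[where I = "\<lambda>i. reach S es (P \<union> R i)"])
      have "queue N D eqs es (tick t)"
        by (rule queue_unchanged[OF es(1), of "{}" "{}"]) (auto simp: unchanged_def)
      then show "reach S es (P \<union> R 0) (tick t)"
        unfolding reach_def R_def using es(2,3) by (intro exI[of _ "[]"]) simp
      show "reach S es (P \<union> R i) t'" if "reach S es (P \<union> R i) u" "unchanged {Op} {} u t'" for i u t'
        by (rule reach_unchanged[OF that]) auto
    next
      fix u assume U0: "unchanged (insert Op (wvars (op_code D eqs))) (warrs (op_code D eqs)) (tick t) u"
      have U1: "unchanged ?V ?W (tick t) u" by (rule unchanged_mono[OF U0]) (use frame_op_code in auto)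
      have "env u" by (rule env_unchanged[OF env U1]) (auto simp: body_vars_def)
      then show "val (Var Ops) u = length T" by (simp add: env_def)
    next
      fix p u assume p: "p < length T" and Ru: "reach S es (P \<union> R p) u" and Op: "vars u Op = p"
        and U0: "unchanged (insert Op (wvars (op_code D eqs))) (warrs (op_code D eqs)) (tick t) u"
      have U1: "unchanged (?V - {Head}) ?W (tick t) u"
        by (rule unchanged_mono[OF U0]) (use frame_op_code in \<open>auto simp: body_vars_def\<close>)
      have "env u" using env U1 by (rule env_unchanged) (auto simp: body_vars_def)
      moreover have "vars u Head = ?q" using unchanged_var[OF U1, of Head] by simp
      ultimately have "wp (op_code D eqs) (\<lambda>t'. reach S es ((P \<union> R p) \<union> (\<Union>j<fst (T ! p). produced es ?q p j)) t' \<and>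
          clk t' \<le> clk u + op_time) u"
        using Ru Op p q len by (intro wp_op_code) auto
      then show "wp (op_code D eqs) (\<lambda>t'. reach S es (P \<union> R (Suc p)) t' \<and> vars t' Op = p \<and>
          clk t' \<le> clk u + op_time) u"
      proof (rule wp_conseq)
        fix t' assume t': "reach S es ((P \<union> R p) \<union> (\<Union>j<fst (T ! p). produced es ?q p j)) t' \<and> clk t' \<le> clk u + op_time"
          and U': "unchanged (wvars (op_code D eqs)) (warrs (op_code D eqs)) u t'"
        have "Op \<notin> wvars (op_code D eqs)" using frame_op_code(1)[of D eqs] by (auto simp: body_vars_def)
        then have "vars t' Op = p" using unchanged_var[OF U'] Op by simp
        then show "reach S es (P \<union> R (Suc p)) t' \<and> vars t' Op = p \<and> clk t' \<le> clk u + op_time"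
          using t' by (simp add: R_def lessThan_Suc Un_ac)
      qed
    qed
    then have "wp ?head (wp (inc Head) (\<lambda>t'. I t' \<and> N ^ D - vars t' Head < N ^ D - vars t Head)) (tick t)"
    proof (rule wp_conseq)
      fix u assume u: "reach S es (P \<union> R (length T)) u \<and> clk u \<le> clk (tick t) + 2 + length T * (op_time + 2)"
        and U': "unchanged (wvars ?head) (warrs ?head) (tick t) u"
      have "Head \<notin> wvars ?head" using frame_op_code(1)[of D eqs] by (auto simp: body_vars_def)
      then have Head: "vars u Head = ?q" using unchanged_var[OF U'] by simp
      obtain fs where fs: "queue N D eqs (es @ fs) u" "set (es @ fs) \<subseteq> S" "R (length T) \<subseteq> set (es @ fs)"
        using u unfolding reach_def by blast
      let ?u = "tick (u\<lparr>vars := (vars u)(Head := Suc ?q)\<rparr>)"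
      have "queue N D eqs (es @ fs) ?u"
        by (rule queue_unchanged[OF fs(1), of "{Head}" "{}"]) (auto simp: unchanged_def)
      moreover have "produced (es @ fs) q' p j \<subseteq> set (es @ fs)"
        if "q' < Suc ?q" "p < length T" "j < fst (T ! p)" for q' p j
      proof (cases "q' = ?q")
        case True
        then show ?thesis using fs(3) that(2,3) q unfolding R_def by (auto simp: produced_append)
      next
        case False
        then show ?thesis using es(5)[of q' p j] that q by (auto simp: produced_append)
      qed
      ultimately have "I ?u"
        unfolding I_def using es(2,6) fs(2) q u by (intro exI[of _ "es @ fs"]) auto
      then show "wp (inc Head) (\<lambda>t'. I t' \<and> N ^ D - vars t' Head < N ^ D - vars t Head) u"
        using Head q len by simp
    qed
    then show "wp (?head ;; inc Head) (\<lambda>t'. I t' \<and> N ^ D - vars t' Head < N ^ D - vars t Head) (tick t)"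
      unfolding wp_Seq .
  next
    fix t assume It: "I t" and zero: "val (less_exp (Var Head) (Var Count)) t = 0"
    obtain es where es: "queue N D eqs es t" "P \<subseteq> set es" "set es \<subseteq> S" "vars t Head \<le> length es"
      "\<And>q p j. q < vars t Head \<Longrightarrow> p < length T \<Longrightarrow> j < fst (T ! p) \<Longrightarrow> produced es q p j \<subseteq> set es"
      "clk t \<le> clk s + 1 + vars t Head * ?\<tau>"
      using It unfolding I_def by blast
    have Head: "vars t Head = length es" using zero es(1,4) by (simp add: queue_def)
    have set_es: "set es = S"
    proof (rule S_min[OF es(2,3)])
      fix p fs assume p: "p < length T" and fs: "length fs = fst (T ! p)" "set fs \<subseteq> set es"
      let ?k = "fst (T ! p)"
      have k: "?k \<ge> 1" using arity p nth_mem by blast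
      have "\<exists>i<length es. es ! i = fs ! l" if "l < ?k" for l
        using fs that nth_mem[of l fs] by (metis in_set_conv_nth subsetD)
      then obtain x where x: "x l < length es" "es ! x l = fs ! l" if "l < ?k" for l by metis
      \<comment> \<open>The pivot is a place of the argument that comes last in the queue.\<close>
      have "Max (x ` {..<?k}) \<in> x ` {..<?k}" using k by (intro Max_in) (auto simp: lessThan_empty_iff)
      then obtain j where j: "j < ?k" "x j = Max (x ` {..<?k})" by auto
      have "x l \<le> x j" if "l < ?k" for l unfolding j(2) using that by (intro Max_ge) auto
      then have "result p (map (\<lambda>l. es ! x l) [0..<?k]) \<in> produced es (x j) p j"
        unfolding produced_def by blast
      moreover have "map (\<lambda>l. es ! x l) [0..<?k] = fs" using x(2) fs(1) by (intro nth_equalityI) auto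
      ultimately show "result p fs \<in> set es" using es(5)[OF _ p j(1), of "x j"] x(1)[OF j(1)] Head by auto
    qed
    have "length es \<le> N ^ D" using es(1) length_queue_le by (simp add: queue_def)
    then have "length es * ?\<tau> \<le> N ^ D * ?\<tau>" by (rule mult_le_mono1)
    moreover have "clk (tick t) = Suc (clk t)" by simp
    ultimately have "clk (tick t) \<le> clk s + close_time" using es(6)[unfolded Head] unfolding close_time_def by linarith
    then show "(vars (tick t) Hit > 0 \<longleftrightarrow> (\<exists>e\<in>S. solved eqs e)) \<and> stamps_ok (tick t) \<and>
        clk (tick t) \<le> clk s + close_time"
      using es(1) set_es by (simp add: queue_def stamps_ok_def)
  qed
  then show ?thesis by (simp add: close_code_def)
qed

end

subsection \<open>Running through all tuples\<close>

definition start_code :: "nat \<Rightarrow> nat list list \<Rightarrow> (nat \<times> nat) list \<Rightarrow> prog" where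
  "start_code D gens eqs = inc Stamp ;; Count ::= Num 0 ;; Hit ::= Num 0 ;;
     block (map (\<lambda>g. block (map (\<lambda>d. Coord d ::= Elt Tuple (Num (g ! d))) [0..<D]) ;;
       insert_code D eqs) gens)"

definition tuple_code :: "nat \<Rightarrow> nat list list \<Rightarrow> (nat \<times> nat) list \<Rightarrow> prog" where
  "tuple_code D gens eqs = start_code D gens eqs ;; close_code D eqs ;;
     Cond (Var Hit) Skip (Every ::= Num 0)"

definition outer_code :: "nat \<Rightarrow> nat \<Rightarrow> nat list list \<Rightarrow> (nat \<times> nat) list \<Rightarrow> prog" where
  "outer_code n D gens eqs = Every ::= Num 1 ;;
     enumerate_box Busy_outer Carry_outer Place_outer Tuple Zeros (Minus (Var Univ) (Num 1)) (Num n)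
       (tuple_code D gens eqs)"

lemma frame_start_code:
  "wvars (start_code D gens eqs) \<subseteq> insert Stamp body_vars"
  "warrs (start_code D gens eqs) \<subseteq> {Seen} \<union> range Queue"
  using frame_insert_code[of D eqs] by (auto simp: start_code_def body_vars_def)

lemma frame_tuple_code:
  "wvars (tuple_code D gens eqs) \<subseteq>
     {Stamp, Every, Head, Op, Arity, Base, Pivot, Arg, Busy, Carry, Place} \<union> body_vars"
  "warrs (tuple_code D gens eqs) \<subseteq> {Digits, Low, Seen} \<union> range Queue"
  using frame_start_code[of D gens eqs] frame_close_code[of D eqs] by (auto simp: tuple_code_def body_vars_def)

context search
begin

definition start_time :: "nat list list \<Rightarrow> nat" where
  "start_time gens = 3 + length gens * (3 * D + 2 * length eqs + 8)"

text \<open>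
  Incrementing \<open>Stamp\<close> empties the queue, because all stamps in \<open>Seen\<close> are then outdated.
\<close>

lemma wp_start_code:
  assumes s: "env s" "stamps_ok s"
    and E: "E = (\<lambda>g. map (arrs s Tuple) g) ` set gens" "E \<subseteq> S" "S \<subseteq> vectors N D"
    and gens: "\<And>g. g \<in> set gens \<Longrightarrow> length g = D"
  shows "wp (start_code D gens eqs) (\<lambda>t. reach S [] E t \<and> clk t \<le> clk s + start_time gens) s"
proof -
  let ?s = "tick (tick (tick (s\<lparr>vars := (vars s)(Stamp := Suc (vars s Stamp), Count := 0, Hit := 0)\<rparr>)))"
  let ?load = "\<lambda>g. map (\<lambda>d. Coord d ::= Elt Tuple (Num (g ! d))) [0..<D] :: prog list"
  let ?cs = "map (\<lambda>g. block (?load g) ;; insert_code D eqs) gens"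
  let ?V = "insert Stamp body_vars" let ?W = "{Seen} \<union> range Queue"
  define I where "I i = reach S [] ((\<lambda>g. map (arrs s Tuple) g) ` set (take i gens))" for i
  have "wp (block ?cs) (\<lambda>t. I (length ?cs) t \<and> clk t \<le> clk ?s + length ?cs * (3 * D + 2 * length eqs + 8)) ?s"
  proof (rule wp_block)
    have "arrs s Seen v \<noteq> Suc (vars s Stamp)" for v
      using s(2)[unfolded stamps_ok_def, rule_format, of v] by linarith
    then have "queue N D eqs [] ?s" using s(2) by (auto simp: queue_def stamps_ok_def le_Suc_eq)
    then show "I 0 ?s" unfolding I_def reach_def by (intro exI[of _ "[]"]) simp
  next
    fix i t assume i: "i < length ?cs" and It: "I i t"
      and U0: "unchanged (\<Union> (wvars ` set ?cs)) (\<Union> (warrs ` set ?cs)) ?s t"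
    have U: "unchanged ?V ?W ?s t"
      by (rule unchanged_mono[OF U0]) (use frame_insert_code[of D eqs] in \<open>auto simp: body_vars_def\<close>)
    have Us: "unchanged ?V ?W s t"
      by (rule unchanged_trans[OF _ U]) (simp add: unchanged_def body_vars_def)
    have Tuple: "arrs t Tuple = arrs s Tuple" using unchanged_arr[OF Us, of Tuple] by auto
    have env: "env t" by (rule env_unchanged[OF s(1) Us]) (auto simp: body_vars_def)
    let ?g = "gens ! i"
    let ?P = "(\<lambda>g. map (arrs s Tuple) g) ` set (take i gens)"
    let ?e = "map (arrs s Tuple) ?g"
    have g: "?g \<in> set gens" using i by simp
    have "wp (block (?load ?g)) (\<lambda>v. (\<forall>d<length (?load ?g). vars v (Coord d) = arrs s Tuple (?g ! d)) \<and>
        clk v \<le> clk t + length (?load ?g) * 1) t"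
    proof (rule wp_block[where I = "\<lambda>d v. \<forall>d'<d. vars v (Coord d') = arrs s Tuple (?g ! d')"])
      fix d v assume d: "d < length (?load ?g)" and Iv: "\<forall>d'<d. vars v (Coord d') = arrs s Tuple (?g ! d')"
        and "unchanged (\<Union> (wvars ` set (?load ?g))) (\<Union> (warrs ` set (?load ?g))) t v"
      then have "unchanged (range Coord) {} t v" by (intro unchanged_mono[of _ _ t v "range Coord" "{}"]) auto
      then have "arrs v Tuple = arrs s Tuple" using Tuple by (simp add: unchanged_def)
      then show "wp (?load ?g ! d) (\<lambda>v'. (\<forall>d'<Suc d. vars v' (Coord d') = arrs s Tuple (?g ! d')) \<and>
          clk v' \<le> clk v + 1) v"
        using d Iv by (auto simp: less_Suc_eq)
    qed simp
    then have "wp (block (?load ?g)) (wp (insert_code D eqs) (\<lambda>v. I (Suc i) v \<and>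
        clk v \<le> clk t + (3 * D + 2 * length eqs + 8))) t"
    proof (rule wp_conseq)
      fix v assume v: "(\<forall>d<length (?load ?g). vars v (Coord d) = arrs s Tuple (?g ! d)) \<and>
          clk v \<le> clk t + length (?load ?g) * 1"
        and Uv0: "unchanged (wvars (block (?load ?g))) (warrs (block (?load ?g))) t v"
      have Uv: "unchanged (range Coord) {} t v" by (rule unchanged_mono[OF Uv0]) auto
      have env_v: "env v" by (rule env_unchanged[OF env Uv]) auto
      have "reach S [] ?P v" by (rule reach_unchanged[OF It[unfolded I_def] Uv]) auto
      moreover have "map (\<lambda>d. vars v (Coord d)) [0..<D] = ?e"
        using v gens[OF g] by (intro nth_equalityI) auto
      moreover have "?e \<in> S" using E(1,2) g by blast
      ultimately have "wp (insert_code D eqs) (\<lambda>v'. reach S [] (insert ?e ?P) v' \<and>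
          clk v' \<le> clk v + (2 * D + 2 * length eqs + 8)) v"
        using env_v E(3) by (intro wp_insert_reach) (auto simp: env_def)
      then show "wp (insert_code D eqs) (\<lambda>v. I (Suc i) v \<and> clk v \<le> clk t + (3 * D + 2 * length eqs + 8)) v"
      proof (rule wp_mono)
        fix v' assume "reach S [] (insert ?e ?P) v' \<and> clk v' \<le> clk v + (2 * D + 2 * length eqs + 8)"
        moreover have "insert ?e ?P = (\<lambda>g. map (arrs s Tuple) g) ` set (take (Suc i) gens)"
          using i by (simp add: take_Suc_conv_app_nth)
        ultimately show "I (Suc i) v' \<and> clk v' \<le> clk t + (3 * D + 2 * length eqs + 8)"
          using v unfolding I_def by simp
      qed
    qed
    then show "wp (?cs ! i) (\<lambda>v. I (Suc i) v \<and> clk v \<le> clk t + (3 * D + 2 * length eqs + 8)) t"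
      using i by simp
  qed
  then have "wp (block ?cs) (\<lambda>t. reach S [] E t \<and> clk t \<le> clk s + start_time gens) ?s"
    by (rule wp_mono) (simp add: I_def E(1) start_time_def)
  then show ?thesis unfolding start_code_def by simp
qed

lemma subpower_is_search:
  assumes "E \<subseteq> vectors N D"
  shows "search_subpower N D \<kappa> T eqs (subpower (map (table_op N) T) D E)"
proof (unfold_locales)
  let ?F = "map (table_op N) T"
  have E: "\<And>e. e \<in> E \<Longrightarrow> length e = D \<and> set e \<subseteq> {..<N}" using assms by (auto simp: vectors_def)
  have F: "\<exists>f'. (k, f') \<in> set ?F \<and> (\<forall>xs. length xs = k \<and> set xs \<subseteq> {..<N} \<longrightarrow> f xs = f' xs \<and> f xs \<in> {..<N})"
    if kf: "(k, f) \<in> set ?F" for k f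
  proof (intro exI[of _ f] conjI kf allI impI refl)
    fix xs assume xs: "length xs = k \<and> set xs \<subseteq> {..<N}"
    obtain tab where tab: "(k, tab) \<in> set T" "f = (\<lambda>xs. tab ! horner N xs)"
      using kf by (auto simp: table_op_def)
    then have "length tab = N ^ k" "set tab \<subseteq> {..<N}" using valid by (auto simp: valid_table_def)
    moreover from this have "horner N xs < length tab" using horner_less[of xs N] xs by simp
    ultimately show "f xs \<in> {..<N}" using tab(2) nth_mem by blast
  qed
  show "subpower ?F D E \<subseteq> vectors N D"
  proof
    fix e assume "e \<in> subpower ?F D E"
    from subpower_cong_subset[OF E F this] show "e \<in> vectors N D" by (simp add: vectors_def)
  qed
  fix p es assume p: "p < length T" "length es = fst (T ! p)" "set es \<subseteq> subpower ?F D E"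
  have "(fst (T ! p), \<lambda>xs. snd (T ! p) ! horner N xs) \<in> set ?F"
    using p(1) nth_mem[of p T] by (force simp: table_op_def split_def)
  from subpower.app[OF this p(2)] p(3) show "result p es \<in> subpower ?F D E" by (auto simp: result_def)
qed

definition tuple_time :: "nat list list \<Rightarrow> nat" where
  "tuple_time gens = start_time gens + close_time + 2"

lemma wp_tuple_code:
  assumes s: "env s" "stamps_ok s" and x: "\<And>i. i < n \<Longrightarrow> arrs s Tuple i < N"
    and scheme: "wellformed_scheme n D gens eqs"
  shows "wp (tuple_code D gens eqs) (\<lambda>t. stamps_ok t \<and>
    (vars t Every > 0 \<longleftrightarrow> vars s Every > 0 \<and>
       (\<exists>e\<in>subpower (map (table_op N) T) D ((\<lambda>g. map (arrs s Tuple) g) ` set gens). solved eqs e)) \<and>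
    clk t \<le> clk s + tuple_time gens) s" (is "wp _ ?Q s")
proof -
  let ?E = "(\<lambda>g. map (arrs s Tuple) g) ` set gens"
  let ?F = "map (table_op N) T"
  let ?S = "subpower ?F D ?E"
  have E: "?E \<subseteq> vectors N D" using scheme x by (force simp: wellformed_scheme_def vectors_def)
  interpret search_subpower N D \<kappa> T eqs ?S by (rule subpower_is_search[OF E])
  have E_S: "?E \<subseteq> ?S" by (auto intro: subpower.gen)
  have "wp (start_code D gens eqs) (\<lambda>t. reach ?S [] ?E t \<and> clk t \<le> clk s + start_time gens) s"
    using s E_S S scheme by (intro wp_start_code) (auto simp: wellformed_scheme_def)
  then have "wp (start_code D gens eqs) (wp (close_code D eqs) (wp (Cond (Var Hit) Skip (Every ::= Num 0)) ?Q)) s"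
  proof (rule wp_conseq)
    fix t assume t: "reach ?S [] ?E t \<and> clk t \<le> clk s + start_time gens"
      and U0: "unchanged (wvars (start_code D gens eqs)) (warrs (start_code D gens eqs)) s t"
    have U: "unchanged (insert Stamp body_vars) ({Seen} \<union> range Queue) s t"
      by (rule unchanged_mono[OF U0]) (use frame_start_code in auto)
    have env: "env t" by (rule env_unchanged[OF s(1) U]) (auto simp: body_vars_def)
    have Every: "vars t Every = vars s Every" using unchanged_var[OF U, of Every] by (auto simp: body_vars_def)
    have "wp (close_code D eqs) (\<lambda>v. (vars v Hit > 0 \<longleftrightarrow> (\<exists>e\<in>?S. solved eqs e)) \<and> stamps_ok v \<and>
        clk v \<le> clk t + close_time) t"
    proof (rule wp_close_code[OF env conjunct1[OF t]])
      fix Q assume Q: "?E \<subseteq> Q" "Q \<subseteq> ?S"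
        "\<And>p es. p < length T \<Longrightarrow> length es = fst (T ! p) \<Longrightarrow> set es \<subseteq> Q \<Longrightarrow> result p es \<in> Q"
      show "Q = ?S"
      proof (rule subpower_closed_set[OF Q(1,2)])
        fix k f es assume "(k, f) \<in> set ?F" and es: "length es = k" "set es \<subseteq> Q"
        then obtain p where p: "p < length T" "T ! p = (k, snd (T ! p))" "f = (\<lambda>xs. snd (T ! p) ! horner N xs)"
          by (auto simp: table_op_def in_set_conv_nth split: prod.splits)
        have "length es = fst (T ! p)" using es(1) p(2) by (metis fst_conv)
        from Q(3)[OF p(1) this es(2)] show "map (\<lambda>d. f (map (\<lambda>e. e ! d) es)) [0..<D] \<in> Q"
          unfolding p(3) by (simp add: result_def)
      qed
    qed
    then show "wp (close_code D eqs) (wp (Cond (Var Hit) Skip (Every ::= Num 0)) ?Q) t"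
    proof (rule wp_conseq)
      fix v assume v: "(vars v Hit > 0 \<longleftrightarrow> (\<exists>e\<in>?S. solved eqs e)) \<and> stamps_ok v \<and> clk v \<le> clk t + close_time"
        and U': "unchanged (wvars (close_code D eqs)) (warrs (close_code D eqs)) t v"
      have "Every \<notin> wvars (close_code D eqs)" using frame_close_code(1)[of D eqs] by (auto simp: body_vars_def)
      then have "vars v Every = vars s Every" using unchanged_var[OF U'] Every by simp
      then show "wp (Cond (Var Hit) Skip (Every ::= Num 0)) ?Q v"
        using v t by (auto simp: stamps_ok_def tuple_time_def)
    qed
  qed
  then show ?thesis unfolding tuple_code_def by simp
qed

text \<open>
  The tuples that have been tried are those of smaller rank, and only the entries below \<open>n\<close> of a
  tuple matter.
\<close>

lemma wp_outer_code:
  assumes s: "env s" "stamps_ok s" and zero: "arrs s Tuple = (\<lambda>_. 0)" "arrs s Zeros = (\<lambda>_. 0)"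
    and scheme: "wellformed_scheme n D gens eqs"
  shows "wp (outer_code n D gens eqs) (\<lambda>t.
    (vars t Every > 0 \<longleftrightarrow> digit_criterion N (map (table_op N) T) n D gens eqs) \<and>
    clk t \<le> clk s + 3 + N ^ n * (tuple_time gens + 4 * n + 9)) s"
proof -
  let ?c = "tuple_code D gens eqs"
  let ?F = "map (table_op N) T"
  let ?s = "tick (s\<lparr>vars := (vars s)(Every := 1)\<rparr>)"
  let ?lo = "\<lambda>_. 0 :: nat"
  let ?r = "rank ?lo (N - 1) n" and ?B = "box ?lo (N - 1) n"
  define good where "good x \<longleftrightarrow> (\<exists>e\<in>subpower ?F D ((\<lambda>g. map x g) ` set gens). solved eqs e)" for x
  define J where "J r t \<longleftrightarrow> stamps_ok t \<and> (vars t Every > 0 \<longleftrightarrow> (\<forall>x\<in>?B. ?r x < r \<longrightarrow> good x))"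
    for r and t :: pstate
  let ?V = "{Busy_outer, Carry_outer, Place_outer} \<union> wvars ?c" let ?W = "insert Tuple (warrs ?c)"
  let ?V' = "- {Ops, Univ, Filled}" let ?W' = "- {Arities, Bases, Word, Times, Zeros}"
  have frame: "?V \<subseteq> ?V'" "?W \<subseteq> ?W'" using frame_tuple_code[of D gens eqs] by (auto simp: body_vars_def)
  have good_cong: "good x = good y" if "\<And>i. i < n \<Longrightarrow> x i = y i" for x y
  proof -
    have "map x g = map y g" if "g \<in> set gens" for g
      using scheme that \<open>\<And>i. i < n \<Longrightarrow> x i = y i\<close> by (auto simp: wellformed_scheme_def subset_iff)
    then have "(\<lambda>g. map x g) ` set gens = (\<lambda>g. map y g) ` set gens" by (intro image_cong) auto
    then show ?thesis unfolding good_def by simp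
  qed
  have lo: "arrs ?s Zeros = ?lo" using zero by simp
  have weight: "weight ?lo (N - 1) n = N ^ n" using N by (simp add: weight_def)
  have "wp (enumerate_box Busy_outer Carry_outer Place_outer Tuple Zeros (Minus (Var Univ) (Num 1)) (Num n) ?c)
    (\<lambda>t. J (weight (arrs ?s Zeros) (N - 1) n) t \<and>
      clk t \<le> clk ?s + 2 + weight (arrs ?s Zeros) (N - 1) n * (tuple_time gens + 4 * n + 9)) ?s"
  proof (rule wp_enumerate_box)
    show "J 0 ?s" using s(2) by (simp add: J_def stamps_ok_def)
    show "arrs ?s Tuple j = arrs ?s Zeros j" for j using zero by simp
    show "arrs ?s Zeros j \<le> N - 1" for j using zero by simp
    show "J r t'" if "J r t" "unchanged {Busy_outer, Carry_outer, Place_outer} {Tuple} t t'" for r t t'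
      using that by (simp add: J_def stamps_ok_def unchanged_def)
    show "val (Minus (Var Univ) (Num 1)) t = N - 1" if "unchanged ?V ?W ?s t" for t
      using unchanged_var[OF unchanged_mono[OF that frame], of Univ] s(1) by (simp add: env_def times_ok_def)
  next
    fix t assume x: "arrs t Tuple \<in> box (arrs ?s Zeros) (N - 1) n"
      and Jt: "J (rank (arrs ?s Zeros) (N - 1) n (arrs t Tuple)) t" and U: "unchanged ?V ?W ?s t"
    let ?x = "arrs t Tuple"
    have xB: "?x \<in> ?B" using x zero by simp
    have U': "unchanged ?V' ?W' s t"
      by (rule unchanged_trans[OF _ unchanged_mono[OF U frame]]) (simp add: unchanged_def)
    have env: "env t" by (rule env_unchanged[OF s(1) U']) auto
    have "?x i < N" if "i < n" for i
    proof -
      have "?x i \<le> N - 1" using xB that by (simp add: box_def)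
      then show ?thesis using N by linarith
    qed
    then have "wp ?c (\<lambda>t'. stamps_ok t' \<and> (vars t' Every > 0 \<longleftrightarrow> vars t Every > 0 \<and> good ?x) \<and>
        clk t' \<le> clk t + tuple_time gens) t"
      using Jt env scheme unfolding good_def by (intro wp_tuple_code) (auto simp: J_def)
    then show "wp ?c (\<lambda>t'. J (Suc (rank (arrs ?s Zeros) (N - 1) n (arrs t Tuple))) t' \<and>
        clk t' \<le> clk t + tuple_time gens) t"
    proof (rule wp_mono)
      fix t' assume t': "stamps_ok t' \<and> (vars t' Every > 0 \<longleftrightarrow> vars t Every > 0 \<and> good ?x) \<and>
        clk t' \<le> clk t + tuple_time gens"
      have "good y = good ?x" if "y \<in> ?B" "?r y = ?r ?x" for y
        using rank_inj[OF that(1) xB that(2)] by (rule good_cong)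
      then have "(\<forall>y\<in>?B. ?r y < Suc (?r ?x) \<longrightarrow> good y) \<longleftrightarrow> (\<forall>y\<in>?B. ?r y < ?r ?x \<longrightarrow> good y) \<and> good ?x"
        unfolding less_Suc_eq using xB by blast
      then show "J (Suc (rank (arrs ?s Zeros) (N - 1) n (arrs t Tuple))) t' \<and> clk t' \<le> clk t + tuple_time gens"
        using t' Jt zero by (simp add: J_def)
    qed
  qed (use frame frame_tuple_code[of D gens eqs] in \<open>auto simp: body_vars_def\<close>)
  moreover have "(\<forall>x\<in>?B. ?r x < N ^ n \<longrightarrow> good x) \<longleftrightarrow> digit_criterion N ?F n D gens eqs"
  proof
    assume all: "\<forall>x\<in>?B. ?r x < N ^ n \<longrightarrow> good x"
    show "digit_criterion N ?F n D gens eqs"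
      unfolding digit_criterion_def
    proof (intro allI impI)
      fix a assume a: "length a = n \<and> set a \<subseteq> {..<N}"
      have "a ! i \<le> N - 1" if "i < n" for i
      proof -
        have "a ! i \<in> {..<N}" using a nth_mem[of i a] that by (metis subsetD)
        then show ?thesis by simp
      qed
      then have "(!) a \<in> ?B" by (simp add: box_def)
      then have "good ((!) a)" using all rank_less_weight[of "(!) a" ?lo "N - 1" n] weight by simp
      then show "\<exists>e\<in>subpower ?F D ((\<lambda>g. map ((!) a) g) ` set gens). \<forall>(i, j)\<in>set eqs. e ! i = e ! j"
        by (simp add: good_def solved_def)
    qed
  next
    assume crit: "digit_criterion N ?F n D gens eqs"
    show "\<forall>x\<in>?B. ?r x < N ^ n \<longrightarrow> good x"
    proof (intro ballI impI)
      fix x assume x: "x \<in> ?B"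
      let ?a = "map x [0..<n]"
      have "x i < N" if "i < n" for i
      proof -
        have "x i \<le> N - 1" using x that by (simp add: box_def)
        then show ?thesis using N by linarith
      qed
      then have "length ?a = n \<and> set ?a \<subseteq> {..<N}" by auto
      then have "good ((!) ?a)"
        using crit unfolding digit_criterion_def good_def solved_def by blast
      then show "good x" using good_cong[of x "(!) ?a"] by simp
    qed
  qed
  ultimately have "wp (enumerate_box Busy_outer Carry_outer Place_outer Tuple Zeros (Minus (Var Univ) (Num 1)) (Num n) ?c)
    (\<lambda>t. (vars t Every > 0 \<longleftrightarrow> digit_criterion N ?F n D gens eqs) \<and>
      clk t \<le> clk s + 3 + N ^ n * (tuple_time gens + 4 * n + 9)) ?s"
    unfolding lo weight by (elim wp_mono) (simp add: J_def)
  then show ?thesis unfolding outer_code_def by simp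
qed

end

section \<open>Reading and validating the input\<close>

definition holds :: "nat list \<Rightarrow> pstate \<Rightarrow> bool" where
  "holds w s \<longleftrightarrow> vars s Length = length w \<and> (\<forall>i<length w. arrs s Word i = w ! i)"

lemma holds_unchanged: "holds w s \<Longrightarrow> unchanged V W s t \<Longrightarrow> Length \<notin> V \<Longrightarrow> Word \<notin> W \<Longrightarrow> holds w t"
  by (simp add: holds_def unchanged_def)

definition store_item :: prog where
  "store_item = Put Word (Var Length) (Var Item) ;; inc Length"

definition load_code :: prog where
  "load_code = Reading ::= Num 1 ;; Loop (Var Reading) (Input Item store_item (Reading ::= Num 0))"

lemma frame_load_code: "wvars load_code = {Reading, Item, Length}" "warrs load_code = {Word}"
  by (auto simp: load_code_def store_item_def)

lemma holds_store:
  "holds w s \<Longrightarrow> wp store_item (\<lambda>t. holds (w @ [vars s Item]) t \<and> inp t = inp s \<and> clk t = clk s + 2) s"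
  by (auto simp: holds_def store_item_def nth_append less_Suc_eq)

lemma wp_load_code:
  assumes "holds u s"
  shows "wp load_code (\<lambda>t. holds (u @ inp s) t \<and> clk t \<le> clk s + 5 + 4 * length (inp s)) s"
proof -
  let ?s = "tick (s\<lparr>vars := (vars s)(Reading := 1)\<rparr>)"
  define I where "I t \<longleftrightarrow> vars t Reading \<le> 1 \<and> (\<exists>v. holds (u @ v) t \<and> v @ inp t = inp s \<and>
    (vars t Reading = 0 \<longrightarrow> inp t = []) \<and> clk t \<le> clk s + 4 + 4 * length v - 3 * vars t Reading)" for t :: pstate
  have "wp (Loop (Var Reading) (Input Item store_item (Reading ::= Num 0)))
    (\<lambda>t. holds (u @ inp s) t \<and> clk t \<le> clk s + 5 + 4 * length (inp s)) ?s"
  proof (rule wp_loop[where I = I and V = "\<lambda>t. length (inp t) + vars t Reading"])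
    show "I ?s" unfolding I_def using assms by (auto intro!: exI[of _ "[]"] simp: holds_def)
  next
    fix t assume It: "I t" and "0 < val (Var Reading) t"
    then have R: "vars t Reading = 1" by (simp add: I_def)
    obtain v where v: "holds (u @ v) t" "v @ inp t = inp s" "clk t \<le> clk s + 1 + 4 * length v"
      using It R unfolding I_def by auto
    show "wp (Input Item store_item (Reading ::= Num 0))
      (\<lambda>t'. I t' \<and> length (inp t') + vars t' Reading < length (inp t) + vars t Reading) (tick t)"
    proof (cases "inp t")
      case Nil
      then show ?thesis using v R by (auto simp: I_def holds_def intro!: exI[of _ v])
    next
      case (Cons a w)
      let ?t = "tick ((tick t)\<lparr>vars := (vars t)(Item := a), inp := w\<rparr>)"
      have "holds (u @ v) ?t" using v(1) by (simp add: holds_def)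
      then have "wp store_item (\<lambda>t'. holds ((u @ v) @ [a]) t' \<and> inp t' = w \<and> clk t' = clk t + 4) ?t"
        using holds_store[of "u @ v" ?t] by (simp add: eval_nat_numeral)
      then have "wp store_item (\<lambda>t'. I t' \<and>
          length (inp t') + vars t' Reading < length (inp t) + vars t Reading) ?t"
      proof (rule wp_conseq)
        fix t' assume t': "holds ((u @ v) @ [a]) t' \<and> inp t' = w \<and> clk t' = clk t + 4"
          and "unchanged (wvars store_item) (warrs store_item) ?t t'"
        then have "vars t' Reading = 1" using R by (simp add: unchanged_def store_item_def)
        then show "I t' \<and> length (inp t') + vars t' Reading < length (inp t) + vars t Reading"
          using t' v(2,3) Cons R unfolding I_def by (auto intro!: exI[of _ "v @ [a]"])
      qed
      then show ?thesis using Cons by simp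
    qed
  next
    fix t assume It: "I t" and "val (Var Reading) t = 0"
    then obtain v where "holds (u @ v) t" "v = inp s" "clk t \<le> clk s + 4 + 4 * length v"
      unfolding I_def by auto
    then show "holds (u @ inp s) (tick t) \<and> clk (tick t) \<le> clk s + 5 + 4 * length (inp s)"
      by (simp add: holds_def)
  qed
  then show ?thesis by (simp add: load_code_def)
qed

subsection \<open>Validation\<close>

text \<open>
  For \<open>N \<ge> 2\<close> the loop stops as soon as the power exceeds the length of the input, so it takes few
  rounds although the arity may be a huge number. For \<open>N = 1\<close> no bound on the arity follows from
  the length of the table, but all powers are \<open>1\<close>.
\<close>

definition power_code :: prog where
  "power_code = Power ::= Num 1 ;; Cond (less_exp (Num 1) (Var Univ))
     (Arg ::= Num 0 ;;
      Loop (and_exp (less_exp (Var Arg) (Var Arity)) (less_exp (Var Power) (Plus (Var Length) (Num 1))))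
        (Power ::= Elt Times (Var Power) ;; inc Arg))
     Skip"

lemma wp_power_code:
  assumes s: "times_ok N s" "N \<ge> 1" "vars s Arity = k" "vars s Length = L" "L \<ge> 1" "L \<le> vars s Filled"
  shows "wp power_code (\<lambda>t. (if N ^ k \<le> L then vars t Power = N ^ k else vars t Power > L) \<and>
    clk t \<le> clk s + 4 + 3 * L) s"
proof (cases "N = 1")
  case True
  then show ?thesis using s by (auto simp: power_code_def times_ok_def)
next
  case False
  then have N: "N \<ge> 2" using s by simp
  let ?s = "tick (tick (tick (s\<lparr>vars := (vars s)(Power := 1, Arg := 0)\<rparr>)))"
  let ?b = "Power ::= Elt Times (Var Power) ;; inc Arg"
  let ?e = "and_exp (less_exp (Var Arg) (Var Arity)) (less_exp (Var Power) (Plus (Var Length) (Num 1)))"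
  define I where "I t \<longleftrightarrow> vars t Power = N ^ vars t Arg \<and> vars t Arg \<le> k \<and> vars t Arg \<le> L \<and>
    clk t \<le> clk s + 3 + 3 * vars t Arg" for t :: pstate
  have "wp (Loop ?e ?b) (\<lambda>t. (if N ^ k \<le> L then vars t Power = N ^ k else vars t Power > L) \<and>
    clk t \<le> clk s + 4 + 3 * L) ?s"
  proof (rule wp_loop[where I = I and V = "\<lambda>t. k - vars t Arg"])
    show "I ?s" by (simp add: I_def)
  next
    fix t assume It: "I t" and U: "unchanged (wvars ?b) (warrs ?b) ?s t" and pos: "0 < val ?e t"
    have vals: "vars t Arity = k" "vars t Length = L" "vars t Filled = vars s Filled"
      "vars t Univ = N" "arrs t Times = arrs s Times"
      using U s by (simp_all add: unchanged_def times_ok_def)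
    then have "arrs t Times (vars t Power) = vars t Power * N"
      using s(1,6) pos by (simp add: times_ok_def)
    moreover have "vars t Arg < L"
    proof -
      have "vars t Arg < 2 ^ vars t Arg" by simp
      also have "\<dots> \<le> N ^ vars t Arg" using N by (rule power_mono) simp
      finally show ?thesis using It pos vals by (simp add: I_def)
    qed
    ultimately show "wp ?b (\<lambda>t'. I t' \<and> k - vars t' Arg < k - vars t Arg) (tick t)"
      using It pos vals by (simp add: I_def) linarith
  next
    fix t assume It: "I t" and U: "unchanged (wvars ?b) (warrs ?b) ?s t" and zero: "val ?e t = 0"
    have vals: "vars t Arity = k" "vars t Length = L" using U s by (simp_all add: unchanged_def)
    have "L < vars t Power \<Longrightarrow> L < N ^ k"
      using It N power_increasing[of "vars t Arg" k N] unfolding I_def by linarith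
    then show "(if N ^ k \<le> L then vars (tick t) Power = N ^ k else vars (tick t) Power > L) \<and>
        clk (tick t) \<le> clk s + 4 + 3 * L"
      using It zero vals by (cases "vars t Arg = k") (auto simp: I_def)
  qed
  then show ?thesis using N s(1) by (simp add: power_code_def times_ok_def)
qed

definition entries_code :: prog where
  "entries_code = for_loop Arg (Var Power)
     (Cond (less_exp (Elt Word (Var Ptr)) (Var Univ)) Skip (Ok ::= Num 0) ;; inc Ptr)"

lemma wp_entries_code:
  assumes s: "holds w s" "vars s Univ = N" "vars s Ptr = p" "p + vars s Power \<le> length w" "vars s Ok > 0"
  shows "wp entries_code (\<lambda>t. vars t Ptr = p + vars s Power \<and>
    (vars t Ok > 0 \<longleftrightarrow> set (take (vars s Power) (drop p w)) \<subseteq> {..<N}) \<and>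
    clk t \<le> clk s + 2 + 5 * vars s Power) s"
proof -
  let ?P = "vars s Power"
  let ?c = "Cond (less_exp (Elt Word (Var Ptr)) (Var Univ)) Skip (Ok ::= Num 0) ;; inc Ptr"
  define I where "I i t \<longleftrightarrow> vars t Ptr = p + i \<and> (vars t Ok > 0 \<longleftrightarrow> (\<forall>l<i. w ! (p + l) < N))"
    for i and t :: pstate
  have "wp (for_loop Arg (Var Power) ?c) (\<lambda>t. I ?P t \<and> clk t \<le> clk s + 2 + ?P * (3 + 2)) s"
  proof (rule wp_for_loop)
    show "I 0 s" using s by (simp add: I_def)
  next
    fix i t assume i: "i < ?P" and It: "I i t" and Arg: "vars t Arg = i"
      and U: "unchanged (insert Arg (wvars ?c)) (warrs ?c) s t"
    have "vars t Univ = N" "arrs t Word (p + i) = w ! (p + i)"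
      using U s i by (simp_all add: unchanged_def holds_def)
    then show "wp ?c (\<lambda>t'. I (Suc i) t' \<and> vars t' Arg = i \<and> clk t' \<le> clk t + 3) t"
      using It Arg by (auto simp: I_def less_Suc_eq)
  qed (auto simp: I_def unchanged_def)
  moreover have "(\<forall>l<?P. w ! (p + l) < N) \<longleftrightarrow> set (take ?P (drop p w)) \<subseteq> {..<N}"
    using s(4) by (auto simp: set_conv_nth subset_iff)
  ultimately show ?thesis unfolding entries_code_def by (elim wp_mono) (simp add: I_def)
qed

definition table_code :: prog where
  "table_code = Cond (less_exp (Var Ptr) (Var Length))
     (Arity ::= Elt Word (Var Ptr) ;; inc Ptr ;;
      Put Arities (Var Op) (Var Arity) ;; Put Bases (Var Op) (Var Ptr) ;;
      Cond (Var Arity) Skip (Nullary ::= Num 1) ;;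
      power_code ;;
      Cond (less_exp (Minus (Var Length) (Var Ptr)) (Var Power)) (Ok ::= Num 0) entries_code ;;
      inc Op)
     (Ok ::= Num 0)"

lemma frame_table_code:
  "wvars table_code = {Arity, Ptr, Nullary, Power, Arg, Ok, Op}" "warrs table_code = {Arities, Bases}"
  by (auto simp: table_code_def power_code_def entries_code_def)

definition tables_read :: "nat list \<Rightarrow> (nat \<times> nat list) list \<Rightarrow> pstate \<Rightarrow> bool" where
  "tables_read w T s \<longleftrightarrow> (\<forall>p<length T. arrs s Arities p = fst (T ! p) \<and>
     (\<forall>i<length (snd (T ! p)). w ! (arrs s Bases p + i) = snd (T ! p) ! i)) \<and>
     (\<forall>p<length T. arrs s Bases p + length (snd (T ! p)) \<le> length w) \<and>
     (vars s Nullary > 0 \<longleftrightarrow> (\<exists>t\<in>set T. fst t = 0))"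

text \<open>
  One step of \<open>parse\<close>: either it fails, or one more table has been read and the pointer has moved.
\<close>

lemma wp_table_code:
  assumes s: "holds w s" "times_ok N s" "N \<ge> 1" "length w \<le> vars s Filled" "vars s Ok > 0"
    and T: "vars s Op = length T" "tables_read w T s" and p: "vars s Ptr \<le> length w"
  shows "wp table_code (\<lambda>t.
    (vars t Ok = 0 \<longrightarrow> parse N (Suc r) (drop (vars s Ptr) w) = None) \<and>
    (vars t Ok > 0 \<longrightarrow> (\<exists>e. vars t Op = Suc (length T) \<and> tables_read w (T @ [e]) t \<and>
       vars s Ptr < vars t Ptr \<and> vars t Ptr \<le> length w \<and>
       parse N (Suc r) (drop (vars s Ptr) w) = map_option ((#) e) (parse N r (drop (vars t Ptr) w)))) \<and>
    clk t \<le> clk s + 16 + 8 * length w) s" (is "wp table_code ?Q s")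
proof (cases "vars s Ptr < length w")
  case False
  then show ?thesis using s(1) by (auto simp: table_code_def holds_def)
next
  case True
  let ?p = "vars s Ptr" and ?L = "length w"
  let ?k = "w ! ?p"
  let ?u = "drop (Suc ?p) w"
  have drop: "drop ?p w = ?k # ?u" using True by (simp add: Cons_nth_drop_Suc)
  let ?arrs = "(arrs s)(Arities := (arrs s Arities)(length T := ?k), Bases := (arrs s Bases)(length T := Suc ?p))"
  let ?t = "Suc (Suc (Suc (Suc (Suc (Suc (clk s))))))"
  define s1 where "s1 = (if ?k > 0
     then s\<lparr>vars := (vars s)(Arity := ?k, Ptr := Suc ?p), arrs := ?arrs, clk := ?t\<rparr>
     else s\<lparr>arrs := ?arrs, vars := (vars s)(Arity := ?k, Ptr := Suc ?p, Nullary := 1), clk := Suc ?t\<rparr>)"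
  have s1: "vars s1 Arity = ?k" "vars s1 Ptr = Suc ?p" "vars s1 Length = ?L" "vars s1 Filled = vars s Filled"
    "vars s1 Ok = vars s Ok" "vars s1 Op = length T" "vars s1 Univ = N" "arrs s1 Word = arrs s Word"
    "arrs s1 Times = arrs s Times" "clk s1 \<le> clk s + 7"
    using s(1,2) T(1) by (auto simp: s1_def holds_def times_ok_def)
  have ok1: "times_ok N s1" using s(2) s1 by (simp add: times_ok_def)
  have start: "wp table_code ?Q s \<longleftrightarrow> wp power_code (wp (Cond (less_exp (Minus (Var Length) (Var Ptr)) (Var Power))
      (Ok ::= Num 0) entries_code ;; inc Op) ?Q) s1"
  proof (cases "?k > 0")
    case 1: True
    have "vars s Ptr < vars s Length" "arrs s Word (vars s Ptr) = ?k"
      using s(1) True by (simp_all add: holds_def)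
    with 1 show ?thesis using T(1) by (simp add: table_code_def s1_def)
  next
    case 2: False
    have "vars s Ptr < vars s Length" "arrs s Word (vars s Ptr) = ?k"
      using s(1) True by (simp_all add: holds_def)
    with 2 show ?thesis using T(1) by (simp add: table_code_def s1_def)
  qed
  have "wp power_code (\<lambda>t. (if N ^ ?k \<le> ?L then vars t Power = N ^ ?k else vars t Power > ?L) \<and>
    clk t \<le> clk s1 + 4 + 3 * ?L) s1"
    using ok1 s s1 True by (intro wp_power_code) auto
  then have "wp power_code (wp (Cond (less_exp (Minus (Var Length) (Var Ptr)) (Var Power))
      (Ok ::= Num 0) entries_code ;; inc Op) ?Q) s1"
  proof (rule wp_conseq)
    fix t assume t: "(if N ^ ?k \<le> ?L then vars t Power = N ^ ?k else vars t Power > ?L) \<and>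
        clk t \<le> clk s1 + 4 + 3 * ?L"
      and "unchanged (wvars power_code) (warrs power_code) s1 t"
    then have U: "unchanged {Power, Arg} {} s1 t" by (auto simp: unchanged_def power_code_def)
    have vals: "vars t Ptr = Suc ?p" "vars t Length = ?L" "vars t Ok > 0" "vars t Op = length T"
      "vars t Univ = N" "arrs t Word = arrs s Word"
      using U s1 s(5) by (simp_all add: unchanged_def)
    have fits: "vars t Power \<le> ?L - Suc ?p \<longleftrightarrow> N ^ ?k \<le> length ?u"
      using t by (auto split: if_splits)
    show "wp (Cond (less_exp (Minus (Var Length) (Var Ptr)) (Var Power))
      (Ok ::= Num 0) entries_code ;; inc Op) ?Q t"
    proof (cases "vars t Power \<le> ?L - Suc ?p")
      case False
      then have "parse N (Suc r) (drop ?p w) = None" using fits by (simp add: drop)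
      then show ?thesis using False vals t s1(10) by simp
    next
      case le: True
      then have P: "vars t Power = N ^ ?k" "N ^ ?k \<le> length ?u" using fits t by (auto split: if_splits)
      have "wp entries_code (\<lambda>v. vars v Ptr = Suc ?p + vars (tick t) Power \<and>
        (vars v Ok > 0 \<longleftrightarrow> set (take (vars (tick t) Power) (drop (Suc ?p) w)) \<subseteq> {..<N}) \<and>
        clk v \<le> clk (tick t) + 2 + 5 * vars (tick t) Power) (tick t)"
        using vals s(1) P True by (intro wp_entries_code) (auto simp: holds_def)
      then have "wp entries_code (wp (inc Op) ?Q) (tick t)"
      proof (rule wp_conseq)
        fix v assume v: "vars v Ptr = Suc ?p + vars (tick t) Power \<and>
          (vars v Ok > 0 \<longleftrightarrow> set (take (vars (tick t) Power) (drop (Suc ?p) w)) \<subseteq> {..<N}) \<and>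
          clk v \<le> clk (tick t) + 2 + 5 * vars (tick t) Power"
          and "unchanged (wvars entries_code) (warrs entries_code) (tick t) v"
        then have Uv: "unchanged {Arg, Ptr, Ok, Power} {} s1 v"
          using U by (auto simp: unchanged_def entries_code_def)
        let ?e = "(?k, take (N ^ ?k) ?u)"
        have "tables_read w (T @ [?e]) v"
        proof -
          have arrs: "arrs v Arities = (arrs s Arities)(length T := ?k)"
            "arrs v Bases = (arrs s Bases)(length T := Suc ?p)"
            "vars v Nullary = (if ?k > 0 then vars s Nullary else 1)"
            using Uv by (simp_all add: unchanged_def s1_def)
          show ?thesis
            unfolding tables_read_def using T(2) P(2) True
            by (auto simp: arrs nth_append less_Suc_eq tables_read_def)
        qed
        then have read: "tables_read w (T @ [?e]) (tick (v\<lparr>vars := (vars v)(Op := Suc (vars v Op))\<rparr>))"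
          by (simp add: tables_read_def)
        have clk: "clk v \<le> clk s + 15 + 8 * ?L"
        proof -
          have "5 * N ^ ?k \<le> 5 * ?L" using P(2) by simp
          then show ?thesis using v t s1(10) P(1) by simp
        qed
        have Op: "vars v Op = length T" using Uv s1 by (simp add: unchanged_def)
        have Ptr: "vars v Ptr = Suc ?p + N ^ ?k" using v P(1) by simp
        have ok: "vars v Ok > 0 \<longleftrightarrow> set (take (N ^ ?k) ?u) \<subseteq> {..<N}" using v P(1) by simp
        have d: "drop (N ^ ?k) ?u = drop (vars v Ptr) w" using Ptr by (simp add: add.commute)
        have "vars v Ptr \<le> ?L" "?p < vars v Ptr" using Ptr P(2) True by auto
        moreover have "parse N (Suc r) (drop ?p w) = (if vars v Ok > 0
            then map_option ((#) ?e) (parse N r (drop (vars v Ptr) w)) else None)"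
          unfolding drop parse.simps d using P(2) ok by simp
        ultimately show "wp (inc Op) ?Q v" using read clk Op by auto
      qed
      then show ?thesis using le vals by simp
    qed
  qed
  then show ?thesis using start by blast
qed

definition validate_code :: prog where
  "validate_code = Ok ::= Num 1 ;; Nullary ::= Num 0 ;; Cond (less_exp (Var Length) (Num 2)) (Ok ::= Num 0)
    (Univ ::= Elt Word (Num 0) ;; Ops ::= Elt Word (Num 1) ;;
     Cond (Var Univ) Skip (Ok ::= Num 0) ;;
     Ptr ::= Num 2 ;; Op ::= Num 0 ;;
     extend_times (Var Length) ;;
     Loop (and_exp (Var Ok) (less_exp (Var Op) (Var Ops))) table_code ;;
     Cond (less_exp (Var Ptr) (Var Length)) (Ok ::= Num 0) Skip)"

definition valid_input :: "nat list \<Rightarrow> nat \<Rightarrow> (nat \<times> nat list) list \<Rightarrow> bool" where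
  "valid_input w N T \<longleftrightarrow> N \<ge> 1 \<and> (\<forall>t\<in>set T. valid_table N t) \<and>
     w = N # length T # concat (map (\<lambda>(k, tab). k # tab) T)"

lemma valid_input_parse:
  "valid_input w N T \<longleftrightarrow> 2 \<le> length w \<and> N = w ! 0 \<and> 1 \<le> N \<and> parse N (w ! 1) (drop 2 w) = Some T"
proof (cases "2 \<le> length w")
  case True
  then obtain a b u where "w = a # b # u" by (cases w; cases "tl w") auto
  then show ?thesis by (auto simp: valid_input_def parse_iff)
qed (auto simp: valid_input_def)

lemma frame_validate_code:
  "wvars validate_code = {Ok, Nullary, Univ, Ops, Ptr, Op, Filled, Arity, Power, Arg}"
  "warrs validate_code = {Times, Arities, Bases}"
  using frame_table_code by (auto simp: validate_code_def)

lemma wp_validate_code: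
  assumes s: "holds w s" "vars s Filled = 0" "arrs s Times = (\<lambda>_. 0)"
  shows "wp validate_code (\<lambda>t. (vars t Ok > 0 \<longrightarrow> (\<exists>N T. valid_input w N T \<and> times_ok N t \<and>
      vars t Ops = length T \<and> tables_read w T t \<and> length w \<le> vars t Filled)) \<and>
    (vars t Ok = 0 \<longrightarrow> \<not> (\<exists>N T. valid_input w N T)) \<and>
    clk t \<le> clk s + 40 * (length w + 1) ^ 2) s" (is "wp validate_code ?Q s")
proof (cases "length w < 2")
  case True
  then have "\<not> valid_input w N T" for N T by (auto simp: valid_input_parse)
  then show ?thesis using True s(1) by (simp add: validate_code_def holds_def)
next
  case False
  let ?L = "length w" and ?N = "w ! 0" and ?r = "w ! 1"
  let ?\<tau> = "17 + 8 * ?L"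
  let ?loop = "Loop (and_exp (Var Ok) (less_exp (Var Op) (Var Ops))) table_code"
  let ?end = "Cond (less_exp (Var Ptr) (Var Length)) (Ok ::= Num 0) Skip"
  define s1 where "s1 = s\<lparr>vars := (vars s)(Ok := if ?N > 0 then 1 else 0, Nullary := 0, Univ := ?N,
    Ops := ?r, Ptr := 2, Op := 0), clk := (if ?N > 0 then id else Suc) (Suc (Suc (Suc (Suc (Suc (Suc (Suc (Suc (clk s)))))))))\<rparr>"
  have start: "wp validate_code ?Q s \<longleftrightarrow> wp (extend_times (Var Length)) (wp ?loop (wp ?end ?Q)) s1"
  proof -
    have "0 < ?L" "1 < ?L" using False by linarith+
    then have "vars s Length = ?L" "arrs s Word 0 = ?N" "arrs s Word 1 = ?r"
      using s(1) unfolding holds_def by blast+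
    moreover have "(vars s)(Ok := 1, Nullary := 0, Univ := ?N, Ops := ?r, Ok := 0, Ptr := 2, Op := 0)
      = (vars s)(Ok := 0, Nullary := 0, Univ := ?N, Ops := ?r, Ptr := 2, Op := 0)"
      by (auto simp: fun_eq_iff)
    ultimately show ?thesis using False by (cases "?N > 0") (simp_all add: validate_code_def s1_def)
  qed
  have "wp (extend_times (Var Length)) (\<lambda>t. times_ok ?N t \<and> vars t Filled = max (vars s1 Filled) ?L \<and>
    clk t \<le> clk s1 + 1 + 3 * ?L) s1"
    using s False by (intro wp_extend_times) (auto simp: times_ok_def s1_def holds_def unchanged_def)
  then have "wp (extend_times (Var Length)) (wp ?loop (wp ?end ?Q)) s1"
  proof (rule wp_conseq)
    fix t assume t: "times_ok ?N t \<and> vars t Filled = max (vars s1 Filled) ?L \<and> clk t \<le> clk s1 + 1 + 3 * ?L"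
      and Ut: "unchanged (wvars (extend_times (Var Length))) (warrs (extend_times (Var Length))) s1 t"
    have vals: "vars t Ok = (if ?N > 0 then 1 else 0)" "vars t Nullary = 0" "vars t Ops = ?r" "vars t Ptr = 2"
      "vars t Op = 0" using Ut by (simp_all add: unchanged_def s1_def)
    have holds_t: "holds w t" using s(1) Ut by (simp add: holds_def unchanged_def s1_def)
    have filled: "vars t Filled = ?L" using t s(2) by (simp add: s1_def)
    \<comment> \<open>A round costs \<open>O(L)\<close> and moves the pointer or ends the loop, so \<open>V\<close> bounds the remaining rounds. The number of tables that the header announces does not, as it may be huge.\<close>
    define V where "V u = (if vars u Ok > 0 then 1 + (?L - vars u Ptr) else 0)" for u :: pstate
    define I where "I u \<longleftrightarrow> clk u + V u * ?\<tau> \<le> clk t + ?L * ?\<tau> \<and>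
      (vars u Ok = 0 \<longrightarrow> ?N = 0 \<or> parse ?N ?r (drop 2 w) = None) \<and>
      (vars u Ok > 0 \<longrightarrow> ?N \<ge> 1 \<and> vars u Ptr \<le> ?L \<and> vars u Op \<le> ?r \<and> (\<exists>T. vars u Op = length T \<and> tables_read w T u \<and>
        parse ?N ?r (drop 2 w) = map_option ((@) T) (parse ?N (?r - vars u Op) (drop (vars u Ptr) w))))"
      for u :: pstate
    show "wp ?loop (wp ?end ?Q) t"
    proof (rule wp_loop[where I = I and V = V])
      have "1 + (?L - 2) \<le> ?L" using False by simp
      then have "V t * ?\<tau> \<le> ?L * ?\<tau>" unfolding V_def vals by (intro mult_le_mono1) auto
      moreover have "map_option ((@) []) z = z" for z :: "(nat \<times> nat list) list option" by (cases z) auto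
      moreover have "tables_read w [] t" using vals by (simp add: tables_read_def)
      ultimately show "I t" using vals False
        by (auto simp: I_def intro!: exI[of _ "[]"])
    next
      fix u assume Iu: "I u" and U: "unchanged (wvars table_code) (warrs table_code) t u"
        and pos: "0 < val (and_exp (Var Ok) (less_exp (Var Op) (Var Ops))) u"
      have uvals: "vars u Ops = ?r" "holds w u" "times_ok ?N u" "vars u Filled = ?L"
        using U vals holds_t t filled unfolding frame_table_code by (simp_all add: unchanged_def holds_def times_ok_def)
      have ok: "vars u Ok > 0" "vars u Op < ?r" using pos uvals by simp_all
      obtain T where T: "?N \<ge> 1" "vars u Ptr \<le> ?L" "vars u Op = length T" "tables_read w T u"
        "parse ?N ?r (drop 2 w) = map_option ((@) T) (parse ?N (?r - vars u Op) (drop (vars u Ptr) w))"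
        "clk u + V u * ?\<tau> \<le> clk t + ?L * ?\<tau>"
        using Iu ok unfolding I_def by auto
      define r' where "r' = ?r - Suc (vars u Op)"
      have r': "?r - vars u Op = Suc r'" using ok by (simp add: r'_def)
      have "wp table_code (\<lambda>v.
        (vars v Ok = 0 \<longrightarrow> parse ?N (Suc r') (drop (vars (tick u) Ptr) w) = None) \<and>
        (vars v Ok > 0 \<longrightarrow> (\<exists>e. vars v Op = Suc (length T) \<and> tables_read w (T @ [e]) v \<and>
           vars (tick u) Ptr < vars v Ptr \<and> vars v Ptr \<le> length w \<and>
           parse ?N (Suc r') (drop (vars (tick u) Ptr) w) = map_option ((#) e) (parse ?N r' (drop (vars v Ptr) w)))) \<and>
        clk v \<le> clk (tick u) + 16 + 8 * ?L) (tick u)"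
        using uvals ok T by (intro wp_table_code) (auto simp: holds_def times_ok_def tables_read_def)
      then show "wp table_code (\<lambda>v. I v \<and> V v < V u) (tick u)"
      proof (rule wp_conseq)
        fix v assume v: "(vars v Ok = 0 \<longrightarrow> parse ?N (Suc r') (drop (vars (tick u) Ptr) w) = None) \<and>
        (vars v Ok > 0 \<longrightarrow> (\<exists>e. vars v Op = Suc (length T) \<and> tables_read w (T @ [e]) v \<and>
           vars (tick u) Ptr < vars v Ptr \<and> vars v Ptr \<le> length w \<and>
           parse ?N (Suc r') (drop (vars (tick u) Ptr) w) = map_option ((#) e) (parse ?N r' (drop (vars v Ptr) w)))) \<and>
        clk v \<le> clk (tick u) + 16 + 8 * ?L"
        have V: "V v < V u"
        proof (cases "vars v Ok > 0")
          case True
          then have "vars u Ptr < vars v Ptr" "vars v Ptr \<le> ?L" using v by auto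
          then have "?L - vars v Ptr < ?L - vars u Ptr" by linarith
          then show ?thesis using True ok by (simp add: V_def)
        qed (use ok in \<open>simp add: V_def\<close>)
        then have "Suc (V v) * ?\<tau> \<le> V u * ?\<tau>" by (intro mult_le_mono1) simp
        then have time: "clk v + V v * ?\<tau> \<le> clk t + ?L * ?\<tau>" using v T(6) by simp
        have "I v"
        proof (cases "vars v Ok > 0")
          case True
          then obtain e where e: "vars v Op = Suc (length T)" "tables_read w (T @ [e]) v" "vars v Ptr \<le> ?L"
            "parse ?N (Suc r') (drop (vars u Ptr) w) = map_option ((#) e) (parse ?N r' (drop (vars v Ptr) w))"
            using v by auto
          have "?r - vars v Op = r'" using e(1) T(3) by (simp add: r'_def)
          then have "parse ?N ?r (drop 2 w) = map_option ((@) (T @ [e])) (parse ?N (?r - vars v Op) (drop (vars v Ptr) w))"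
            unfolding T(5) r' e(4) \<open>?r - vars v Op = r'\<close>
            by (cases "parse ?N r' (drop (vars v Ptr) w)") simp_all
          then show ?thesis unfolding I_def using True time T(1,3) ok e by (auto intro!: exI[of _ "T @ [e]"])
        next
          case False
          then show ?thesis unfolding I_def using v time T(5) r' by simp
        qed
        then show "I v \<and> V v < V u" using V by blast
      qed
    next
      fix u assume Iu: "I u" and U: "unchanged (wvars table_code) (warrs table_code) t u"
        and zero: "val (and_exp (Var Ok) (less_exp (Var Op) (Var Ops))) u = 0"
      have uvals: "vars u Ops = ?r" "vars u Length = ?L" "times_ok ?N u" "vars u Filled = ?L"
        using U vals holds_t t filled unfolding frame_table_code by (simp_all add: unchanged_def holds_def times_ok_def)
      have time: "clk u + 3 \<le> clk s + 40 * (?L + 1) ^ 2"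
      proof -
        have "clk u \<le> clk s1 + 1 + 3 * ?L + ?L * ?\<tau>" using Iu t unfolding I_def by linarith
        moreover have "clk s1 \<le> clk s + 9" by (simp add: s1_def)
        moreover have "13 + 3 * ?L + ?L * ?\<tau> \<le> 40 * (?L + 1) ^ 2" by (simp add: power2_eq_square algebra_simps)
        ultimately show ?thesis by linarith
      qed
      show "wp ?end ?Q (tick u)"
      proof (cases "vars u Ok > 0")
        case False
        then have "\<not> (\<exists>N T. valid_input w N T)" using Iu by (auto simp: I_def valid_input_parse)
        then show ?thesis using False time by simp
      next
        case True
        then obtain T where T: "?N \<ge> 1" "vars u Ptr \<le> ?L" "vars u Op = length T" "tables_read w T u"
          "parse ?N ?r (drop 2 w) = map_option ((@) T) (parse ?N (?r - vars u Op) (drop (vars u Ptr) w))"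
          "vars u Op \<le> ?r"
          using Iu unfolding I_def by auto
        have "vars u Op = ?r" using zero True T(6) uvals by simp
        then have parse: "parse ?N ?r (drop 2 w) = (if vars u Ptr < ?L then None else Some T)" "?r = length T"
          using T(2,3,5) by auto
        show ?thesis
        proof (cases "vars u Ptr < ?L")
          case True
          then have "\<not> (\<exists>N T. valid_input w N T)" using parse by (auto simp: valid_input_parse)
          then show ?thesis using True time uvals by simp
        next
          case 2: False
          then have "valid_input w ?N T" using parse T(1) False by (simp add: valid_input_parse)
          then show ?thesis using 2 True time uvals T(4) parse(2)
            by (auto simp: times_ok_def tables_read_def intro!: exI[of _ ?N] exI[of _ T])
        qed
      qed
    qed
  qed
  then show ?thesis using start by blast
qed

section \<open>The decision program\<close>

definition table_total :: "nat \<Rightarrow> (nat \<times> nat list) list \<Rightarrow> nat" where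
  "table_total N T = (\<Sum>t\<leftarrow>T. N ^ fst t)"

lemma table_total_ge:
  "t \<in> set T \<Longrightarrow> N ^ fst t \<le> table_total N T"
  "(\<And>t. t \<in> set T \<Longrightarrow> b \<le> N ^ fst t) \<Longrightarrow> length T * b \<le> table_total N T"
  unfolding table_total_def by (induction T) (auto simp: add_mono intro: trans_le_add2)

lemma length_valid_input:
  assumes "valid_input w N T"
  shows "length w = 2 + length T + table_total N T" "length w \<le> 2 + 2 * table_total N T"
proof -
  have "length (concat (map (\<lambda>(k, tab). k # tab) T)) = length T + table_total N T"
    if "\<forall>t\<in>set T. valid_table N t"
    using that unfolding table_total_def by (induction T) (auto simp: valid_table_def)
  then show len: "length w = 2 + length T + table_total N T"
    using assms by (simp add: valid_input_def)
  have "length T * 1 \<le> table_total N T"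
    using assms by (intro table_total_ge(2)) (simp add: valid_input_def)
  then show "length w \<le> 2 + 2 * table_total N T" using len by simp
qed

lemma valid_input_unique: "valid_input w N T \<Longrightarrow> valid_input w N' T' \<Longrightarrow> N = N' \<and> T = T'"
  by (auto simp: valid_input_parse)

lemma Decide_valid_input:
  assumes "w \<in> Decide X G" shows "\<exists>N T. valid_input w N T"
proof -
  obtain A where "tabular A" "w = encode A" using assms by (auto simp: Decide_def)
  then show ?thesis using encode_tables[of A] unfolding valid_input_def by blast
qed

lemma Decide_iff:
  assumes sol: "solves n D gens eqs X G" and w: "valid_input w N T"
  shows "w \<in> Decide X G \<longleftrightarrow> satisfies_loop (table_algebra N T) X G"
    "w \<in> Decide X G \<longleftrightarrow> digit_criterion N (map (table_op N) T) n D gens eqs"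
proof -
  have N: "N \<ge> 1" "\<forall>t\<in>set T. valid_table N t" using w by (auto simp: valid_input_def)
  note tab = tabular_table_algebra[OF N]
  have ops: "operations (table_algebra N T) = map (table_op N) T" "card (universe (table_algebra N T)) = N"
    by (simp_all add: table_algebra_def)
  have crit: "satisfies_loop (table_algebra N T) X G \<longleftrightarrow> digit_criterion N (map (table_op N) T) n D gens eqs"
    using sol tab(1) ops unfolding solves_def by simp
  show "w \<in> Decide X G \<longleftrightarrow> satisfies_loop (table_algebra N T) X G"
  proof
    assume "w \<in> Decide X G"
    then obtain A where A: "tabular A" "satisfies_loop A X G" "w = encode A" by (auto simp: Decide_def)
    define N' where "N' = card (universe A)"
    have "valid_input w N' (tables_of A)"
      using encode_tables[OF A(1) N'_def] A(3) by (simp add: valid_input_def)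
    then have eq: "N' = N" "tables_of A = T" using valid_input_unique w by blast+
    have "digit_criterion N' (operations A) n D gens eqs"
      using sol A(1,2) unfolding solves_def N'_def by blast
    then have "digit_criterion N (map (table_op N) T) n D gens eqs"
      using digit_criterion_tables[OF A(1) N'_def] sol unfolding solves_def eq by blast
    then show "satisfies_loop (table_algebra N T) X G" using crit by simp
  next
    assume "satisfies_loop (table_algebra N T) X G"
    moreover have "encode (table_algebra N T) = w" using tab(2) w by (simp add: valid_input_def)
    ultimately show "w \<in> Decide X G" using tab(1) unfolding Decide_def by blast
  qed
  then show "w \<in> Decide X G \<longleftrightarrow> digit_criterion N (map (table_op N) T) n D gens eqs" using crit by simp
qed

subsection \<open>The time bound of the search\<close>

lemma square_le_power2: "\<kappa> \<ge> 1 \<Longrightarrow> \<kappa> * \<kappa> \<le> 3 * 2 ^ (\<kappa> - 1)" for \<kappa> :: nat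
proof (induction \<kappa> rule: nat_induct_at_least)
  case (Suc k)
  show ?case
  proof (cases "k \<le> 2")
    case True
    then have "k = 1 \<or> k = 2" using Suc.hyps by linarith
    then show ?thesis by auto
  next
    case False
    then have "3 * k \<le> k * k" by (intro mult_le_mono1) simp
    then have "Suc k * Suc k \<le> 2 * (k * k)"
      unfolding mult_Suc mult_Suc_right using False by linarith
    also have "\<dots> \<le> 2 * (3 * 2 ^ (k - 1))" using Suc.IH by simp
    also have "\<dots> = 3 * 2 ^ k" using Suc.hyps by (cases k) simp_all
    finally show ?thesis by simp
  qed
qed simp

text \<open>
  With \<open>r\<close> operations of positive arities, the largest of them being \<open>\<kappa>\<close>, both
  \<open>r * N\<close> and \<open>N ^ \<kappa>\<close> are at most the size \<open>s\<close> of
  the tables. The number \<open>N ^ n\<close> of tuples is far below \<open>s ^ n\<close> unless \<open>r\<close> and \<open>\<kappa>\<close> are small, and this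
  pays for the factor \<open>r * \<kappa>\<^sup>2\<close> that the search loses.
\<close>

lemma search_time_core:
  fixes N r s \<kappa> n D :: nat
  assumes "N \<ge> 2" "n \<ge> 2" "\<kappa> \<ge> 1" "r * N \<le> s" "N ^ \<kappa> \<le> s"
  shows "N ^ n * (r * (\<kappa> * \<kappa>) * (N ^ D) ^ \<kappa>) \<le> 3 * s ^ (n + D)"
proof -
  obtain m where m: "n = Suc (Suc m)" using assms(2) by (metis add_2_eq_Suc le_Suc_ex)
  obtain k where k: "\<kappa> = Suc k" using assms(3) by (cases \<kappa>) auto
  have "N ^ n * (r * (\<kappa> * \<kappa>)) \<le> N ^ n * (r * (3 * 2 ^ k))"
    using square_le_power2[OF assms(3)] k by (intro mult_le_mono2) simp
  also have "\<dots> = 3 * (r * N) * (N ^ Suc m * 2 ^ k)" by (simp add: m algebra_simps)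
  also have "\<dots> \<le> 3 * s * (N ^ \<kappa>) ^ Suc m"
  proof (intro mult_le_mono)
    have "2 ^ k \<le> N ^ k" using assms(1) by (rule power_mono) simp
    also have "\<dots> \<le> (N ^ k) ^ Suc m" using assms(1) by (simp add: Suc_leI)
    finally have "N ^ Suc m * 2 ^ k \<le> N ^ Suc m * (N ^ k) ^ Suc m" by (rule mult_le_mono2)
    also have "\<dots> = (N ^ \<kappa>) ^ Suc m" unfolding k by (simp add: power_mult_distrib mult_ac)
    finally show "N ^ Suc m * 2 ^ k \<le> (N ^ \<kappa>) ^ Suc m" .
  qed (use assms(4) in auto)
  also have "\<dots> \<le> 3 * s * s ^ Suc m" using assms(5) by (intro mult_le_mono2 power_mono) auto
  also have "\<dots> = 3 * s ^ n" by (simp add: m)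
  finally have "N ^ n * (r * (\<kappa> * \<kappa>)) \<le> 3 * s ^ n" .
  moreover have "(N ^ D) ^ \<kappa> \<le> s ^ D"
    using assms(5) power_mono[of "N ^ \<kappa>" s D] by (simp add: mult.commute flip: power_mult)
  ultimately have "N ^ n * (r * (\<kappa> * \<kappa>)) * (N ^ D) ^ \<kappa> \<le> 3 * s ^ n * s ^ D" by (rule mult_le_mono)
  then show ?thesis by (simp add: power_add algebra_simps)
qed

definition search_constant :: "nat \<Rightarrow> nat \<Rightarrow> nat list list \<Rightarrow> (nat \<times> nat) list \<Rightarrow> nat" where
  "search_constant n D gens eqs =
     (3 + length gens * (3 * D + 2 * length eqs + 8)) + (9 * D + 2 * length eqs + 45) + 4 * n + 5 * D + 30"

lemma (in search) outer_time:
  assumes "N \<ge> 2" "n \<ge> 2" "\<exists>t\<in>set T. fst t = \<kappa>"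
  shows "10 + D * (2 + 3 * N ^ D) + N ^ n * (tuple_time gens + 4 * n + 9) \<le>
    3 * search_constant n D gens eqs * table_total N T ^ (n + D)"
proof -
  let ?r = "length T" let ?s0 = "step_time" let ?st = "start_time gens"
  define X where "X = ?r * (\<kappa> * \<kappa>) * (N ^ D) ^ \<kappa>"
  have r: "?r \<ge> 1" using T by (cases T) auto
  have k: "\<kappa> * \<kappa> \<ge> 1" "\<kappa> \<ge> 1" using \<kappa> by simp_all
  have ND: "N ^ D \<le> (N ^ D) ^ \<kappa>" using N k by (simp add: self_le_power)
  have ND1: "N ^ D \<ge> 1" using N by simp
  have rX: "N ^ D * ?r \<le> X"
  proof -
    have "N ^ D * ?r = ?r * 1 * N ^ D" by simp
    also have "\<dots> \<le> X" unfolding X_def using k ND by (intro mult_le_mono) auto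
    finally show ?thesis .
  qed
  have "N ^ D * 1 \<le> N ^ D * ?r" using r by (rule mult_le_mono2)
  then have NX: "N ^ D \<le> X" using rX by linarith
  have X1: "X \<ge> 1" using NX ND1 by linarith
  have op: "N ^ D * (?r * op_time) = (?s0 + 6) * X"
  proof -
    have eq: "N ^ D * (N ^ D) ^ (\<kappa> - 1) = (N ^ D) ^ \<kappa>" using k by (cases \<kappa>) auto
    have "N ^ D * (?r * op_time) = (?s0 + 6) * (?r * (\<kappa> * \<kappa>) * (N ^ D * (N ^ D) ^ (\<kappa> - 1)))"
      unfolding op_time_def by (simp only: mult_ac)
    then show ?thesis unfolding X_def eq .
  qed
  have "close_time = 2 + 4 * N ^ D + N ^ D * (?r * op_time) + 2 * (N ^ D * ?r)"
    unfolding close_time_def by (simp add: algebra_simps)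
  then have close: "close_time \<le> (?s0 + 14) * X" using op NX X1 rX by (simp add: algebra_simps)
  have "?st + 11 + 4 * n \<le> (?st + 11 + 4 * n) * X" using X1 by simp
  then have "tuple_time gens + 4 * n + 9 \<le> (?st + 11 + 4 * n) * X + (?s0 + 14) * X"
    using close unfolding tuple_time_def by linarith
  also have "\<dots> = (?st + ?s0 + 4 * n + 25) * X" by (simp add: algebra_simps)
  finally have "N ^ n * (tuple_time gens + 4 * n + 9) \<le> N ^ n * ((?st + ?s0 + 4 * n + 25) * X)"
    by (rule mult_le_mono2)
  also have "\<dots> = (?st + ?s0 + 4 * n + 25) * (N ^ n * X)" by (rule mult.left_commute)
  finally have body: "N ^ n * (tuple_time gens + 4 * n + 9) \<le> (?st + ?s0 + 4 * n + 25) * (N ^ n * X)" .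
  have Y: "X \<le> N ^ n * X" using N by simp
  have "D * (2 + 3 * N ^ D) \<le> D * (5 * N ^ D)" using ND1 by (intro mult_le_mono2) linarith
  also have "\<dots> \<le> D * (5 * (N ^ n * X))" using NX Y by (intro mult_le_mono2) linarith
  finally have pow: "D * (2 + 3 * N ^ D) \<le> 5 * D * (N ^ n * X)" by simp
  have "10 \<le> 10 * (N ^ n * X)" using X1 Y by linarith
  with body pow have "10 + D * (2 + 3 * N ^ D) + N ^ n * (tuple_time gens + 4 * n + 9)
      \<le> 10 * (N ^ n * X) + 5 * D * (N ^ n * X) + (?st + ?s0 + 4 * n + 25) * (N ^ n * X)"
    by linarith
  also have "\<dots> \<le> search_constant n D gens eqs * (N ^ n * X)"
    unfolding search_constant_def start_time_def step_time_def
    by (simp flip: add_mult_distrib)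
  also have "\<dots> \<le> search_constant n D gens eqs * (3 * table_total N T ^ (n + D))"
  proof (rule mult_le_mono2)
    have "N \<le> N ^ fst t" if "t \<in> set T" for t using N arity[OF that] by (simp add: self_le_power)
    then have "?r * N \<le> table_total N T" by (rule table_total_ge(2))
    moreover have "N ^ \<kappa> \<le> table_total N T" using assms(3) table_total_ge(1) by blast
    ultimately show "N ^ n * X \<le> 3 * table_total N T ^ (n + D)"
      unfolding X_def using assms(1,2) k(2) by (intro search_time_core)
  qed
  finally show ?thesis by (simp add: mult_ac)
qed

subsection \<open>The cases after validation\<close>

definition search_code :: "nat \<Rightarrow> nat \<Rightarrow> nat list list \<Rightarrow> (nat \<times> nat) list \<Rightarrow> prog" where
  "search_code n D gens eqs = Cond (less_exp (Num 1) (Var Univ))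
     (Cond (Var Ops)
       (extend_times_to_power D ;; outer_code n D gens eqs ;; Answer ::= Var Every)
       (Answer ::= Num 0))
     (Answer ::= Num 1)"

definition validated :: "nat list \<Rightarrow> nat \<Rightarrow> (nat \<times> nat list) list \<Rightarrow> pstate \<Rightarrow> bool" where
  "validated w N T s \<longleftrightarrow> valid_input w N T \<and> holds w s \<and> times_ok N s \<and> vars s Ops = length T \<and>
     tables_read w T s \<and> length w \<le> vars s Filled \<and> arrs s Seen = (\<lambda>_. 0) \<and>
     arrs s Tuple = (\<lambda>_. 0) \<and> arrs s Zeros = (\<lambda>_. 0)"

text \<open>
  After validation, and if there are no constants among the operations, \<open>p\<close> decides \<open>L\<close> within the
  stated time.
\<close>

definition answers :: "prog \<Rightarrow> nat \<Rightarrow> nat \<Rightarrow> nat list set \<Rightarrow> bool" where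
  "answers p c e L \<longleftrightarrow> (\<forall>w N T s. validated w N T s \<longrightarrow> (\<forall>t\<in>set T. fst t \<ge> 1) \<longrightarrow>
     wp p (\<lambda>t. (vars t Answer > 0 \<longleftrightarrow> w \<in> L) \<and> clk t \<le> clk s + c * max 1 (table_total N T ^ e)) s)"

text \<open>
  Two inputs are kept away from the search. For \<open>N = 1\<close> the arities are not bounded by the size of the
  tables, and without operations \<open>N\<close> itself is not bounded by it.
\<close>

lemma answers_search_code:
  assumes sol: "solves n D gens eqs X G" and n: "n \<ge> 2"
    and X: "\<And>z. z \<in> X \<Longrightarrow> \<exists>g\<in>G. g z \<in> X \<and> g z \<noteq> z" "X \<noteq> {}"
    and G: "\<And>g z. g \<in> G \<Longrightarrow> z \<in> X \<Longrightarrow> g z \<in> X"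
  shows "answers (search_code n D gens eqs) (3 * search_constant n D gens eqs) (n + D) (Decide X G)"
  unfolding answers_def
proof (intro allI impI)
  fix w N T and s :: pstate
  assume s: "validated w N T s" and ar: "\<forall>t\<in>set T. fst t \<ge> 1"
  let ?L = "Decide X G" let ?C = "3 * search_constant n D gens eqs"
  define b where "b = ?C * max 1 (table_total N T ^ (n + D))"
  let ?Q = "\<lambda>t :: pstate. (vars t Answer > 0 \<longleftrightarrow> w \<in> ?L) \<and> clk t \<le> clk s + b"
  have w: "valid_input w N T" and N: "N \<ge> 1" and Univ: "vars s Univ = N" and Ops: "vars s Ops = length T"
    using s by (auto simp: validated_def valid_input_def times_ok_def)
  have "3 \<le> ?C * 1" unfolding search_constant_def by simp
  also have "?C * 1 \<le> ?C * max 1 (table_total N T ^ (n + D))" by (rule mult_le_mono2) simp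
  finally have b: "3 \<le> b" unfolding b_def .
  have "wp (search_code n D gens eqs) ?Q s"
  proof (cases "N \<ge> 2")
    case False
    then have "universe (table_algebra N T) = {0}" using N by (auto simp: table_algebra_def)
    then have "satisfies_loop (table_algebra N T) X G"
      by (rule satisfies_loop_singleton[OF _ X(2)]) (rule G)
    then have "w \<in> ?L" using Decide_iff(1)[OF sol w] by blast
    then show ?thesis using False Univ b by (simp add: search_code_def)
  next
    case N2: True
    show ?thesis
    proof (cases "T = []")
      case True
      have "\<not> satisfies_loop (table_algebra N T) X G"
        using True N2 X(1) by (intro not_satisfies_loop_projections[where u = 0 and v = 1])
          (auto simp: table_algebra_def)
      then show ?thesis using N2 Univ Ops True b Decide_iff(1)[OF sol w] by (simp add: search_code_def)
    next
      case False
      define \<kappa> where "\<kappa> = Max (fst ` set T)"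
      have scheme: "wellformed_scheme n D gens eqs" using sol by (simp add: solves_def)
      interpret search N D \<kappa> T eqs
        using N w ar scheme False
        by unfold_locales (auto simp: valid_input_def wellformed_scheme_def \<kappa>_def)
      let ?s = "tick (tick s)"
      have "wp (extend_times_to_power D) (\<lambda>t. times_ok N t \<and> vars t Filled \<ge> N ^ D \<and>
        vars t Filled \<ge> vars ?s Filled \<and> clk t \<le> clk ?s + 1 + D * (2 + 3 * N ^ D)) ?s"
        using s N length_valid_input(1)[OF w]
        by (intro wp_extend_times_to_power) (auto simp: validated_def times_ok_def)
      then have "wp (extend_times_to_power D) (wp (outer_code n D gens eqs) (wp (Answer ::= Var Every) ?Q)) ?s"
      proof (rule wp_conseq)
        fix t assume t: "times_ok N t \<and> vars t Filled \<ge> N ^ D \<and> vars t Filled \<ge> vars ?s Filled \<and>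
            clk t \<le> clk ?s + 1 + D * (2 + 3 * N ^ D)"
          and U0: "unchanged (wvars (extend_times_to_power D)) (warrs (extend_times_to_power D)) ?s t"
        have "unchanged {Power, Filled} {Times} ?s t"
          by (rule unchanged_mono[OF U0 frame_extend_times_to_power])
        then have U: "vars t Ops = length T" "arrs t Word = arrs s Word" "arrs t Arities = arrs s Arities"
          "arrs t Bases = arrs s Bases" "arrs t Seen = arrs s Seen" "arrs t Tuple = arrs s Tuple"
          "arrs t Zeros = arrs s Zeros"
          using Ops by (simp_all add: unchanged_def)
        have "env t"
          unfolding env_def
        proof (intro conjI allI impI)
          fix p assume p: "p < length T"
          have tab: "length (snd (T ! p)) = N ^ fst (T ! p)"
            using valid[OF nth_mem[OF p]] by (auto simp: valid_table_def split: prod.splits)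
          have read: "arrs s Arities p = fst (T ! p)"
            "\<And>i. i < N ^ fst (T ! p) \<Longrightarrow> w ! (arrs s Bases p + i) = snd (T ! p) ! i"
            "arrs s Bases p + N ^ fst (T ! p) \<le> length w"
            using s p tab by (auto simp: validated_def tables_read_def)
          show "arrs t Arities p = fst (T ! p)" using read(1) U by simp
          show "arrs t Word (arrs t Bases p + i) = snd (T ! p) ! i" if "i < N ^ fst (T ! p)" for i
            using read(2)[OF that] read(3) that s U by (simp add: validated_def holds_def)
          show "N ^ fst (T ! p) \<le> vars t Filled"
            using read(3) s t by (simp add: validated_def)
        qed (use t U in auto)
        moreover have "stamps_ok t" using s U by (simp add: validated_def stamps_ok_def)
        ultimately have "wp (outer_code n D gens eqs) (\<lambda>v.
            (vars v Every > 0 \<longleftrightarrow> digit_criterion N (map (table_op N) T) n D gens eqs) \<and>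
            clk v \<le> clk t + 3 + N ^ n * (tuple_time gens + 4 * n + 9)) t"
          using s U scheme by (intro wp_outer_code) (auto simp: validated_def)
        then show "wp (outer_code n D gens eqs) (wp (Answer ::= Var Every) ?Q) t"
        proof (rule wp_mono)
          fix v :: pstate assume v: "(vars v Every > 0 \<longleftrightarrow> digit_criterion N (map (table_op N) T) n D gens eqs) \<and>
            clk v \<le> clk t + 3 + N ^ n * (tuple_time gens + 4 * n + 9)"
          have "\<kappa> \<in> fst ` set T" unfolding \<kappa>_def using False by (intro Max_in) auto
          then have "\<exists>t\<in>set T. fst t = \<kappa>" by auto
          from outer_time[OF N2 n this, of gens]
          have "10 + D * (2 + 3 * N ^ D) + N ^ n * (tuple_time gens + 4 * n + 9) \<le> ?C * table_total N T ^ (n + D)" .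
          also have "\<dots> \<le> b" unfolding b_def by (rule mult_le_mono2) simp
          finally have "clk v + 1 \<le> clk s + b" using v t by simp
          then show "wp (Answer ::= Var Every) ?Q v" using v Decide_iff(2)[OF sol w] by simp
        qed
      qed
      then show ?thesis using N2 False Univ Ops by (simp add: search_code_def)
    qed
  qed
  then show "wp (search_code n D gens eqs) (\<lambda>t. (vars t Answer > 0 \<longleftrightarrow> w \<in> ?L) \<and>
      clk t \<le> clk s + ?C * max 1 (table_total N T ^ (n + D))) s" unfolding b_def .
qed

lemma answers_fixed_point:
  assumes "solves n D gens eqs X G" "z \<in> X" "\<forall>g\<in>G. g z = z"
  shows "answers (Answer ::= Num 1) 1 e (Decide X G)"
  unfolding answers_def validated_def
  using Decide_iff(1)[OF assms(1)] satisfies_loop_fixed_point[OF assms(2,3)] by auto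

lemma answers_empty:
  assumes "solves n D gens eqs {} G"
  shows "answers (Answer ::= Num 0) 1 e (Decide {} G)"
proof -
  have "\<not> satisfies_loop (table_algebra N T) {} G" if "\<forall>t\<in>set T. fst t \<ge> 1" for N T
  proof
    assume "satisfies_loop (table_algebra N T) {} G"
    then obtain f where "(0, f) \<in> set (operations (table_algebra N T))"
      unfolding satisfies_loop_def using term_ops_empty by blast
    then show False using that by (fastforce simp: table_algebra_def table_op_def)
  qed
  then show ?thesis unfolding answers_def validated_def using Decide_iff(1)[OF assms] by auto
qed

definition decide_code :: "prog \<Rightarrow> prog" where
  "decide_code p = load_code ;; validate_code ;;
     Cond (Var Ok) (Cond (Var Nullary) (Answer ::= Num 1) p) (Answer ::= Num 0)"

definition fresh :: "nat list \<Rightarrow> pstate \<Rightarrow> bool" where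
  "fresh u s \<longleftrightarrow> holds u s \<and> vars s Filled = 0 \<and> arrs s Times = (\<lambda>_. 0) \<and> arrs s Seen = (\<lambda>_. 0) \<and>
     arrs s Tuple = (\<lambda>_. 0) \<and> arrs s Zeros = (\<lambda>_. 0)"

text \<open>
  A function of the word alone; if the word encodes tables, \<open>parse\<close> recovers them.
\<close>

definition decide_time :: "nat \<Rightarrow> nat \<Rightarrow> nat list \<Rightarrow> nat" where
  "decide_time c e w = 50 * (length w + 1) ^ 2 + (if \<exists>N T. valid_input w N T
     then c * max 1 (table_total (w ! 0) (the (parse (w ! 0) (w ! 1) (drop 2 w))) ^ e) else 0)"

lemma decide_time_valid:
  assumes "valid_input w N T"
  shows "decide_time c e w = 50 * (length w + 1) ^ 2 + c * max 1 (table_total N T ^ e)"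
proof -
  have "w ! 0 = N" "parse (w ! 0) (w ! 1) (drop 2 w) = Some T" using assms by (auto simp: valid_input_parse)
  moreover have "\<exists>N T. valid_input w N T" using assms by blast
  ultimately show ?thesis unfolding decide_time_def by simp
qed

lemma decide_time_le: "decide_time c e w \<le> (50 + c) * Suc (length w) ^ (e + 2)"
proof -
  let ?L = "Suc (length w)"
  have sq: "50 * (length w + 1) ^ 2 \<le> 50 * ?L ^ (e + 2)"
    unfolding Suc_eq_plus1 by (intro mult_le_mono2 power_increasing) auto
  show ?thesis
  proof (cases "\<exists>N T. valid_input w N T")
    case True
    then obtain N T where T: "valid_input w N T" by blast
    have "table_total N T \<le> ?L" using length_valid_input(1)[OF T] by simp
    then have "table_total N T ^ e \<le> ?L ^ e" by (rule power_mono) simp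
    then have "max 1 (table_total N T ^ e) \<le> ?L ^ e" using one_le_power[of ?L e] by simp
    also have "\<dots> \<le> ?L ^ (e + 2)" by (intro power_increasing) auto
    finally have "c * max 1 (table_total N T ^ e) \<le> c * ?L ^ (e + 2)" by (rule mult_le_mono2)
    then show ?thesis unfolding decide_time_valid[OF T] add_mult_distrib using sq by linarith
  next
    case False
    then show ?thesis unfolding decide_time_def add_mult_distrib using sq by (simp only: if_False)
  qed
qed

lemma wp_decide_code:
  assumes sol: "solves n D gens eqs X G" and p: "answers p c e (Decide X G)"
    and s: "fresh u s" and w: "w = u @ inp s"
  shows "wp (decide_code p) (\<lambda>t. (vars t Answer > 0 \<longleftrightarrow> w \<in> Decide X G) \<and>
    clk t \<le> clk s + decide_time c e w) s"
proof -
  let ?L = "length w"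
  let ?end = "Cond (Var Ok) (Cond (Var Nullary) (Answer ::= Num 1) p) (Answer ::= Num 0)"
  let ?Q = "\<lambda>t :: pstate. (vars t Answer > 0 \<longleftrightarrow> w \<in> Decide X G) \<and> clk t \<le> clk s + decide_time c e w"
  have "wp load_code (wp validate_code (wp ?end ?Q)) s"
  proof (rule wp_conseq[OF wp_load_code])
    show "holds u s" using s by (simp add: fresh_def)
    fix t assume t: "holds (u @ inp s) t \<and> clk t \<le> clk s + 5 + 4 * length (inp s)"
      and U: "unchanged (wvars load_code) (warrs load_code) s t"
    have vals: "vars t Filled = 0" "arrs t Times = (\<lambda>_. 0)" "arrs t Seen = (\<lambda>_. 0)"
      "arrs t Tuple = (\<lambda>_. 0)" "arrs t Zeros = (\<lambda>_. 0)"
      using U s unfolding frame_load_code by (simp_all add: unchanged_def fresh_def)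
    have holds: "holds w t" using t w by simp
    have "wp validate_code (\<lambda>v. (vars v Ok > 0 \<longrightarrow> (\<exists>N T. valid_input w N T \<and> times_ok N v \<and>
        vars v Ops = length T \<and> tables_read w T v \<and> length w \<le> vars v Filled)) \<and>
      (vars v Ok = 0 \<longrightarrow> \<not> (\<exists>N T. valid_input w N T)) \<and> clk v \<le> clk t + 40 * (?L + 1) ^ 2) t"
      by (rule wp_validate_code[OF holds vals(1,2)])
    then show "wp validate_code (wp ?end ?Q) t"
    proof (rule wp_conseq)
      fix v assume v: "(vars v Ok > 0 \<longrightarrow> (\<exists>N T. valid_input w N T \<and> times_ok N v \<and>
          vars v Ops = length T \<and> tables_read w T v \<and> length w \<le> vars v Filled)) \<and>
        (vars v Ok = 0 \<longrightarrow> \<not> (\<exists>N T. valid_input w N T)) \<and> clk v \<le> clk t + 40 * (?L + 1) ^ 2"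
        and Uv: "unchanged (wvars validate_code) (warrs validate_code) t v"
      have time': "clk v + 3 \<le> clk s + 50 * (?L + 1) ^ 2"
      proof -
        have "length (inp s) \<le> ?L" using w by simp
        then have "clk v \<le> clk s + 5 + 4 * ?L + 40 * (?L + 1) ^ 2" using v t by linarith
        moreover have "8 + 4 * ?L + 40 * (?L + 1) ^ 2 \<le> 50 * (?L + 1) ^ 2"
          by (simp add: power2_eq_square algebra_simps)
        ultimately show ?thesis by linarith
      qed
      have "50 * (?L + 1) ^ 2 \<le> decide_time c e w" by (simp add: decide_time_def)
      with time' have time: "clk v + 3 \<le> clk s + decide_time c e w" by linarith
      show "wp ?end ?Q v"
      proof (cases "vars v Ok > 0")
        case False
        then have "w \<notin> Decide X G" using v Decide_valid_input by blast
        then show ?thesis using False time by simp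
      next
        case True
        then obtain N T where T: "valid_input w N T" "times_ok N v" "vars v Ops = length T"
          "tables_read w T v" "?L \<le> vars v Filled" using v by blast
        show ?thesis
        proof (cases "vars v Nullary > 0")
          case 1: True
          then obtain tab where "(0, tab) \<in> set T" using T(4) by (auto simp: tables_read_def)
          then have "(0, \<lambda>xs. tab ! horner N xs) \<in> set (operations (table_algebra N T))"
            by (force simp: table_algebra_def table_op_def)
          then have "w \<in> Decide X G" using Decide_iff(1)[OF sol T(1)] satisfies_loop_nullary by blast
          then show ?thesis using True 1 time by simp
        next
          case 2: False
          have "validated w N T (tick (tick v))"
          proof -
            have "holds w v" by (rule holds_unchanged[OF holds Uv]) (simp_all add: frame_validate_code)
            moreover have "arrs v Seen = (\<lambda>_. 0)" "arrs v Tuple = (\<lambda>_. 0)" "arrs v Zeros = (\<lambda>_. 0)"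
              using Uv vals unfolding frame_validate_code by (simp_all add: unchanged_def)
            ultimately show ?thesis
              using T by (simp add: validated_def holds_def times_ok_def tables_read_def)
          qed
          moreover have "\<forall>t\<in>set T. fst t \<ge> 1" using 2 T(4) by (auto simp: tables_read_def Suc_le_eq)
          ultimately have "wp p (\<lambda>x. (vars x Answer > 0 \<longleftrightarrow> w \<in> Decide X G) \<and>
              clk x \<le> clk (tick (tick v)) + c * max 1 (table_total N T ^ e)) (tick (tick v))"
            using p unfolding answers_def by blast
          then have "wp p ?Q (tick (tick v))"
            unfolding decide_time_valid[OF T(1)] using time' by (elim wp_mono) simp
          then show ?thesis using True 2 by simp
        qed
      qed
    qed
  qed
  then show ?thesis unfolding decide_code_def by simp
qed

definition initial :: "nat list \<Rightarrow> pstate" where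
  "initial w = \<lparr>vars = \<lambda>_. 0, arrs = \<lambda>_ _. 0, inp = w, clk = 0\<rparr>"

lemma program_from_wp:
  assumes "\<And>w. wp c (\<lambda>t. (vars t Answer > 0 \<longleftrightarrow> w \<in> L) \<and> clk t \<le> B w) (initial w)"
  obtains p b where "\<And>w. \<exists>t \<le> b * Suc (B w). halted p (run p w t) \<and> (accepting (run p w t) \<longleftrightarrow> w \<in> L)"
proof -
  obtain p b where p: "\<And>w s'. bigstep c (initial w) s' \<Longrightarrow>
    \<exists>t \<le> b * Suc (clk s'). halted p (run p w t) \<and> (accepting (run p w t) \<longleftrightarrow> vars s' Answer > 0)"
    using compiled_program_exists[of c Answer] unfolding initial_def by blast
  show thesis
  proof (rule that[of b p])
    fix w
    obtain s' where s': "bigstep c (initial w) s'" "vars s' Answer > 0 \<longleftrightarrow> w \<in> L" "clk s' \<le> B w"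
      using assms[of w] unfolding wp_def by (elim exE conjE) (rule that)
    obtain t where t: "t \<le> b * Suc (clk s')" "halted p (run p w t)"
      "accepting (run p w t) \<longleftrightarrow> vars s' Answer > 0"
      using p[OF s'(1)] by (elim exE conjE) (rule that)
    have "b * Suc (clk s') \<le> b * Suc (B w)" using s'(3) by (intro mult_le_mono2) simp
    then show "\<exists>t \<le> b * Suc (B w). halted p (run p w t) \<and> (accepting (run p w t) \<longleftrightarrow> w \<in> L)"
      using le_trans[OF t(1)] t(2,3) s'(2) by (intro exI[of _ t]) simp
  qed
qed

lemma fresh_initial: "fresh [] (initial w)"
  by (simp add: fresh_def initial_def holds_def)

subsection \<open>The core program for a group\<close>

lemma (in normal_stabilizers) core_exists:
  assumes M: "card (stab ` X) \<le> M" "M \<ge> 1"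
  obtains gens eqs p c where "solves (M * card X) (M * card G) gens eqs X G"
    "answers p c (M * card G + M * card X) (Decide X G)"
proof -
  let ?n = "M * card X" and ?D = "M * card G"
  obtain gens eqs where sol: "solves ?n ?D gens eqs X G" using scheme_exists[OF M(1)] by blast
  have "\<exists>p c. answers p c (?D + ?n) (Decide X G)"
  proof (cases "X = {}")
    case True
    then show ?thesis using answers_empty sol by blast
  next
    case nonempty: False
    show ?thesis
    proof (cases "\<exists>z\<in>X. \<forall>g\<in>G. g z = z")
      case True
      then show ?thesis using answers_fixed_point[OF sol] by blast
    next
      case False
      obtain z where z: "z \<in> X" using nonempty by blast
      then obtain g where g: "g \<in> G" "g z \<noteq> z" using False by blast
      have "card {z, g z} \<le> card X" using z maps[OF g(1) z] by (intro card_mono finite_X) auto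
      then have "card X \<ge> 2" using g(2) by simp
      then have n: "?n \<ge> 2" using M(2) mult_le_mono[of 1 M 2 "card X"] by simp
      then have "answers (search_code ?n ?D gens eqs) (3 * search_constant ?n ?D gens eqs) (?n + ?D) (Decide X G)"
        using sol False nonempty maps by (intro answers_search_code) blast+
      then show ?thesis by (metis add.commute)
    qed
  qed
  then show thesis using that sol by blast
qed

section \<open>Direct products of regular groups\<close>

text \<open>
  If all operations are constants, the time bound is a constant, whereas the input may be long. Such
  an input is recognized by its first operation, so it is accepted after three items.
\<close>

definition read_code :: prog where
  "read_code = Input Item store_item Skip"

definition quick_code :: "prog \<Rightarrow> prog" where
  "quick_code p = read_code ;; read_code ;; read_code ;;
     Cond (and_exp (Elt Word (Num 1)) (Minus (Num 1) (Elt Word (Num 2)))) (Answer ::= Num 1) (decide_code p)"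

lemma wp_read_code:
  assumes "fresh u s"
  shows "wp read_code (\<lambda>t. fresh (u @ take 1 (inp s)) t \<and> inp t = drop 1 (inp s) \<and> clk t \<le> clk s + 3) s"
  using assms
  by (cases "inp s") (auto simp: read_code_def store_item_def fresh_def holds_def nth_append less_Suc_eq)

lemma wp_quick_code:
  assumes "\<And>s. fresh (take 3 w) s \<Longrightarrow> inp s = drop 3 w \<Longrightarrow> clk s \<le> 9 \<Longrightarrow>
    wp (Cond (and_exp (Elt Word (Num 1)) (Minus (Num 1) (Elt Word (Num 2)))) (Answer ::= Num 1) (decide_code p)) Q s"
  shows "wp (quick_code p) Q (initial w)"
proof -
  have step: "wp read_code (\<lambda>t. fresh (take (Suc i) w) t \<and> inp t = drop (Suc i) w \<and> clk t \<le> 3 * Suc i) s"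
    if "fresh (take i w) s \<and> inp s = drop i w \<and> clk s \<le> 3 * i" for i s
  proof (rule wp_mono[OF wp_read_code[of "take i w" s]])
    show "fresh (take i w) s" using that by blast
    have inp: "take i w @ take 1 (inp s) = take (Suc i) w" "drop 1 (inp s) = drop (Suc i) w"
      using that by (simp_all add: take_add[of i 1 w, simplified, symmetric])
    fix t assume "fresh (take i w @ take 1 (inp s)) t \<and> inp t = drop 1 (inp s) \<and> clk t \<le> clk s + 3"
    then show "fresh (take (Suc i) w) t \<and> inp t = drop (Suc i) w \<and> clk t \<le> 3 * Suc i"
      unfolding inp using that by simp
  qed
  show ?thesis
    unfolding quick_code_def wp_Seq
  proof (rule wp_mono[OF step[of 0]])
    show "fresh (take 0 w) (initial w) \<and> inp (initial w) = drop 0 w \<and> clk (initial w) \<le> 3 * 0"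
      using fresh_initial by (simp add: initial_def)
  next
    fix s1 assume s1: "fresh (take (Suc 0) w) s1 \<and> inp s1 = drop (Suc 0) w \<and> clk s1 \<le> 3 * Suc 0"
    let ?c = "Cond (and_exp (Elt Word (Num 1)) (Minus (Num 1) (Elt Word (Num 2)))) (Answer ::= Num 1) (decide_code p)"
    show "wp read_code (wp read_code (wp ?c Q)) s1"
    proof (rule wp_mono[OF step[OF s1]])
      fix s2 assume s2: "fresh (take (Suc (Suc 0)) w) s2 \<and> inp s2 = drop (Suc (Suc 0)) w \<and> clk s2 \<le> 3 * Suc (Suc 0)"
      show "wp read_code (wp ?c Q) s2"
      proof (rule wp_mono[OF step[OF s2]])
        fix s3 assume "fresh (take (Suc (Suc (Suc 0))) w) s3 \<and> inp s3 = drop (Suc (Suc (Suc 0))) w \<and>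
          clk s3 \<le> 3 * Suc (Suc (Suc 0))"
        then show "wp ?c Q s3" by (intro assms) (simp_all add: eval_nat_numeral)
      qed
    qed
  qed
qed

lemma table_size_tables: "table_size A = table_total (card (universe A)) (tables_of A)"
  unfolding table_size_def table_total_def tables_of_def by (simp add: comp_def split_def)

lemma max_arity_ge: "t \<in> set (tables_of A) \<Longrightarrow> fst t \<le> max_arity A"
  unfolding max_arity_def tables_of_def by (intro Max_ge) force+

text \<open>
  Validation takes time quadratic in the length of the word, which is at most linear in the size of the
  tables. This is within the bound if some arity is positive, since the exponent is at least two. If
  there are no operations, the word has length two, and \<open>quick_code\<close> deals with the remaining
  inputs.
\<close>

lemma (in normal_stabilizers) solvable_in_product_time:
  assumes M: "card (stab ` X) \<le> M" "M \<ge> 1" and X: "X \<noteq> {}"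
  shows "solvable_in_time_O (Decide X G)
    (\<lambda>A. max 1 (max_arity A * table_size A ^ (M * card G + M * card X)))"
proof -
  let ?e = "M * card G + M * card X"
  obtain gens eqs p c where sol: "solves (M * card X) (M * card G) gens eqs X G"
    and p: "answers p c ?e (Decide X G)" using core_exists[OF M] by blast
  have "card G \<ge> 1" "card X \<ge> 1"
    using id_in finite_G X finite_X by (metis One_nat_def Suc_leI card_gt_0_iff empty_iff)+
  then have "1 * 1 \<le> M * card G" "1 * 1 \<le> M * card X" using M(2) by (intro mult_le_mono; simp)+
  then have e: "?e \<ge> 2" by linarith
  define T where "T A = max 1 (max_arity A * table_size A ^ ?e)" for A :: "nat algebra"
  have run: "wp (quick_code p) (\<lambda>t. (vars t Answer > 0 \<longleftrightarrow> encode A \<in> Decide X G) \<and>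
      clk t \<le> (2000 + c) * T A) (initial (encode A))" if A: "tabular A" for A
  proof -
    define N where "N = card (universe A)"
    let ?T = "tables_of A" and ?w = "encode A"
    let ?C = "(2000 + c) * T A"
    have w: "valid_input ?w N ?T" using encode_tables[OF A N_def] by (simp add: valid_input_def)
    have C: "(2000 + c) * 1 \<le> ?C" by (rule mult_le_mono2) (simp add: T_def)
    let ?Q = "\<lambda>t :: pstate. (vars t Answer > 0 \<longleftrightarrow> ?w \<in> Decide X G) \<and> clk t \<le> ?C"
    have main: "wp (decide_code p) ?Q s"
      if s: "fresh u s" "u @ inp s = ?w" "clk s \<le> 10" and ar: "?T = [] \<or> max_arity A \<ge> 1" for u s
    proof -
      let ?t = "table_total N ?T"
      have "wp (decide_code p) (\<lambda>t. (vars t Answer > 0 \<longleftrightarrow> ?w \<in> Decide X G) \<and>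
          clk t \<le> clk s + (50 * (length ?w + 1) ^ 2 + c * max 1 (?t ^ ?e))) s"
        using wp_decide_code[OF sol p s(1) s(2)[symmetric]] unfolding decide_time_valid[OF w] .
      moreover have "10 + 50 * (length ?w + 1) ^ 2 + c * max 1 (?t ^ ?e) \<le> ?C"
      proof (cases "?T = []")
        case True
        then have "?t = 0" "length ?w = 2" using length_valid_input(1)[OF w] by (simp_all add: table_total_def)
        moreover have "(0 :: nat) ^ ?e = 0" using e by (intro zero_power) linarith
        ultimately have eq: "10 + 50 * (length ?w + 1) ^ 2 + c * max 1 (?t ^ ?e) = 460 + c"
          by (simp only: power2_eq_square) simp
        show ?thesis unfolding eq by (rule order.trans[OF _ C]) simp
      next
        case False
        have "length ?T * 1 \<le> ?t" using w by (intro table_total_ge(2)) (simp add: valid_input_def)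
        then have t1: "?t \<ge> 1" using False by (cases ?T) auto
        have "length ?w + 1 \<le> 5 * ?t" using length_valid_input(2)[OF w] t1 by linarith
        then have "(length ?w + 1) ^ 2 \<le> (5 * ?t) ^ 2" by (rule power_mono) simp
        also have "\<dots> = 25 * ?t ^ 2" by (simp add: power2_eq_square)
        also have "\<dots> \<le> 25 * ?t ^ ?e" using t1 e by (intro mult_le_mono2 power_increasing)
        finally have "10 + 50 * (length ?w + 1) ^ 2 \<le> 10 * ?t ^ ?e + 1250 * ?t ^ ?e"
          using one_le_power[OF t1, of ?e] by linarith
        moreover have "max 1 (?t ^ ?e) = ?t ^ ?e" using one_le_power[OF t1, of ?e] by simp
        ultimately have "10 + 50 * (length ?w + 1) ^ 2 + c * max 1 (?t ^ ?e) \<le> (2000 + c) * ?t ^ ?e"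
          by (simp add: add_mult_distrib)
        also have "\<dots> \<le> ?C"
        proof (rule mult_le_mono2)
          have "1 * ?t ^ ?e \<le> max_arity A * ?t ^ ?e"
            by (rule mult_le_mono1) (use ar False in simp)
          then show "?t ^ ?e \<le> T A"
            unfolding T_def table_size_tables N_def[symmetric] mult_1 by (rule max.coboundedI2)
        qed
        finally show ?thesis .
      qed
      ultimately show ?thesis using s(3) by (elim wp_mono) auto
    qed
    show ?thesis
    proof (cases "operations A")
      case Nil
      then have T: "?T = []" by (simp add: tables_of_def)
      then have enc: "?w = [N, 0]" using w by (simp add: valid_input_def)
      show ?thesis
      proof (rule wp_quick_code)
        fix s assume s: "fresh (take 3 ?w) s" "inp s = drop 3 ?w" "clk s \<le> 9"
        have "arrs s Word 1 = 0" using s(1) by (auto simp: enc fresh_def holds_def)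
        moreover have "wp (decide_code p) ?Q (tick s)"
          using s T by (intro main[of "take 3 ?w"]) (auto simp: fresh_def holds_def)
        ultimately show "wp (Cond (and_exp (Elt Word (Num 1)) (Minus (Num 1) (Elt Word (Num 2))))
            (Answer ::= Num 1) (decide_code p)) ?Q s" by simp
      qed
    next
      case (Cons op ops)
      obtain k f where op: "op = (k, f)" by (cases op)
      obtain y v where enc: "?w = N # Suc (length ops) # k # y # v"
      proof -
        have N1: "N \<ge> 1" using w by (simp add: valid_input_def)
        have "map f (tuples N k) \<noteq> []" using N1 by (metis length_0_conv length_map length_tuples not_one_le_zero power_eq_0_iff)
        then obtain y v where "map f (tuples N k) = y # v" by (cases "map f (tuples N k)") auto
        then have "?w = N # Suc (length ops) # k # y # (v @ concat (map (\<lambda>(k, tab). k # tab) (tl ?T)))"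
          using w Cons op by (simp add: valid_input_def tables_of_def N_def)
        then show thesis using that by blast
      qed
      have first: "(k, map f (tuples N k)) \<in> set ?T" using Cons op by (simp add: tables_of_def N_def)
      show ?thesis
      proof (rule wp_quick_code)
        fix s assume s: "fresh (take 3 ?w) s" "inp s = drop 3 ?w" "clk s \<le> 9"
        have take: "take 3 ?w = [N, Suc (length ops), k]" by (simp add: enc eval_nat_numeral)
        have "holds [N, Suc (length ops), k] s" using s(1) unfolding take fresh_def by blast
        then have Word: "arrs s Word 1 = Suc (length ops)" "arrs s Word 2 = k"
          unfolding holds_def by (force simp: eval_nat_numeral)+
        show "wp (Cond (and_exp (Elt Word (Num 1)) (Minus (Num 1) (Elt Word (Num 2))))
            (Answer ::= Num 1) (decide_code p)) ?Q s"
        proof (cases "k = 0")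
          case True
          then have "satisfies_loop A X G" using satisfies_loop_nullary[of f A] Cons op by simp
          then have "?w \<in> Decide X G" using A unfolding Decide_def by blast
          moreover have "clk s + 2 \<le> ?C" by (rule order.trans[OF _ C]) (use s(3) in simp)
          ultimately show ?thesis using True Word by simp
        next
          case False
          then have "max_arity A \<ge> 1" using max_arity_ge[OF first] by simp
          then have "wp (decide_code p) ?Q (tick s)"
            using s by (intro main[of "take 3 ?w"]) (auto simp: fresh_def holds_def)
          then show ?thesis using Word False by simp
        qed
      qed
    qed
  qed
  obtain q b where q: "\<And>w s'. bigstep (quick_code p) (initial w) s' \<Longrightarrow>
    \<exists>t \<le> b * Suc (clk s'). halted q (run q w t) \<and> (accepting (run q w t) \<longleftrightarrow> vars s' Answer > 0)"
    using compiled_program_exists[of "quick_code p" Answer] unfolding initial_def by blast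
  show ?thesis
    unfolding solvable_in_time_O_def
  proof (rule exI[of _ q], rule exI[of _ "b * (2001 + c)"], intro allI impI)
    fix A :: "nat algebra" assume "tabular A"
    from run[OF this] obtain s' where s': "bigstep (quick_code p) (initial (encode A)) s'"
      "vars s' Answer > 0 \<longleftrightarrow> encode A \<in> Decide X G" "clk s' \<le> (2000 + c) * T A"
      unfolding wp_def by (elim exE conjE) (rule that)
    obtain t where t: "t \<le> b * Suc (clk s')" "halted q (run q (encode A) t)"
      "accepting (run q (encode A) t) \<longleftrightarrow> vars s' Answer > 0"
      using q[OF s'(1)] by (elim exE conjE) (rule that)
    have "Suc (clk s') \<le> (2001 + c) * T A"
      using s'(3) by (simp add: T_def add_mult_distrib)
    then have "b * Suc (clk s') \<le> b * ((2001 + c) * T A)" by (rule mult_le_mono2)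
    then have "t \<le> b * (2001 + c) * T A" using t(1) by (simp add: mult.assoc)
    then show "\<exists>t \<le> b * (2001 + c) * max 1 (max_arity A * table_size A ^ ?e).
        halted q (run q (encode A) t) \<and> (accepting (run q (encode A) t) \<longleftrightarrow> encode A \<in> Decide X G)"
      using t(2,3) s'(2) unfolding T_def by (intro exI[of _ t]) simp
  qed
qed

context
  fixes n :: nat and G :: "nat \<Rightarrow> 'g monoid"
  assumes n: "n \<ge> 1" and G: "\<And>i. i < n \<Longrightarrow> group (G i) \<and> finite (carrier (G i))"
begin

lemma translation_in: "i < n \<Longrightarrow> a \<in> carrier (G i) \<Longrightarrow> translation n G p (i, a) = (i, p i \<otimes>\<^bsub>G i\<^esub> a)"
  by (simp add: translation_def disjoint_carriers_def)

lemma translation_out: "z \<notin> disjoint_carriers n G \<Longrightarrow> translation n G p z = z"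
  by (simp add: translation_def)

lemma disjoint_carriersE:
  assumes "z \<in> disjoint_carriers n G"
  obtains i a where "i < n" "a \<in> carrier (G i)" "z = (i, a)"
  using assms by (auto simp: disjoint_carriers_def)

lemma carrier_productD: "p \<in> carrier (product_group {..<n} G) \<Longrightarrow> i < n \<Longrightarrow> p i \<in> carrier (G i)"
  by (auto simp: carrier_product_group)

lemma translation_comp:
  assumes p: "p \<in> carrier (product_group {..<n} G)" and q: "q \<in> carrier (product_group {..<n} G)"
  shows "translation n G p \<circ> translation n G q = translation n G (p \<otimes>\<^bsub>product_group {..<n} G\<^esub> q)"
proof
  fix z
  show "(translation n G p \<circ> translation n G q) z = translation n G (p \<otimes>\<^bsub>product_group {..<n} G\<^esub> q) z"
  proof (cases "z \<in> disjoint_carriers n G")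
    case True
    then obtain i a where z: "i < n" "a \<in> carrier (G i)" "z = (i, a)" by (rule disjoint_carriersE)
    interpret group "G i" using G z(1) by blast
    have "p i \<in> carrier (G i)" "q i \<in> carrier (G i)" using carrier_productD p q z(1) by blast+
    then show ?thesis using z by (simp add: translation_in m_assoc)
  qed (simp add: translation_out)
qed

lemma translation_one: "translation n G (\<one>\<^bsub>product_group {..<n} G\<^esub>) = id"
proof
  fix z
  show "translation n G (\<one>\<^bsub>product_group {..<n} G\<^esub>) z = id z"
  proof (cases "z \<in> disjoint_carriers n G")
    case True
    then obtain i a where z: "i < n" "a \<in> carrier (G i)" "z = (i, a)" by (rule disjoint_carriersE)
    interpret group "G i" using G z(1) by blast
    show ?thesis using z by (simp add: translation_in)
  qed (simp add: translation_out)
qed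

text \<open>
  In a regular group only the identity has a fixed point.
\<close>

lemma translation_fixes_block:
  assumes p: "p \<in> carrier (product_group {..<n} G)" and "i < n" "a \<in> carrier (G i)" "b \<in> carrier (G i)"
    and "translation n G p (i, a) = (i, a)"
  shows "translation n G p (i, b) = (i, b)"
proof -
  interpret group "G i" using G assms(2) by blast
  have "p i \<in> carrier (G i)" using carrier_productD p assms(2) by blast
  moreover have "p i \<otimes>\<^bsub>G i\<^esub> a = a" using assms by (simp add: translation_in)
  ultimately have "p i = \<one>\<^bsub>G i\<^esub>" using assms(3) by (metis r_cancel_one)
  then show ?thesis using assms by (simp add: translation_in)
qed

lemma normal_stabilizers_regular_product:
  "normal_stabilizers (disjoint_carriers n G) (regular_product n G)"
proof
  let ?P = "product_group {..<n} G" and ?X = "disjoint_carriers n G"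
  interpret P: group ?P by (rule product_group) (use G in auto)
  show "finite ?X" using G unfolding disjoint_carriers_def by (intro finite_SigmaI) auto
  have "finite (carrier ?P)" using G unfolding carrier_product_group by (intro finite_PiE) auto
  then show "finite (regular_product n G)" by (simp add: regular_product_def)
  show "id \<in> regular_product n G"
    unfolding regular_product_def using translation_one P.one_closed by (metis imageI)
  show "g \<circ> h \<in> regular_product n G" if "g \<in> regular_product n G" "h \<in> regular_product n G" for g h
    using that translation_comp P.m_closed unfolding regular_product_def by auto
  show "\<exists>h\<in>regular_product n G. h \<circ> g = id \<and> g \<circ> h = id" if g: "g \<in> regular_product n G" for g
  proof -
    obtain p where p: "p \<in> carrier ?P" "g = translation n G p" using g unfolding regular_product_def by blast
    let ?h = "translation n G (inv\<^bsub>?P\<^esub> p)"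
    have q: "inv\<^bsub>?P\<^esub> p \<in> carrier ?P" using p(1) by (rule P.inv_closed)
    have "?h \<circ> g = id" "g \<circ> ?h = id"
      unfolding p(2) translation_comp[OF q p(1)] translation_comp[OF p(1) q] P.l_inv[OF p(1)] P.r_inv[OF p(1)]
        translation_one by (rule refl)+
    moreover have "?h \<in> regular_product n G" unfolding regular_product_def using q by (rule imageI)
    ultimately show ?thesis by blast
  qed
  show maps: "g z \<in> ?X" if gz: "g \<in> regular_product n G" "z \<in> ?X" for g z
  proof -
    obtain p where p: "p \<in> carrier ?P" "g = translation n G p" using gz(1) unfolding regular_product_def by blast
    obtain i a where z: "i < n" "a \<in> carrier (G i)" "z = (i, a)" using gz(2) by (rule disjoint_carriersE)
    interpret group "G i" using G z(1) by blast
    show ?thesis using p z carrier_productD[OF p(1) z(1)] by (simp add: translation_in disjoint_carriers_def)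
  qed
  show "g z = z" if "g \<in> regular_product n G" "z \<notin> ?X" for g z
    using that(1) translation_out[OF that(2)] unfolding regular_product_def by (elim imageE) (simp only:)
  show "h (g z) = g z" if gh: "g \<in> regular_product n G" "h \<in> regular_product n G" "z \<in> ?X" "h z = z" for g h z
  proof -
    obtain p where p: "p \<in> carrier ?P" "g = translation n G p" using gh(1) unfolding regular_product_def by blast
    obtain q where q: "q \<in> carrier ?P" "h = translation n G q" using gh(2) unfolding regular_product_def by blast
    obtain i a where z: "i < n" "a \<in> carrier (G i)" "z = (i, a)" using gh(3) by (rule disjoint_carriersE)
    have "g z = (i, p i \<otimes>\<^bsub>G i\<^esub> a)" using p z by (simp add: translation_in)
    moreover from this have "p i \<otimes>\<^bsub>G i\<^esub> a \<in> carrier (G i)"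
      using maps[OF gh(1,3)] by (simp add: disjoint_carriers_def)
    ultimately show ?thesis using translation_fixes_block[OF q(1) z(1,2)] gh(4) q(2) z(3) by simp
  qed
qed

lemma solvable_regular_product:
  "solvable_in_time_O (Decide (disjoint_carriers n G) (regular_product n G))
    (\<lambda>A. max 1 (max_arity A *
      table_size A ^ (n * (card (regular_product n G) + (\<Sum>i<n. card (carrier (G i)))))))"
proof -
  let ?X = "disjoint_carriers n G" and ?H = "regular_product n G"
  interpret normal_stabilizers ?X ?H by (rule normal_stabilizers_regular_product)
  define o' where "o' i = (i, \<one>\<^bsub>G i\<^esub>)" for i
  have "stab z = stab (o' (fst z))" if zX: "z \<in> ?X" for z
  proof -
    obtain i a where z: "i < n" "a \<in> carrier (G i)" "z = (i, a)" using zX by (rule disjoint_carriersE)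
    interpret group "G i" using G z(1) by blast
    have "h z = z \<longleftrightarrow> h (o' i) = o' i" if h: "h \<in> ?H" for h
    proof -
      obtain p where p: "p \<in> carrier (product_group {..<n} G)" "h = translation n G p"
        using h unfolding regular_product_def by blast
      show ?thesis
        unfolding p(2) z(3) o'_def
        using translation_fixes_block[OF p(1) z(1) z(2) one_closed]
          translation_fixes_block[OF p(1) z(1) one_closed z(2)] by blast
    qed
    then show ?thesis unfolding stab_def z(3) fst_conv by blast
  qed
  then have "stab ` ?X \<subseteq> (\<lambda>i. stab (o' i)) ` {..<n}" by (force simp: disjoint_carriers_def)
  then have "card (stab ` ?X) \<le> card {..<n}" by (rule surj_card_le[rotated]) simp
  then have M: "card (stab ` ?X) \<le> n" by simp
  interpret G0: group "G 0" using G n by simp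
  have "(0, \<one>\<^bsub>G 0\<^esub>) \<in> ?X" using n by (simp add: disjoint_carriers_def)
  then have "?X \<noteq> {}" by blast
  moreover have "card ?X = (\<Sum>i<n. card (carrier (G i)))"
    using G unfolding disjoint_carriers_def by (subst card_SigmaI) auto
  ultimately show ?thesis
    using solvable_in_product_time[OF M n] by (simp add: add_mult_distrib2)
qed

end

section \<open>Cyclic groups\<close>

text \<open>
  In an abelian group, elements that fix \<open>z\<close> also fix \<open>g z\<close>.
\<close>

lemma normal_stabilizers_cyclic:
  assumes "\<pi> \<in> carrier (sym_group m)"
  shows "normal_stabilizers {1..m} (generate (sym_group m) {\<pi>})"
proof -
  let ?S = "sym_group m" and ?G = "generate (sym_group m) {\<pi>}"
  interpret S: group ?S by (rule sym_group_is_group)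
  have sub: "subgroup ?G ?S" using assms by (intro S.generate_is_subgroup) simp
  have perm: "g permutes {1..m}" if "g \<in> ?G" for g
    using subgroup.mem_carrier[OF sub that] by (simp add: sym_group_carrier)
  have commute: "g \<circ> h = h \<circ> g" if gh: "g \<in> ?G" "h \<in> ?G" for g h
  proof -
    obtain i j where "g = \<pi> [^]\<^bsub>?S\<^esub> (i :: int)" "h = \<pi> [^]\<^bsub>?S\<^esub> (j :: int)"
      using gh unfolding S.generate_pow[OF assms] by blast
    then have "g \<otimes>\<^bsub>?S\<^esub> h = h \<otimes>\<^bsub>?S\<^esub> g"
      using S.int_pow_mult[OF assms] by (metis add.commute)
    then show ?thesis by (simp add: sym_group_mult)
  qed
  show ?thesis
  proof
    show "finite ?G"
      by (rule finite_subset[OF _ finite_permutations[of "{1..m}"]]) (use perm in auto)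
    show "id \<in> ?G" using subgroup.one_closed[OF sub] by (simp add: sym_group_one)
    show "g \<circ> h \<in> ?G" if "g \<in> ?G" "h \<in> ?G" for g h
      using subgroup.m_closed[OF sub that] by (simp add: sym_group_mult)
    show "\<exists>h\<in>?G. h \<circ> g = id \<and> g \<circ> h = id" if g: "g \<in> ?G" for g
    proof (intro bexI conjI)
      have gS: "g \<in> carrier ?S" using subgroup.mem_carrier[OF sub g] .
      show "inv\<^bsub>?S\<^esub> g \<circ> g = id" using S.l_inv[OF gS] by (simp add: sym_group_mult sym_group_one)
      show "g \<circ> inv\<^bsub>?S\<^esub> g = id" using S.r_inv[OF gS] by (simp add: sym_group_mult sym_group_one)
      show "inv\<^bsub>?S\<^esub> g \<in> ?G" using subgroup.m_inv_closed[OF sub g] .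
    qed
    show "g z \<in> {1..m}" if "g \<in> ?G" "z \<in> {1..m}" for g z
      using permutes_in_image[OF perm[OF that(1)]] that(2) by blast
    show "g z = z" if "g \<in> ?G" "z \<notin> {1..m}" for g z
      using permutes_not_in[OF perm[OF that(1)] that(2)] .
    show "h (g z) = g z" if "g \<in> ?G" "h \<in> ?G" "h z = z" for g h z
      using commute[OF that(2,1)] that(3) by (metis comp_apply)
  qed simp
qed

subsection \<open>Logarithmic cost\<close>

lemma num_size_le: "x < 2 ^ b \<Longrightarrow> num_size x \<le> Suc b"
  unfolding num_size_def using floorlog_leI[of x 2 b] by simp

fun instr_const :: "instr \<Rightarrow> nat" where
  "instr_const (Const i c) = c"
| "instr_const _ = 0"

definition bounded :: "nat \<Rightarrow> config \<Rightarrow> bool" where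
  "bounded b c \<longleftrightarrow> (\<forall>r. fst (snd c) r < 2 ^ b) \<and> (\<forall>a\<in>set (snd (snd c)). a < 2 ^ b)"

lemma bounded_Suc: "bounded b c \<Longrightarrow> bounded (Suc b) c"
proof -
  have "x < 2 ^ b \<Longrightarrow> x < 2 ^ Suc b" for x :: nat by simp
  then show "bounded b c \<Longrightarrow> bounded (Suc b) c" unfolding bounded_def by blast
qed

lemma bounded_exec:
  assumes "bounded b c" "instr_const i < 2 ^ b" shows "bounded (Suc b) (exec i c)"
proof -
  obtain pc X w where c: "c = (pc, X, w)" by (cases c)
  have X: "X r < 2 ^ b" for r using assms(1) by (simp add: bounded_def c)
  have w: "a < 2 ^ b" if "a \<in> set w" for a using assms(1) that by (simp add: bounded_def c)
  have mono: "x < 2 ^ b \<Longrightarrow> x < 2 ^ Suc b" for x :: nat by simp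
  have "X j + X k < 2 ^ Suc b" "X j - X k < 2 ^ Suc b" for j k using X[of j] X[of k] by simp_all
  then show ?thesis
    using assms(2) mono[OF X] mono[OF w] unfolding c
    by (cases i; cases w) (auto simp: bounded_def simp del: power_Suc intro: mono)
qed

lemma bounded_cost: "bounded b c \<Longrightarrow> instr_cost i c \<le> 2 * Suc b"
proof -
  assume b: "bounded b c"
  obtain pc X w where c: "c = (pc, X, w)" by (cases c)
  have X: "num_size (X r) \<le> Suc b" for r using b num_size_le by (simp add: bounded_def c)
  have w: "num_size a \<le> Suc b" if "a \<in> set w" for a using b num_size_le that by (simp add: bounded_def c)
  have "num_size (X j) + num_size (X k) \<le> 2 * Suc b" "num_size (X j) \<le> 2 * Suc b" for j k
    using add_mono[OF X[of j] X[of k]] X[of j] by simp_all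
  moreover have "num_size a \<le> 2 * Suc b" if "a \<in> set w" for a using w[OF that] by simp
  ultimately show "instr_cost i c \<le> 2 * Suc b"
    unfolding c by (cases i; cases w) auto
qed

text \<open>
  Apart from loading a constant of the program, one instruction at most doubles the largest number,
  so after \<open>t\<close> steps all numbers have at most \<open>O(t)\<close> more bits than the input.
\<close>

lemma log_cost_le:
  assumes "\<And>i. i \<in> set p \<Longrightarrow> instr_const i < 2 ^ k"
  shows "log_cost p w t \<le> 2 * t * Suc (input_size w + k + t)"
proof -
  have "bounded (input_size w + k + s) (run p w s)" for s
  proof (induction s)
    case 0
    have "a < 2 ^ (input_size w + k)" if "a \<in> set w" for a
    proof -
      have "a < 2 ^ num_size a"
        using floorlog_leD[of 2 a "num_size a"] by (simp add: num_size_def)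
      also have "num_size a \<le> input_size w" unfolding input_size_def
        using that by (intro member_le_sum_list) auto
      then have "(2::nat) ^ num_size a \<le> 2 ^ (input_size w + k)" by (intro power_increasing) auto
      finally show ?thesis .
    qed
    then show ?case by (simp add: bounded_def run_def)
  next
    case (Suc s)
    let ?b = "input_size w + k + s"
    have run: "run p w (Suc s) = step p (run p w s)" by (simp add: run_def)
    show ?case
    proof (cases "halted p (run p w s)")
      case True
      then show ?thesis using bounded_Suc[OF Suc] unfolding run by (simp add: step_def)
    next
      case False
      then have "p ! fst (run p w s) \<in> set p" by (simp add: halted_def)
      then have "instr_const (p ! fst (run p w s)) < 2 ^ k" by (rule assms)
      also have "(2::nat) ^ k \<le> 2 ^ ?b" by (intro power_increasing) auto
      finally show ?thesis using bounded_exec[OF Suc] False unfolding run by (simp add: step_def)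
    qed
  qed
  then have cost: "step_cost p (run p w s) \<le> 2 * Suc (input_size w + k + s)" for s
    unfolding step_cost_def using bounded_cost[of "input_size w + k + s" "run p w s"] by (simp only: split: if_split) blast
  have "step_cost p (run p w s) \<le> 2 * Suc (input_size w + k + t)" if "s < t" for s
    by (rule order.trans[OF cost mult_le_mono2]) (use that in simp)
  then have "log_cost p w t \<le> (\<Sum>s<t. 2 * Suc (input_size w + k + t))"
    unfolding log_cost_def by (intro sum_mono) simp
  also have "\<dots> = 2 * t * Suc (input_size w + k + t)" by (simp only: sum_constant card_lessThan) simp
  finally show ?thesis .
qed

text \<open>
  A polynomial bound on the number of steps suffices, also in terms of the number of items instead of
  their total size.
\<close>

lemma in_class_P:
  assumes "\<And>w. \<exists>t \<le> a * Suc (length w) ^ e. halted p (run p w t) \<and> (accepting (run p w t) \<longleftrightarrow> w \<in> L)"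
  shows "L \<in> class_P"
proof -
  define k where "k = Suc (sum_list (map instr_const p))"
  have k: "instr_const i < 2 ^ k" if "i \<in> set p" for i
  proof -
    have "instr_const i \<le> sum_list (map instr_const p)" using that by (intro member_le_sum_list) auto
    also have "\<dots> < 2 ^ sum_list (map instr_const p)" by simp
    also have "\<dots> \<le> 2 ^ k" by (simp add: k_def)
    finally show ?thesis .
  qed
  define r where "r = [:a:] * [:1, 1:] ^ e"
  define q where "q = [:2:] * r * ([:Suc k, 1:] + r)"
  have r: "poly r x = a * Suc x ^ e" for x by (simp add: r_def poly_power)
  have q: "poly q x = 2 * (a * Suc x ^ e) * (Suc k + x + a * Suc x ^ e)" for x by (simp add: q_def r)
  have "\<exists>t. halted p (run p w t) \<and> log_cost p w t \<le> poly q (input_size w) \<and>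
      (accepting (run p w t) \<longleftrightarrow> w \<in> L)" for w
  proof -
    obtain t where t: "t \<le> a * Suc (length w) ^ e" "halted p (run p w t)"
      "accepting (run p w t) \<longleftrightarrow> w \<in> L" using assms by blast
    have "length w \<le> input_size w"
      unfolding input_size_def by (induction w) (auto simp: num_size_def)
    then have "Suc (length w) ^ e \<le> Suc (input_size w) ^ e" by (intro power_mono) auto
    then have t': "t \<le> a * Suc (input_size w) ^ e" using t(1) by (meson le_trans mult_le_mono2)
    have "log_cost p w t \<le> 2 * t * Suc (input_size w + k + t)" using log_cost_le[OF k] .
    also have "\<dots> \<le> poly q (input_size w)" unfolding q using t' by (intro mult_le_mono) auto
    finally show ?thesis using t(2,3) by blast
  qed
  then show ?thesis unfolding class_P_def by blast
qed

lemma (in normal_stabilizers) Decide_in_P: "Decide X G \<in> class_P"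
proof -
  \<comment> \<open>The number of points bounds the number of stabilizers; it is zero for \<open>X = {}\<close>.\<close>
  define M where "M = Suc (card X)"
  have M: "card (stab ` X) \<le> M" "M \<ge> 1" using card_image_le[OF finite_X, of stab] by (simp_all add: M_def)
  let ?e = "M * card G + M * card X"
  obtain gens eqs p c where sol: "solves (M * card X) (M * card G) gens eqs X G"
    and p: "answers p c ?e (Decide X G)" using core_exists[OF M] by blast
  have "wp (decide_code p) (\<lambda>t. (vars t Answer > 0 \<longleftrightarrow> w \<in> Decide X G) \<and>
      clk t \<le> (50 + c) * Suc (length w) ^ (?e + 2)) (initial w)" for w
  proof (rule wp_mono[OF wp_decide_code[OF sol p fresh_initial, of w]])
    show "w = [] @ inp (initial w)" by (simp add: initial_def)
    fix t :: pstate
    assume "(vars t Answer > 0 \<longleftrightarrow> w \<in> Decide X G) \<and> clk t \<le> clk (initial w) + decide_time c ?e w"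
    moreover have "clk (initial w) = 0" by (simp add: initial_def)
    ultimately show "(vars t Answer > 0 \<longleftrightarrow> w \<in> Decide X G) \<and> clk t \<le> (50 + c) * Suc (length w) ^ (?e + 2)"
      using decide_time_le[of c ?e w] by linarith
  qed
  then obtain q b where q: "\<And>w. \<exists>t \<le> b * Suc ((50 + c) * Suc (length w) ^ (?e + 2)).
      halted q (run q w t) \<and> (accepting (run q w t) \<longleftrightarrow> w \<in> Decide X G)"
    by (rule program_from_wp) (rule that)
  show ?thesis
  proof (rule in_class_P)
    fix w
    obtain t where t: "t \<le> b * Suc ((50 + c) * Suc (length w) ^ (?e + 2))" "halted q (run q w t)"
      "accepting (run q w t) \<longleftrightarrow> w \<in> Decide X G" using q by blast
    have bound: "Suc ((50 + c) * x) \<le> (51 + c) * x" if "1 \<le> x" for x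
      using that by (simp add: add_mult_distrib)
    have "Suc ((50 + c) * Suc (length w) ^ (?e + 2)) \<le> (51 + c) * Suc (length w) ^ (?e + 2)"
      by (rule bound[OF one_le_power]) simp
    then have "b * Suc ((50 + c) * Suc (length w) ^ (?e + 2)) \<le> b * ((51 + c) * Suc (length w) ^ (?e + 2))"
      by (rule mult_le_mono2)
    then have "t \<le> b * (51 + c) * Suc (length w) ^ (?e + 2)"
      unfolding mult.assoc by (rule order.trans[OF t(1)])
    then show "\<exists>t \<le> b * (51 + c) * Suc (length w) ^ (?e + 2). halted q (run q w t) \<and>
        (accepting (run q w t) \<longleftrightarrow> w \<in> Decide X G)"
      using t(2,3) by (intro exI[of _ t]) simp
  qed
qed

theorem corollary16:
  shows "(\<forall>(n::nat) (G :: nat \<Rightarrow> 'g monoid).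
            n \<ge> 1 \<and> (\<forall>i<n. group (G i) \<and> finite (carrier (G i))) \<longrightarrow>
            solvable_in_time_O (Decide (disjoint_carriers n G) (regular_product n G))
              (\<lambda>A. max 1 (max_arity A *
                 table_size A ^ (n * (card (regular_product n G) + (\<Sum>i<n. card (carrier (G i))))))))
       \<and> (\<forall>(m::nat) \<pi>. \<pi> \<in> carrier (sym_group m) \<longrightarrow>
            Decide {1..m} (generate (sym_group m) {\<pi>}) \<in> class_P)"
proof (intro conjI allI impI)
  fix n :: nat and G :: "nat \<Rightarrow> 'g monoid"
  assume "n \<ge> 1 \<and> (\<forall>i<n. group (G i) \<and> finite (carrier (G i)))"
  then show "solvable_in_time_O (Decide (disjoint_carriers n G) (regular_product n G))
      (\<lambda>A. max 1 (max_arity A *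
         table_size A ^ (n * (card (regular_product n G) + (\<Sum>i<n. card (carrier (G i)))))))"
    by (intro solvable_regular_product) auto
next
  fix m :: nat and \<pi> assume "\<pi> \<in> carrier (sym_group m)"
  then show "Decide {1..m} (generate (sym_group m) {\<pi>}) \<in> class_P"
    by (rule normal_stabilizers.Decide_in_P[OF normal_stabilizers_cyclic])
qed

end
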